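(* Let $k$ be a field, $n\ge2$, $F\in\mathrm{GL}_n(k)$ and $t\in\{0,1\}$. Then for any $\mathcal A_{F,t}$-bimodule $M$ and any $m>2$ we have $H_m(\mathcal A_{F,t},M)=(0)=H^m(\mathcal A_{F,t},M)$.
   Context: For $F=(\alpha_{ij})\in M_n(k)$ and $t\in k$, $\mathcal A_{F,t}$ is the $k$-algebra presented by generators $x_1,\ldots,x_n$ and the single relation $\sum_{i,j=1}^n\alpha_{ij}x_ix_j=t$. $H_*(A,M)$ and $H^*(A,M)$ denote Hochschild homology and cohomology of the $k$-algebra $A$ with coefficients in the bimodule $M$. *)

theory Defs
  imports
    "HOL-Analysis.Analysis"
    "HOL-Algebra.Algebra"
    "HOL-Algebra.Algebraic_Closure_Type"
    "HOL-Library.Poly_Mapping"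
begin

unbundle no fps_syntax

section \<open>Free algebras\<close>

text \<open>
  Words in an alphabet, with concatenation written additively: the convolution product that
  \<^theory>\<open>HOL-Library.Poly_Mapping\<close> puts on finitely supported functions
  \<open>'x free_word \<Rightarrow>\<^sub>0 'k\<close> is then the multiplication of the free associative unital
  \<open>'k\<close>-algebra on the alphabet.
\<close>

datatype 'x free_word = Free_Word (letters: "'x list")

instantiation free_word :: (type) monoid_add
begin

definition zero_free_word :: "'x free_word"
  where "zero_free_word = Free_Word []"

definition plus_free_word :: "'x free_word \<Rightarrow> 'x free_word \<Rightarrow> 'x free_word"
  where "plus_free_word u v = Free_Word (letters u @ letters v)"

instance
  by standard (simp_all add: zero_free_word_def plus_free_word_def)

end

type_synonym ('x, 'k) free_algebra = "'x free_word \<Rightarrow>\<^sub>0 'k"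

definition free_gen :: "'x \<Rightarrow> ('x, 'k::field) free_algebra"
  where "free_gen i = Poly_Mapping.single (Free_Word [i]) 1"

definition free_const :: "'k \<Rightarrow> ('x, 'k::field) free_algebra"
  where "free_const c = Poly_Mapping.single 0 c"


section \<open>Associative algebras over a field\<close>

locale assoc_algebra =
  fixes A :: "('k::field, 'a) module" (structure)
  assumes is_module: "module (ring_of_type_algebra :: 'k ring) A"
    and is_ring: "ring A"
    and smult_mult_left:
      "\<lbrakk>a \<in> carrier A; b \<in> carrier A\<rbrakk> \<Longrightarrow> (c \<odot> a) \<otimes> b = c \<odot> (a \<otimes> b)"
    and smult_mult_right:
      "\<lbrakk>a \<in> carrier A; b \<in> carrier A\<rbrakk> \<Longrightarrow> a \<otimes> (c \<odot> b) = c \<odot> (a \<otimes> b)"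

text \<open>Quotient of a free algebra by the two-sided ideal generated by a set of relators.\<close>

definition presented_algebra ::
  "('x, 'k::field) free_algebra set \<Rightarrow> ('k, ('x, 'k) free_algebra set) module"
  where "presented_algebra S =
    (let T = (ring_of_type_algebra :: ('x, 'k) free_algebra ring);
         I = Idl\<^bsub>T\<^esub> S;
         Q = T Quot I
     in \<lparr>carrier = carrier Q, monoid.mult = monoid.mult Q, one = one Q,
         ring.zero = ring.zero Q, add = add Q,
         smult = (\<lambda>c u. (I +>\<^bsub>T\<^esub> free_const c) \<otimes>\<^bsub>Q\<^esub> u)\<rparr>)"

lemma ring_of_type_algebra_is_ring: "ring (ring_of_type_algebra :: 'a::ring_1 ring)"
proof -
  have "\<exists>y. x + y = 0" for x :: 'a
    using add.right_inverse by blast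
  thus ?thesis
    unfolding ring_of_type_algebra_def using add.right_inverse
    by unfold_locales (auto simp: algebra_simps Units_def)
qed

lemma free_const_commute: "free_const c * p = p * (free_const c :: ('x, 'k::field) free_algebra)"
proof (induction p rule: update_induct)
  case const
  show ?case by simp
next
  case (update p w d)
  have eq: "Poly_Mapping.update w d p = p + Poly_Mapping.single w d"
    using update.hyps
    by (intro poly_mapping_eqI) (auto simp: lookup_update lookup_add lookup_single in_keys_iff when_def)
  have "free_const c * Poly_Mapping.single w d = Poly_Mapping.single w d * free_const c"
    unfolding free_const_def mult_single by (simp add: mult.commute)
  with update.IH show ?case
    unfolding eq distrib_left distrib_right by simp
qed

lemma assoc_algebra_presented_algebra: "assoc_algebra (presented_algebra S)"
proof -
  define T where "T = (ring_of_type_algebra :: ('a, 'b) free_algebra ring)"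
  define I where "I = Idl\<^bsub>T\<^esub> S"
  define Q where "Q = T Quot I"
  define e where "e c = I +>\<^bsub>T\<^esub> free_const c" for c
  interpret T: ring T unfolding T_def by (rule ring_of_type_algebra_is_ring)
  have carT: "carrier T = UNIV" by (simp add: T_def ring_of_type_algebra_def)
  have I: "ideal I T" unfolding I_def by (rule T.genideal_ideal) (simp add: carT)
  interpret I: ideal I T by (rule I)
  interpret Q: ring Q unfolding Q_def by (rule I.quotient_is_ring)
  interpret h: ring_hom_ring T Q "\<lambda>p. I +>\<^bsub>T\<^esub> p"
    unfolding Q_def by (rule I.rcos_ring_hom_ring)
  have A: "presented_algebra S = \<lparr>carrier = carrier Q, monoid.mult = monoid.mult Q, one = one Q,
         ring.zero = ring.zero Q, add = add Q, smult = (\<lambda>c u. e c \<otimes>\<^bsub>Q\<^esub> u)\<rparr>"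
    by (simp add: presented_algebra_def Let_def e_def Q_def I_def T_def)
  have e_carr: "e c \<in> carrier Q" for c unfolding e_def by (rule h.hom_closed) (simp add: carT)
  have e_add: "e (c + d) = e c \<oplus>\<^bsub>Q\<^esub> e d" for c d
  proof -
    have "free_const (c + d) = free_const c \<oplus>\<^bsub>T\<^esub> free_const d"
      by (simp add: T_def ring_of_type_algebra_def free_const_def single_add)
    thus ?thesis unfolding e_def by (simp add: carT)
  qed
  have e_mult: "e (c * d) = e c \<otimes>\<^bsub>Q\<^esub> e d" for c d
  proof -
    have "free_const (c * d) = free_const c \<otimes>\<^bsub>T\<^esub> free_const d"
      by (simp add: T_def ring_of_type_algebra_def free_const_def mult_single)
    thus ?thesis unfolding e_def by (simp add: carT)
  qed
  have e_one: "e 1 = \<one>\<^bsub>Q\<^esub>"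
  proof -
    have "free_const 1 = \<one>\<^bsub>T\<^esub>"
      by (simp add: T_def ring_of_type_algebra_def free_const_def)
    thus ?thesis unfolding e_def by simp
  qed
  have e_comm: "e c \<otimes>\<^bsub>Q\<^esub> u = u \<otimes>\<^bsub>Q\<^esub> e c" if "u \<in> carrier Q" for c u
  proof -
    from that obtain p where p: "u = I +>\<^bsub>T\<^esub> p"
      unfolding Q_def FactRing_def A_RCOSETS_def' by force
    have "free_const c \<otimes>\<^bsub>T\<^esub> p = p \<otimes>\<^bsub>T\<^esub> free_const c"
      unfolding T_def ring_of_type_algebra_def monoid.simps by (rule free_const_commute)
    thus ?thesis
      unfolding e_def p using h.hom_mult[of "free_const c" p] h.hom_mult[of p "free_const c"]
      by (metis UNIV_I carT)
  qed
  have "\<exists>v\<in>carrier Q. v \<oplus>\<^bsub>Q\<^esub> u = \<zero>\<^bsub>Q\<^esub>" if "u \<in> carrier Q" for u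
    using that Q.l_neg Q.a_inv_closed by blast
  hence ring: "ring (presented_algebra S)"
    unfolding A
    by (intro ringI abelian_groupI monoidI)
       (simp_all add: Q.add.m_ac Q.m_assoc Q.l_distr Q.r_distr)
  have e_lcomm: "u \<otimes>\<^bsub>Q\<^esub> (e c \<otimes>\<^bsub>Q\<^esub> v) = e c \<otimes>\<^bsub>Q\<^esub> (u \<otimes>\<^bsub>Q\<^esub> v)"
    if "u \<in> carrier Q" "v \<in> carrier Q" for c u v
  proof -
    have "u \<otimes>\<^bsub>Q\<^esub> (e c \<otimes>\<^bsub>Q\<^esub> v) = (u \<otimes>\<^bsub>Q\<^esub> e c) \<otimes>\<^bsub>Q\<^esub> v"
      using that by (simp add: Q.m_assoc e_carr)
    also have "\<dots> = (e c \<otimes>\<^bsub>Q\<^esub> u) \<otimes>\<^bsub>Q\<^esub> v"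
      using that by (simp only: e_comm)
    finally show ?thesis
      using that by (simp add: Q.m_assoc e_carr)
  qed
  have module: "module (ring_of_type_algebra :: 'b ring) (presented_algebra S)"
  proof (rule moduleI)
    show "cring (ring_of_type_algebra :: 'b ring)"
      by (rule cring_from_type_algebra)
    show "abelian_group (presented_algebra S)"
      using ring by (rule ring.is_abelian_group)
  qed (simp_all add: A ring_of_type_algebra_def e_carr e_add e_mult e_one
         Q.l_distr Q.r_distr Q.m_assoc)
  show ?thesis
    by (rule assoc_algebra.intro[OF module ring])
       (simp_all add: A e_carr e_lcomm Q.m_assoc)
qed

definition AFt :: "'k^'n^'n \<Rightarrow> 'k \<Rightarrow> ('k::field, ('n::finite, 'k) free_algebra set) module"
  where "AFt F t = presented_algebra
    {(\<Sum>i\<in>UNIV. \<Sum>j\<in>UNIV. free_const (F $ i $ j) * free_gen i * free_gen j) - free_const t}"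


section \<open>Bimodules\<close>

text \<open>
  Unital bimodules on which the two induced actions of the ground field agree (they are both
  \<open>scl\<close>).
\<close>

locale alg_bimodule = assoc_algebra A
  for A :: "('k::field, 'a) module" (structure) +
  fixes scl :: "'k \<Rightarrow> 'm::ab_group_add \<Rightarrow> 'm"
    and lact :: "'a \<Rightarrow> 'm \<Rightarrow> 'm"
    and ract :: "'m \<Rightarrow> 'a \<Rightarrow> 'm"
  assumes is_vector_space: "vector_space scl"
    and lact_add_right: "a \<in> carrier A \<Longrightarrow> lact a (x + y) = lact a x + lact a y"
    and lact_add_left:
      "\<lbrakk>a \<in> carrier A; b \<in> carrier A\<rbrakk> \<Longrightarrow> lact (a \<oplus> b) x = lact a x + lact b x"
    and lact_scale_right: "a \<in> carrier A \<Longrightarrow> lact a (scl c x) = scl c (lact a x)"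
    and lact_scale_left: "a \<in> carrier A \<Longrightarrow> lact (c \<odot> a) x = scl c (lact a x)"
    and lact_one: "lact \<one> x = x"
    and lact_mult:
      "\<lbrakk>a \<in> carrier A; b \<in> carrier A\<rbrakk> \<Longrightarrow> lact (a \<otimes> b) x = lact a (lact b x)"
    and ract_add_left: "a \<in> carrier A \<Longrightarrow> ract (x + y) a = ract x a + ract y a"
    and ract_add_right:
      "\<lbrakk>a \<in> carrier A; b \<in> carrier A\<rbrakk> \<Longrightarrow> ract x (a \<oplus> b) = ract x a + ract x b"
    and ract_scale_left: "a \<in> carrier A \<Longrightarrow> ract (scl c x) a = scl c (ract x a)"
    and ract_scale_right: "a \<in> carrier A \<Longrightarrow> ract x (c \<odot> a) = scl c (ract x a)"
    and ract_one: "ract x \<one> = x"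
    and ract_mult:
      "\<lbrakk>a \<in> carrier A; b \<in> carrier A\<rbrakk> \<Longrightarrow> ract x (a \<otimes> b) = ract (ract x a) b"
    and lact_ract:
      "\<lbrakk>a \<in> carrier A; b \<in> carrier A\<rbrakk> \<Longrightarrow> ract (lact a x) b = lact a (ract x b)"


section \<open>The Hochschild complexes\<close>

definition alg_tuples :: "('k, 'a) module \<Rightarrow> nat \<Rightarrow> 'a list set"
  where "alg_tuples A m = {as. length as = m \<and> set as \<subseteq> carrier A}"

text \<open>Replaces the (0-based) entries \<open>i\<close> and \<open>i + 1\<close> of a tuple by their product.\<close>

definition contract :: "('k, 'a) module \<Rightarrow> nat \<Rightarrow> 'a list \<Rightarrow> 'a list"
  where "contract A i as = take i as @ (as ! i \<otimes>\<^bsub>A\<^esub> as ! Suc i) # drop (i + 2) as"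


subsection \<open>Homology\<close>

text \<open>
  The tensor product of \<open>M\<close> with \<open>m\<close> copies of \<open>A\<close> over the ground field, as a quotient of
  the free abelian group on pairs of an element of \<open>M\<close> and an \<open>m\<close>-tuple in \<open>A\<close>. Besides
  additivity in each slot, only moving a scalar between \<open>M\<close> and an \<open>A\<close>-slot is imposed;
  moving it between two \<open>A\<close>-slots follows.
\<close>

definition tensor_free :: "('k, 'a) module \<Rightarrow> nat \<Rightarrow> (('m \<times> 'a list) \<Rightarrow>\<^sub>0 int) monoid"
  where "tensor_free A m = free_Abelian_group (UNIV \<times> alg_tuples A m)"

definition tensor_relators ::
  "('k, 'a) module \<Rightarrow> ('k \<Rightarrow> 'm::ab_group_add \<Rightarrow> 'm) \<Rightarrow> nat \<Rightarrow> (('m \<times> 'a list) \<Rightarrow>\<^sub>0 int) set"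
  where "tensor_relators A scl m =
    {frag_of (x + y, as) - frag_of (x, as) - frag_of (y, as) | x y as.
       as \<in> alg_tuples A m} \<union>
    {frag_of (x, as[i := a \<oplus>\<^bsub>A\<^esub> b]) - frag_of (x, as[i := a]) - frag_of (x, as[i := b]) | x as i a b.
       as \<in> alg_tuples A m \<and> i < m \<and> a \<in> carrier A \<and> b \<in> carrier A} \<union>
    {frag_of (scl c x, as[i := a]) - frag_of (x, as[i := c \<odot>\<^bsub>A\<^esub> a]) | c x as i a.
       as \<in> alg_tuples A m \<and> i < m \<and> a \<in> carrier A}"

definition tensor_null ::
  "('k, 'a) module \<Rightarrow> ('k \<Rightarrow> 'm::ab_group_add \<Rightarrow> 'm) \<Rightarrow> nat \<Rightarrow> (('m \<times> 'a list) \<Rightarrow>\<^sub>0 int) set"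
  where "tensor_null A scl m = generate (tensor_free A m) (tensor_relators A scl m)"

definition hochschild_chains ::
  "('k, 'a) module \<Rightarrow> ('k \<Rightarrow> 'm::ab_group_add \<Rightarrow> 'm) \<Rightarrow> nat
    \<Rightarrow> (('m \<times> 'a list) \<Rightarrow>\<^sub>0 int) set monoid"
  where "hochschild_chains A scl m = tensor_free A m Mod tensor_null A scl m"

fun hochschild_boundary_gen ::
  "('k, 'a) module \<Rightarrow> ('a \<Rightarrow> 'm \<Rightarrow> 'm) \<Rightarrow> ('m \<Rightarrow> 'a \<Rightarrow> 'm)
    \<Rightarrow> 'm \<times> 'a list \<Rightarrow> (('m \<times> 'a list) \<Rightarrow>\<^sub>0 int)"
  where
    "hochschild_boundary_gen A lact ract (x, []) = 0"
  | "hochschild_boundary_gen A lact ract (x, a # as) =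
       frag_of (ract x a, as)
       + (\<Sum>i<length as. frag_cmul ((-1) ^ Suc i) (frag_of (x, contract A i (a # as))))
       + frag_cmul ((-1) ^ length (a # as)) (frag_of (lact (last (a # as)) x, butlast (a # as)))"

text \<open>The map induced on the quotients; it is used for \<open>m > 0\<close> only.\<close>

definition hochschild_boundary ::
  "('k, 'a) module \<Rightarrow> ('k \<Rightarrow> 'm::ab_group_add \<Rightarrow> 'm) \<Rightarrow> ('a \<Rightarrow> 'm \<Rightarrow> 'm) \<Rightarrow> ('m \<Rightarrow> 'a \<Rightarrow> 'm)
    \<Rightarrow> nat \<Rightarrow> (('m \<times> 'a list) \<Rightarrow>\<^sub>0 int) set \<Rightarrow> (('m \<times> 'a list) \<Rightarrow>\<^sub>0 int) set"
  where "hochschild_boundary A scl lact ract m u =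
    (\<Union>z\<in>u. tensor_null A scl (m - 1) #>\<^bsub>tensor_free A (m - 1)\<^esub>
              frag_extend (hochschild_boundary_gen A lact ract) z)"

definition hochschild_cycles ::
  "('k, 'a) module \<Rightarrow> ('k \<Rightarrow> 'm::ab_group_add \<Rightarrow> 'm) \<Rightarrow> ('a \<Rightarrow> 'm \<Rightarrow> 'm) \<Rightarrow> ('m \<Rightarrow> 'a \<Rightarrow> 'm)
    \<Rightarrow> nat \<Rightarrow> (('m \<times> 'a list) \<Rightarrow>\<^sub>0 int) set set"
  where "hochschild_cycles A scl lact ract m =
    (if m = 0 then carrier (hochschild_chains A scl 0)
     else kernel (hochschild_chains A scl m) (hochschild_chains A scl (m - 1))
            (hochschild_boundary A scl lact ract m))"

definition hochschild_homology ::
  "('k, 'a) module \<Rightarrow> ('k \<Rightarrow> 'm::ab_group_add \<Rightarrow> 'm) \<Rightarrow> ('a \<Rightarrow> 'm \<Rightarrow> 'm) \<Rightarrow> ('m \<Rightarrow> 'a \<Rightarrow> 'm)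
    \<Rightarrow> nat \<Rightarrow> (('m \<times> 'a list) \<Rightarrow>\<^sub>0 int) set set monoid"
  where "hochschild_homology A scl lact ract m =
    subgroup_generated (hochschild_chains A scl m) (hochschild_cycles A scl lact ract m)
      Mod (hochschild_boundary A scl lact ract (Suc m) ` carrier (hochschild_chains A scl (Suc m)))"


subsection \<open>Cohomology\<close>

text \<open>
  Cochains of degree \<open>m\<close> are the multilinear maps from \<open>m\<close>-tuples in \<open>A\<close> to \<open>M\<close>; they are
  normalised to be zero on all other lists, so that equality of cochains is equality of functions.
\<close>

definition multilinear_on ::
  "('k, 'a) module \<Rightarrow> ('k \<Rightarrow> 'm::ab_group_add \<Rightarrow> 'm) \<Rightarrow> nat \<Rightarrow> ('a list \<Rightarrow> 'm) \<Rightarrow> bool"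
  where "multilinear_on A scl m f \<longleftrightarrow>
    (\<forall>as\<in>alg_tuples A m. \<forall>i<m. \<forall>a\<in>carrier A.
       (\<forall>b\<in>carrier A. f (as[i := a \<oplus>\<^bsub>A\<^esub> b]) = f (as[i := a]) + f (as[i := b])) \<and>
       (\<forall>c. f (as[i := c \<odot>\<^bsub>A\<^esub> a]) = scl c (f (as[i := a]))))"

definition hochschild_cochains ::
  "('k, 'a) module \<Rightarrow> ('k \<Rightarrow> 'm::ab_group_add \<Rightarrow> 'm) \<Rightarrow> nat \<Rightarrow> ('a list \<Rightarrow> 'm) monoid"
  where "hochschild_cochains A scl m =
    \<lparr>carrier = {f. multilinear_on A scl m f \<and> (\<forall>as. as \<notin> alg_tuples A m \<longrightarrow> f as = 0)},
     monoid.mult = (\<lambda>f g as. f as + g as),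
     one = (\<lambda>as. 0)\<rparr>"

definition hochschild_coboundary ::
  "('k::field, 'a) module \<Rightarrow> ('k \<Rightarrow> 'm::ab_group_add \<Rightarrow> 'm) \<Rightarrow> ('a \<Rightarrow> 'm \<Rightarrow> 'm) \<Rightarrow> ('m \<Rightarrow> 'a \<Rightarrow> 'm)
    \<Rightarrow> nat \<Rightarrow> ('a list \<Rightarrow> 'm) \<Rightarrow> 'a list \<Rightarrow> 'm"
  where "hochschild_coboundary A scl lact ract m f as =
    (if as \<in> alg_tuples A (Suc m) then
       lact (hd as) (f (tl as))
       + (\<Sum>i<m. scl ((-1) ^ Suc i) (f (contract A i as)))
       + scl ((-1) ^ Suc m) (ract (f (butlast as)) (last as))
     else 0)"

definition hochschild_coboundaries ::
  "('k::field, 'a) module \<Rightarrow> ('k \<Rightarrow> 'm::ab_group_add \<Rightarrow> 'm) \<Rightarrow> ('a \<Rightarrow> 'm \<Rightarrow> 'm) \<Rightarrow> ('m \<Rightarrow> 'a \<Rightarrow> 'm)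
    \<Rightarrow> nat \<Rightarrow> ('a list \<Rightarrow> 'm) set"
  where "hochschild_coboundaries A scl lact ract m =
    (if m = 0 then {\<lambda>as. 0}
     else hochschild_coboundary A scl lact ract (m - 1) ` carrier (hochschild_cochains A scl (m - 1)))"

definition hochschild_cohomology ::
  "('k::field, 'a) module \<Rightarrow> ('k \<Rightarrow> 'm::ab_group_add \<Rightarrow> 'm) \<Rightarrow> ('a \<Rightarrow> 'm \<Rightarrow> 'm) \<Rightarrow> ('m \<Rightarrow> 'a \<Rightarrow> 'm)
    \<Rightarrow> nat \<Rightarrow> ('a list \<Rightarrow> 'm) set monoid"
  where "hochschild_cohomology A scl lact ract m =
    subgroup_generated (hochschild_cochains A scl m)
      (kernel (hochschild_cochains A scl m) (hochschild_cochains A scl (Suc m))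
         (hochschild_coboundary A scl lact ract m))
      Mod hochschild_coboundaries A scl lact ract m"

end

theory Submission
  imports Defs
begin

text \<open>
  The algebra \<open>A\<close> is the quotient of the free algebra \<open>T\<close> on \<open>n\<close> generators \<open>x\<^sub>i\<close> by the ideal \<open>I\<close>
  generated by the single relator \<open>rho\<close>, the quadratic form minus \<open>t\<close>. The reason for the vanishing
  is that \<open>A\<close> has a projective bimodule resolution of length two,
  \<open>0 \<rightarrow> A \<otimes> A \<rightarrow> A \<otimes> V \<otimes> A \<rightarrow> A \<otimes> A \<rightarrow> A \<rightarrow> 0\<close>, where \<open>V\<close> is spanned by the generators and the first map
  sends \<open>1 \<otimes> 1\<close> to the universal derivative of \<open>rho\<close>. For any presentation, \<open>T\<close> being hereditary,
  such a sequence is exact with the conormal bimodule \<open>I / I\<^sup>2\<close> in place of its first term. So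
  everything rests on the fact that \<open>I / I\<^sup>2\<close> is free on the class of \<open>rho\<close> (\<open>relation_free\<close>).

  Freeness is proved by length. Invertibility of the matrix and the existence of two generators
  imply that in the associated graded algebra right multiplication by a nonzero linear form is
  injective, and that there are no unexpected consequences of \<open>rho\<close> of small length
  (\<open>right_regular\<close>, \<open>rel_low_descend\<close>). If \<open>w\<close> in \<open>A \<otimes> A\<close> is annihilated by the derivative of \<open>rho\<close>,
  then the product of its first factor with a linear form is as long as that factor itself, which
  forces \<open>w = 0\<close>.

  Resolutions are not compared. Instead the freeness is used to write down one bimodule endomorphism
  of the fourth tensor power of \<open>A\<close>, the term of degree two of the bar resolution, that has the same
  differential as the identity and kills boundaries (\<open>resolution_endomorphism\<close>): it says that the
  second syzygy is projective. From it, bimodule homotopies that contract the bar resolution in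
  all degrees above two arise by iteration (\<open>contraction_above\<close>). Evaluating them in coefficients
  gives contractions of the Hochschild complexes in these degrees.

  All computations in tensor powers of \<open>A\<close> take place in tensor powers of \<open>T\<close>, which have bases
  of lists of words, modulo the subspace \<open>null\<close> where one tensor factor lies in \<open>I\<close>. Chains and
  cochains are treated together, as maps from tensor powers to an abelian group modulo a subgroup
  (locale \<open>coefficients\<close>): a chain element is evaluated modulo the relations of the tensor product,
  a cochain modulo zero.
\<close>

section \<open>Linear maps between spaces of finitely supported functions\<close>

definition pscale :: "'k::field \<Rightarrow> ('i \<Rightarrow>\<^sub>0 'k) \<Rightarrow> ('i \<Rightarrow>\<^sub>0 'k)"
  where "pscale c p = Poly_Mapping.map ((*) c) p"

lemma lookup_pscale [simp]: "Poly_Mapping.lookup (pscale c p) i = c * Poly_Mapping.lookup p i"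
  unfolding pscale_def by (simp add: Poly_Mapping.map.rep_eq when_def)

interpretation pm: vector_space pscale
  by unfold_locales (auto intro!: poly_mapping_eqI simp: lookup_add algebra_simps)

interpretation pmp: vector_space_pair pscale pscale ..

abbreviation plinear :: "(('i \<Rightarrow>\<^sub>0 'k::field) \<Rightarrow> ('j \<Rightarrow>\<^sub>0 'k)) \<Rightarrow> bool"
  where "plinear \<equiv> Vector_Spaces.linear pscale pscale"

abbreviation bvec :: "'i \<Rightarrow> ('i \<Rightarrow>\<^sub>0 'k::field)"
  where "bvec i \<equiv> Poly_Mapping.single i 1"

lemma plinearI:
  assumes "\<And>x y. f (x + y) = f x + f y" "\<And>c x. f (pscale c x) = pscale c (f x)"
  shows "plinear f"
  using assms by (intro Vector_Spaces.linear.intro) (unfold_locales, auto)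

lemma plinear_id [simp]: "plinear (\<lambda>x. x)"
  by (rule plinearI) auto

lemma plinear_compose: "plinear f \<Longrightarrow> plinear g \<Longrightarrow> plinear (\<lambda>x. g (f x))"
  by (rule plinearI) (auto simp: pmp.linear_add pmp.linear_scale)

lemma plinear_diff: "plinear f \<Longrightarrow> plinear g \<Longrightarrow> plinear (\<lambda>x. f x - g x)"
  by (rule plinearI) (auto simp: pmp.linear_add pmp.linear_scale pm.scale_right_diff_distrib)

lemma plinear_add: "plinear f \<Longrightarrow> plinear g \<Longrightarrow> plinear (\<lambda>x. f x + g x)"
  by (rule plinearI) (auto simp: pmp.linear_add pmp.linear_scale pm.scale_right_distrib)

lemma pscale_bvec: "pscale c (bvec i) = Poly_Mapping.single i c"
  by (rule poly_mapping_eqI) (simp add: lookup_single when_def)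

lemma bvec_expansion:
  "w = (\<Sum>l\<in>Poly_Mapping.keys w. pscale (Poly_Mapping.lookup w l) (bvec l))"
proof (rule poly_mapping_eqI)
  fix i
  show "Poly_Mapping.lookup w i =
    Poly_Mapping.lookup (\<Sum>l\<in>Poly_Mapping.keys w. pscale (Poly_Mapping.lookup w l) (bvec l)) i"
    by (cases "i \<in> Poly_Mapping.keys w")
       (auto simp: pscale_bvec lookup_sum lookup_single when_def in_keys_iff)
qed

lemma plinear_expansion:
  assumes "plinear f"
  shows "f w = (\<Sum>l\<in>Poly_Mapping.keys w. pscale (Poly_Mapping.lookup w l) (f (bvec l)))"
  by (subst bvec_expansion[of w]) (simp only: pmp.linear_sum[OF assms] pmp.linear_scale[OF assms])

lemma plinear_eqI:
  assumes "plinear f" "plinear g" "\<And>l. l \<in> Poly_Mapping.keys w \<Longrightarrow> f (bvec l) = g (bvec l)"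
  shows "f w = g w"
  unfolding plinear_expansion[OF assms(1), of w] plinear_expansion[OF assms(2), of w]
  using assms(3) by simp

lemma plinear_into_subspace:
  assumes "plinear f" "pm.subspace U" "\<And>l. l \<in> Poly_Mapping.keys w \<Longrightarrow> f (bvec l) \<in> U"
  shows "f w \<in> U"
  unfolding plinear_expansion[OF assms(1), of w]
  using assms by (intro pm.subspace_sum pm.subspace_scale) auto

definition lin_ext :: "('i \<Rightarrow> ('j \<Rightarrow>\<^sub>0 'k::field)) \<Rightarrow> ('i \<Rightarrow>\<^sub>0 'k) \<Rightarrow> ('j \<Rightarrow>\<^sub>0 'k)"
  where "lin_ext g w = (\<Sum>l\<in>Poly_Mapping.keys w. pscale (Poly_Mapping.lookup w l) (g l))"

lemma lin_ext_superset:
  assumes "finite S" "Poly_Mapping.keys w \<subseteq> S"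
  shows "lin_ext g w = (\<Sum>l\<in>S. pscale (Poly_Mapping.lookup w l) (g l))"
  unfolding lin_ext_def using assms
  by (intro sum.mono_neutral_left) (auto simp: in_keys_iff)

lemma plinear_lin_ext [simp]:
  fixes g :: "'i \<Rightarrow> ('j \<Rightarrow>\<^sub>0 'k::field)"
  shows "plinear (lin_ext g)"
proof (rule plinearI)
  fix x y :: "'i \<Rightarrow>\<^sub>0 'k"
  let ?S = "Poly_Mapping.keys x \<union> Poly_Mapping.keys y"
  have "Poly_Mapping.keys (x + y) \<subseteq> ?S" by (rule Poly_Mapping.keys_add)
  thus "lin_ext g (x + y) = lin_ext g x + lin_ext g y"
    by (simp add: lin_ext_superset[of ?S] lookup_add pm.scale_left_distrib sum.distrib)
next
  fix c and x :: "'i \<Rightarrow>\<^sub>0 'k"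
  have "Poly_Mapping.keys (pscale c x) \<subseteq> Poly_Mapping.keys x"
    by (auto simp: in_keys_iff)
  thus "lin_ext g (pscale c x) = pscale c (lin_ext g x)"
    by (simp add: lin_ext_superset[of "Poly_Mapping.keys x"] pm.scale_sum_right)
qed

lemma lin_ext_bvec [simp]: "lin_ext g (bvec l) = g l"
  by (simp add: lin_ext_def)

lemmas lin_ext_add = pmp.linear_add[OF plinear_lin_ext]
  and lin_ext_diff = pmp.linear_diff[OF plinear_lin_ext]
  and lin_ext_scale = pmp.linear_scale[OF plinear_lin_ext]
  and lin_ext_zero [simp] = pmp.linear_0[OF plinear_lin_ext]

lemma plinear_of_lin_ext:
  assumes "plinear f"
  shows "f (lin_ext g w) = lin_ext (\<lambda>l. f (g l)) w"
  by (rule plinear_eqI[of "\<lambda>w. f (lin_ext g w)"])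
     (auto intro: plinear_compose[OF plinear_lin_ext assms])

lemma lin_ext_diff_fun: "lin_ext (\<lambda>l. f l - g l) w = lin_ext f w - lin_ext g w"
  by (rule plinear_eqI[of _ "\<lambda>w. lin_ext f w - lin_ext g w"]) (auto intro: plinear_diff)

lemma lin_ext_mono_id [simp]: "lin_ext bvec w = w"
  by (rule plinear_eqI) auto

lemma lin_ext_in_subspace:
  assumes "pm.subspace U" "\<And>l. l \<in> Poly_Mapping.keys w \<Longrightarrow> g l \<in> U"
  shows "lin_ext g w \<in> U"
  by (rule plinear_into_subspace) (use assms in auto)

lemma pscale_eq_mult: "pscale c p = Poly_Mapping.single 0 c * (p :: 'w::monoid_add \<Rightarrow>\<^sub>0 'k::field)"
proof (induction p rule: update_induct)
  case const
  then show ?case by (simp add: pm.scale_zero_right)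
next
  case (update p w d)
  have eq: "Poly_Mapping.update w d p = p + Poly_Mapping.single w d"
    using update.hyps
    by (intro poly_mapping_eqI) (auto simp: lookup_update lookup_add lookup_single in_keys_iff when_def)
  have "pscale c (Poly_Mapping.single w d) = Poly_Mapping.single w (c * d)"
    by (rule poly_mapping_eqI) (simp add: lookup_single when_def)
  with update.IH show ?case
    by (simp add: eq pm.scale_right_distrib distrib_left mult_single)
qed

lemma pscale_mult_left: "pscale c p * q = pscale c (p * (q :: 'w::monoid_add \<Rightarrow>\<^sub>0 'k::field))"
  by (simp add: pscale_eq_mult mult.assoc)

lemma single_zero_commute:
  fixes p :: "'w::monoid_add \<Rightarrow>\<^sub>0 'k::field"
  shows "Poly_Mapping.single 0 c * p = p * Poly_Mapping.single 0 c"
proof (induction p rule: update_induct)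
  case const
  show ?case by simp
next
  case (update p w d)
  have eq: "Poly_Mapping.update w d p = p + Poly_Mapping.single w d"
    using update.hyps
    by (intro poly_mapping_eqI) (auto simp: lookup_update lookup_add lookup_single in_keys_iff when_def)
  show ?case
    using update.IH by (simp add: eq distrib_left distrib_right mult_single mult.commute)
qed

lemma pscale_mult_right: "p * pscale c q = pscale c (p * (q :: 'w::monoid_add \<Rightarrow>\<^sub>0 'k::field))"
  by (simp add: pscale_eq_mult single_zero_commute[of c p] mult.assoc[symmetric])

lemma plinear_mult_left: "plinear (\<lambda>p. q * (p :: 'w::monoid_add \<Rightarrow>\<^sub>0 'k::field))"
  by (rule plinearI) (auto simp: distrib_left pscale_mult_right)

lemma plinear_mult_right: "plinear (\<lambda>p. (p :: 'w::monoid_add \<Rightarrow>\<^sub>0 'k::field) * q)"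
  by (rule plinearI) (auto simp: distrib_right pscale_mult_left)

lemma bvec_mult: "bvec u * bvec v = (bvec (u + v) :: 'w::monoid_add \<Rightarrow>\<^sub>0 'k::field)"
  by (simp add: mult_single)

lemma bvec_zero: "bvec 0 = (1 :: 'w::monoid_add \<Rightarrow>\<^sub>0 'k::field)"
  by simp

section \<open>The bar complex of a monoid algebra\<close>

text \<open>
  A list of \<open>p\<close> monoid elements is a basis vector of the \<open>p\<close>-fold tensor power of the monoid
  algebra. The outer entries carry the bimodule structure. On the empty list the two actions
  create an entry; this makes them send relations to relations without a side condition.
\<close>

definition lcons :: "'w \<Rightarrow> ('w list \<Rightarrow>\<^sub>0 'k::field) \<Rightarrow> ('w list \<Rightarrow>\<^sub>0 'k)"
  where "lcons a = lin_ext (\<lambda>l. bvec (a # l))"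

fun lmul :: "'w::monoid_add \<Rightarrow> 'w list \<Rightarrow> 'w list"
  where "lmul a [] = [a]"
  | "lmul a (b # l) = (a + b) # l"

fun rmul :: "'w::monoid_add \<Rightarrow> 'w list \<Rightarrow> 'w list"
  where "rmul a [] = [a]"
  | "rmul a [b] = [b + a]"
  | "rmul a (b # c # l) = b # rmul a (c # l)"

definition lact_bar :: "'w::monoid_add \<Rightarrow> ('w list \<Rightarrow>\<^sub>0 'k::field) \<Rightarrow> ('w list \<Rightarrow>\<^sub>0 'k)"
  where "lact_bar a = lin_ext (\<lambda>l. bvec (lmul a l))"

definition ract_bar :: "'w::monoid_add \<Rightarrow> ('w list \<Rightarrow>\<^sub>0 'k::field) \<Rightarrow> ('w list \<Rightarrow>\<^sub>0 'k)"
  where "ract_bar a = lin_ext (\<lambda>l. bvec (rmul a l))"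

text \<open>
  The alternating sum over all ways to multiply two neighbours, with the product of the first two
  entries split off. In this recursive form the identities of the differential need no sums.
\<close>

fun bar_list :: "'w::monoid_add list \<Rightarrow> ('w list \<Rightarrow>\<^sub>0 'k::field)"
  where "bar_list [] = 0"
  | "bar_list [a] = 0"
  | "bar_list (a # b # l) = bvec ((a + b) # l) - lcons a (bar_list (b # l))"

definition bar :: "('w::monoid_add list \<Rightarrow>\<^sub>0 'k::field) \<Rightarrow> ('w list \<Rightarrow>\<^sub>0 'k)"
  where "bar = lin_ext bar_list"

lemma plinear_lcons [simp]: "plinear (lcons a)" by (simp add: lcons_def)
lemma plinear_lact_bar [simp]: "plinear (lact_bar a)" by (simp add: lact_bar_def)
lemma plinear_ract_bar [simp]: "plinear (ract_bar a)" by (simp add: ract_bar_def)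
lemma plinear_bar [simp]: "plinear bar" by (simp add: bar_def)

lemma lcons_bvec [simp]: "lcons a (bvec l) = bvec (a # l)" by (simp add: lcons_def)
lemma lact_bar_bvec [simp]: "lact_bar a (bvec l) = bvec (lmul a l)" by (simp add: lact_bar_def)
lemma ract_bar_bvec [simp]: "ract_bar a (bvec l) = bvec (rmul a l)" by (simp add: ract_bar_def)
lemma bar_bvec [simp]: "bar (bvec l) = bar_list l" by (simp add: bar_def)

lemmas bar_ops_linear =
  pmp.linear_add[OF plinear_lcons] pmp.linear_diff[OF plinear_lcons] pmp.linear_scale[OF plinear_lcons]
  pmp.linear_add[OF plinear_lact_bar] pmp.linear_diff[OF plinear_lact_bar] pmp.linear_scale[OF plinear_lact_bar]
  pmp.linear_add[OF plinear_ract_bar] pmp.linear_diff[OF plinear_ract_bar] pmp.linear_scale[OF plinear_ract_bar]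
  pmp.linear_add[OF plinear_bar] pmp.linear_diff[OF plinear_bar] pmp.linear_scale[OF plinear_bar]
  pmp.linear_0[OF plinear_lcons] pmp.linear_0[OF plinear_lact_bar] pmp.linear_0[OF plinear_ract_bar]
  pmp.linear_0[OF plinear_bar]

lemmas plinear_intros = plinear_diff plinear_add
  plinear_compose[OF _ plinear_lcons] plinear_compose[OF _ plinear_lact_bar]
  plinear_compose[OF _ plinear_ract_bar] plinear_compose[OF _ plinear_bar]
  plinear_compose[OF _ plinear_lin_ext]

definition tensors :: "nat \<Rightarrow> ('w list \<Rightarrow>\<^sub>0 'k::field) set"
  where "tensors p = {w. \<forall>l\<in>Poly_Mapping.keys w. length l = p}"

lemma subspace_tensors: "pm.subspace (tensors p)"
  unfolding tensors_def
  using Poly_Mapping.keys_add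
  by (intro pm.subspaceI) (fastforce simp: in_keys_iff lookup_add)+

lemma bvec_in_tensors [simp]: "bvec l \<in> tensors p \<longleftrightarrow> length l = p"
  by (simp add: tensors_def)

lemma length_lmul: "length (lmul a l) = max 1 (length l)"
  by (cases l) auto

lemma length_rmul: "length (rmul a l) = max 1 (length l)"
  by (induction a l rule: rmul.induct) auto

lemma plinear_on_tensors:
  assumes "plinear f" "pm.subspace U" "\<And>l. length l = p \<Longrightarrow> f (bvec l) \<in> U" "w \<in> tensors p"
  shows "f w \<in> U"
  using assms by (intro plinear_into_subspace[of f U w]) (auto simp: tensors_def)

lemma plinear_eq_on_tensors:
  assumes "plinear f" "plinear g" "\<And>l. length l = p \<Longrightarrow> f (bvec l) = g (bvec l)" "w \<in> tensors p"
  shows "f w = g w"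
  using assms by (intro plinear_eqI[of f g w]) (auto simp: tensors_def)

lemma lcons_tensors: "w \<in> tensors p \<Longrightarrow> lcons a w \<in> tensors (Suc p)"
  by (rule plinear_on_tensors[of _ _ p]) (auto simp: subspace_tensors)

lemma lact_bar_tensors: "w \<in> tensors (Suc p) \<Longrightarrow> lact_bar a w \<in> tensors (Suc p)"
  by (rule plinear_on_tensors[of _ _ "Suc p"]) (auto simp: subspace_tensors length_lmul)

lemma ract_bar_tensors: "w \<in> tensors (Suc p) \<Longrightarrow> ract_bar a w \<in> tensors (Suc p)"
  by (rule plinear_on_tensors[of _ _ "Suc p"]) (auto simp: subspace_tensors length_rmul)

lemma bar_list_tensors: "length l = Suc p \<Longrightarrow> bar_list l \<in> tensors p"
proof (induction l arbitrary: p rule: bar_list.induct)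
  case (2 a)
  then show ?case by (auto simp: tensors_def)
next
  case (3 a b l)
  then obtain q where q: "p = Suc q" by (cases p) auto
  with 3 show ?case
    by (auto intro!: pm.subspace_diff[OF subspace_tensors] lcons_tensors)
qed auto

lemma lact_bar_add: "lact_bar (a + b) w = lact_bar a (lact_bar b w)"
proof (rule plinear_eqI[of _ "\<lambda>w. lact_bar a (lact_bar b w)"])
  fix l :: "'a list"
  show "lact_bar (a + b) (bvec l) = lact_bar a (lact_bar b (bvec l))"
    by (cases l) (auto simp: add.assoc)
qed (auto intro: plinear_compose[of "lact_bar b"])

lemma rmul_add: "rmul (a + b) l = rmul b (rmul a l)"
proof (induction l rule: bar_list.induct)
  case (3 x y l)
  then show ?case by (cases "rmul a (y # l)") (auto dest: arg_cong[of _ _ length] simp: length_rmul)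
qed (auto simp: add.assoc)

lemma ract_bar_add: "ract_bar (a + b) w = ract_bar b (ract_bar a w)"
  by (rule plinear_eqI[of _ "\<lambda>w. ract_bar b (ract_bar a w)"])
     (auto intro: plinear_compose[of "ract_bar a"] simp: rmul_add)

lemma lmul_rmul: "lmul a (rmul b l) = rmul b (lmul a l)"
  by (induction b l rule: rmul.induct) (auto simp: add.assoc)

lemma lact_ract_bar: "lact_bar a (ract_bar b w) = ract_bar b (lact_bar a w)"
  by (rule plinear_eqI[of "\<lambda>w. lact_bar a (ract_bar b w)" "\<lambda>w. ract_bar b (lact_bar a w)"])
     (auto intro: plinear_compose[of "ract_bar b"] plinear_compose[of "lact_bar a"] simp: lmul_rmul)

lemma lact_bar_0: "w \<in> tensors (Suc p) \<Longrightarrow> lact_bar 0 w = w"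
proof (rule plinear_eq_on_tensors[of _ "\<lambda>w. w" "Suc p"])
  fix l :: "'a list" assume "length l = Suc p"
  thus "lact_bar 0 (bvec l) = bvec l" by (cases l) auto
qed auto

text \<open>
  For \<open>a = 0\<close>, the unit of the monoid, the first term is \<open>w\<close> itself, so prefixing the unit is a
  contracting homotopy by right module maps.
\<close>

lemma bar_lcons:
  assumes "w \<in> tensors (Suc p)"
  shows "bar (lcons a w) = lact_bar a w - lcons a (bar w)"
proof (rule plinear_eq_on_tensors[of "\<lambda>w. bar (lcons a w)" "\<lambda>w. lact_bar a w - lcons a (bar w)", OF _ _ _ assms])
  fix l :: "'a list" assume "length l = Suc p"
  thus "bar (lcons a (bvec l)) = lact_bar a (bvec l) - lcons a (bar (bvec l))"
    by (cases l) auto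
qed (auto intro!: plinear_intros)

lemma lact_lcons: "lact_bar a (lcons b w) = lcons (a + b) w"
  by (rule plinear_eqI[of "\<lambda>w. lact_bar a (lcons b w)"]) (auto intro!: plinear_intros)

lemma bar_lact: "bar (lact_bar a w) = lact_bar a (bar w)"
proof (rule plinear_eqI[of "\<lambda>w. bar (lact_bar a w)" "\<lambda>w. lact_bar a (bar w)"])
  fix l :: "'a list"
  show "bar (lact_bar a (bvec l)) = lact_bar a (bar (bvec l))"
    by (cases l rule: bar_list.cases) (auto simp: bar_ops_linear lact_lcons add.assoc)
qed (auto intro!: plinear_intros)

lemma ract_lcons:
  assumes "w \<in> tensors (Suc p)"
  shows "ract_bar a (lcons b w) = lcons b (ract_bar a w)"
proof (rule plinear_eq_on_tensors[of "\<lambda>w. ract_bar a (lcons b w)" "\<lambda>w. lcons b (ract_bar a w)", OF _ _ _ assms])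
  fix l :: "'a list" assume "length l = Suc p"
  thus "ract_bar a (lcons b (bvec l)) = lcons b (ract_bar a (bvec l))"
    by (cases l) auto
qed (auto intro!: plinear_intros)

lemma bar_list_ract:
  "bar_list (rmul a l) = (ract_bar a (bar_list l) :: 'w::monoid_add list \<Rightarrow>\<^sub>0 'k::field)"
proof (induction l rule: bar_list.induct)
  case (3 b c l)
  show ?case
  proof (cases l)
    case Nil
    then show ?thesis by (simp add: bar_ops_linear add.assoc)
  next
    case (Cons e l')
    have t: "bar_list (c # l) \<in> (tensors (Suc (length l')) :: ('w list \<Rightarrow>\<^sub>0 'k) set)"
      by (rule bar_list_tensors) (simp add: Cons)
    have r: "rmul a (x # l) = x # rmul a l" for x
      by (simp add: Cons)
    have "bar_list (rmul a (b # c # l)) = (bvec ((b + c) # rmul a l) - lcons b (bar_list (rmul a (c # l))) :: 'w list \<Rightarrow>\<^sub>0 'k)"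
      by (simp add: r)
    also have "\<dots> = ract_bar a (bar_list (b # c # l))"
      unfolding 3 by (simp add: r bar_ops_linear ract_lcons[OF t])
    finally show ?thesis .
  qed
qed (auto simp: bar_ops_linear)

lemma bar_ract: "bar (ract_bar a w) = ract_bar a (bar w)"
  by (rule plinear_eqI[of "\<lambda>w. bar (ract_bar a w)" "\<lambda>w. ract_bar a (bar w)"])
     (auto intro!: plinear_intros simp: bar_list_ract)

lemma bar_bar_list: "bar (bar_list l) = (0 :: 'w::monoid_add list \<Rightarrow>\<^sub>0 'k::field)"
proof (induction l rule: bar_list.induct)
  case (3 a b l)
  show ?case
  proof (cases l)
    case Nil
    then show ?thesis by (simp add: bar_ops_linear)
  next
    case (Cons c l')
    have t: "bar_list (b # l) \<in> (tensors (Suc (length l')) :: ('w list \<Rightarrow>\<^sub>0 'k) set)"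
      by (rule bar_list_tensors) (simp add: Cons)
    have "bar_list ((a + b) # l) = (lact_bar a (bar_list (b # l)) :: 'w list \<Rightarrow>\<^sub>0 'k)"
      using bar_lact[of a "bvec (b # l)"] by simp
    thus ?thesis
      using 3 by (simp add: bar_ops_linear bar_lcons[OF t])
  qed
qed (auto simp: bar_ops_linear)

lemma bar_bar: "bar (bar w) = 0"
  using plinear_of_lin_ext[OF plinear_bar, of bar_list w]
  by (simp add: bar_def[symmetric] bar_bar_list lin_ext_def pm.scale_zero_right)

section \<open>Passing to a quotient algebra\<close>

definition slot :: "'w list \<Rightarrow> 'w list \<Rightarrow> ('w \<Rightarrow>\<^sub>0 'k::field) \<Rightarrow> ('w list \<Rightarrow>\<^sub>0 'k)"
  where "slot l1 l2 = lin_ext (\<lambda>u. bvec (l1 @ u # l2))"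

lemma plinear_slot [simp]: "plinear (slot l1 l2)" by (simp add: slot_def)
lemma slot_bvec [simp]: "slot l1 l2 (bvec u) = bvec (l1 @ u # l2)" by (simp add: slot_def)

lemma plinear_lin_ext_param:
  assumes "\<And>u. plinear (h u)"
  shows "plinear (\<lambda>Y. lin_ext (\<lambda>u. h u Y) z)"
  unfolding lin_ext_def using assms
  by (intro plinearI)
     (simp_all add: pmp.linear_add pmp.linear_scale pm.scale_right_distrib sum.distrib
        pm.scale_sum_right mult.commute)

lemma lin_ext_plus_right:
  "lin_ext f (z * bvec b) = lin_ext (\<lambda>u. f (u + b)) (z :: 'w::monoid_add \<Rightarrow>\<^sub>0 'k::field)"
  by (rule plinear_eqI[of "\<lambda>z. lin_ext f (z * bvec b)"])
     (auto intro!: plinear_intros plinear_mult_right simp: bvec_mult)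

lemma lin_ext_plus_left:
  "lin_ext f (bvec b * z) = lin_ext (\<lambda>u. f (b + u)) (z :: 'w::monoid_add \<Rightarrow>\<^sub>0 'k::field)"
  by (rule plinear_eqI[of "\<lambda>z. lin_ext f (bvec b * z)"])
     (auto intro!: plinear_intros plinear_mult_left simp: bvec_mult)

lemma rmul_append: "rmul a (l @ [b]) = l @ [b + a]"
  by (induction l rule: induct_list012) auto

lemma rmul_Cons_append: "rmul a (x # l @ [b]) = x # l @ [b + a]"
  using rmul_append[of a "x # l" b] by simp

text \<open>
  With its outer entries as coefficients a tensor power is a free bimodule on its inner entries, so
  that a bimodule map out of it can be prescribed there.
\<close>

definition bim_ext :: "('w::monoid_add list \<Rightarrow> ('w list \<Rightarrow>\<^sub>0 'k::field)) \<Rightarrow> ('w list \<Rightarrow>\<^sub>0 'k) \<Rightarrow> ('w list \<Rightarrow>\<^sub>0 'k)"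
  where "bim_ext g = lin_ext (\<lambda>l. if 2 \<le> length l
    then lact_bar (hd l) (ract_bar (last l) (g (butlast (tl l)))) else 0)"

lemma plinear_bim_ext [simp]: "plinear (bim_ext g)" by (simp add: bim_ext_def)

lemma bim_ext_bvec [simp]:
  "bim_ext g (bvec (a # l @ [b])) = lact_bar a (ract_bar b (g l))"
  by (simp add: bim_ext_def)

lemma bim_ext_short: "length l < 2 \<Longrightarrow> bim_ext g (bvec l) = 0"
  by (simp add: bim_ext_def)

lemma list_ends_cases:
  obtains "length l < 2" | a l' b where "l = a # l' @ [b]"
proof (cases l)
  case (Cons a m)
  show ?thesis
  proof (cases m rule: rev_cases)
    case (snoc m' b)
    thus ?thesis using that(2) Cons by blast
  qed (use Cons that(1) in auto)
qed (use that(1) in auto)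

definition bimodule_map :: "(('w::monoid_add list \<Rightarrow>\<^sub>0 'k::field) \<Rightarrow> ('w list \<Rightarrow>\<^sub>0 'k)) \<Rightarrow> bool"
  where "bimodule_map f \<longleftrightarrow> plinear f \<and>
    (\<forall>a w. f (lact_bar a w) = lact_bar a (f w)) \<and> (\<forall>a w. f (ract_bar a w) = ract_bar a (f w))"

lemma bimodule_map_bim_ext: "bimodule_map (bim_ext g)"
  unfolding bimodule_map_def
proof (intro conjI allI)
  fix a w
  show "bim_ext g (lact_bar a w) = lact_bar a (bim_ext g w)"
  proof (rule plinear_eqI[of "\<lambda>w. bim_ext g (lact_bar a w)" "\<lambda>w. lact_bar a (bim_ext g w)"])
    fix l :: "'a list"
    show "bim_ext g (lact_bar a (bvec l)) = lact_bar a (bim_ext g (bvec l))"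
      by (cases l rule: list_ends_cases)
         (simp_all add: bim_ext_short length_lmul lact_bar_add bar_ops_linear)
  qed (auto intro!: plinear_intros plinear_compose[OF _ plinear_bim_ext])
  show "bim_ext g (ract_bar a w) = ract_bar a (bim_ext g w)"
  proof (rule plinear_eqI[of "\<lambda>w. bim_ext g (ract_bar a w)" "\<lambda>w. ract_bar a (bim_ext g w)"])
    fix l :: "'a list"
    show "bim_ext g (ract_bar a (bvec l)) = ract_bar a (bim_ext g (bvec l))"
      by (cases l rule: list_ends_cases)
         (simp_all add: bim_ext_short length_rmul ract_bar_add bar_ops_linear
            rmul_Cons_append lact_ract_bar)
  qed (auto intro!: plinear_intros plinear_compose[OF _ plinear_bim_ext])
qed simp

lemma bim_ext_tensors:
  assumes "\<And>l. length l + 2 = p \<Longrightarrow> g l \<in> tensors (Suc q)" and "w \<in> tensors p"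
  shows "bim_ext g w \<in> tensors (Suc q)"
proof (rule plinear_on_tensors[OF _ _ _ assms(2)])
  fix l :: "'a list" assume "length l = p"
  with assms(1) show "bim_ext g (bvec l) \<in> tensors (Suc q)"
    by (cases l rule: list_ends_cases)
       (auto simp: bim_ext_short pm.subspace_0[OF subspace_tensors]
         intro!: lact_bar_tensors ract_bar_tensors)
qed (auto simp: subspace_tensors)

locale monoid_algebra_ideal =
  fixes I :: "('w::monoid_add \<Rightarrow>\<^sub>0 'k::field) set"
  assumes subspace_I: "pm.subspace I"
    and I_mult_left: "z \<in> I \<Longrightarrow> bvec u * z \<in> I"
    and I_mult_right: "z \<in> I \<Longrightarrow> z * bvec u \<in> I"
begin

text \<open>
  The kernel of the map onto the same tensor power of the quotient algebra. It is used for all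
  lengths at once: identities in the bar complex of the quotient are congruences modulo \<open>null\<close>.
\<close>

definition null :: "('w list \<Rightarrow>\<^sub>0 'k) set"
  where "null = pm.span {slot l1 l2 z | l1 l2 z. z \<in> I}"

lemma subspace_null: "pm.subspace null"
  unfolding null_def by (rule pm.subspace_span)

lemma slot_null: "z \<in> I \<Longrightarrow> slot l1 l2 z \<in> null"
  unfolding null_def by (rule pm.span_base) auto

lemmas null_add = pm.subspace_add[OF subspace_null]
  and null_diff = pm.subspace_diff[OF subspace_null]
  and null_scale = pm.subspace_scale[OF subspace_null]
  and null_0 [simp] = pm.subspace_0[OF subspace_null]
  and null_neg = pm.subspace_neg[OF subspace_null]

lemma null_into_subspace:
  assumes "plinear f" "pm.subspace U" "\<And>l1 l2 z. z \<in> I \<Longrightarrow> f (slot l1 l2 z) \<in> U" "w \<in> null"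
  shows "f w \<in> U"
  using assms(4) unfolding null_def
proof (induction rule: pm.span_induct)
  case base
  show ?case using assms(1,2)
    by (auto intro!: pm.subspaceI simp: pmp.linear_0 pmp.linear_add pmp.linear_scale
          pm.subspace_0 pm.subspace_add pm.subspace_scale)
qed (use assms(3) in auto)

lemma lact_sum_null:
  assumes "z \<in> I"
  shows "lin_ext (\<lambda>u. lact_bar u Y) z \<in> null"
proof (rule plinear_into_subspace[of "\<lambda>Y. lin_ext (\<lambda>u. lact_bar u Y) z"])
  fix l :: "'w list"
  show "lin_ext (\<lambda>u. lact_bar u (bvec l)) z \<in> null"
  proof (cases l)
    case Nil
    thus ?thesis using slot_null[OF assms, of "[]" "[]"] by (simp add: slot_def)
  next
    case (Cons b l')
    thus ?thesis using slot_null[OF I_mult_right[OF assms], of "[]" l' b]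
      by (simp add: slot_def lin_ext_plus_right)
  qed
qed (auto intro: plinear_lin_ext_param subspace_null)

lemma ract_sum_null:
  assumes "z \<in> I"
  shows "lin_ext (\<lambda>u. ract_bar u Y) z \<in> null"
proof (rule plinear_into_subspace[of "\<lambda>Y. lin_ext (\<lambda>u. ract_bar u Y) z"])
  fix l :: "'w list"
  show "lin_ext (\<lambda>u. ract_bar u (bvec l)) z \<in> null"
  proof (cases l rule: rev_cases)
    case Nil
    thus ?thesis using slot_null[OF assms, of "[]" "[]"] by (simp add: slot_def)
  next
    case (snoc l' b)
    thus ?thesis using slot_null[OF I_mult_left[OF assms], of l' "[]" b]
      by (simp add: slot_def lin_ext_plus_left rmul_append)
  qed
qed (auto intro: plinear_lin_ext_param subspace_null)

lemma lcons_sum_null: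
  assumes "z \<in> I"
  shows "lin_ext (\<lambda>u. lcons u Y) z \<in> null"
proof (rule plinear_into_subspace[of "\<lambda>Y. lin_ext (\<lambda>u. lcons u Y) z"])
  fix l :: "'w list"
  show "lin_ext (\<lambda>u. lcons u (bvec l)) z \<in> null"
    using slot_null[OF assms, of "[]" l] by (simp add: slot_def)
qed (auto intro: plinear_lin_ext_param subspace_null)

lemma lcons_null: "w \<in> null \<Longrightarrow> lcons a w \<in> null"
proof (erule null_into_subspace[rotated -1])
  fix l1 l2 and z :: "'w \<Rightarrow>\<^sub>0 'k" assume "z \<in> I"
  thus "lcons a (slot l1 l2 z) \<in> null"
    using slot_null[of z "a # l1" l2] by (simp add: slot_def plinear_of_lin_ext)
qed (auto simp: subspace_null)

lemma lact_null: "w \<in> null \<Longrightarrow> lact_bar a w \<in> null"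
proof (erule null_into_subspace[rotated -1])
  fix l1 l2 and z :: "'w \<Rightarrow>\<^sub>0 'k" assume z: "z \<in> I"
  show "lact_bar a (slot l1 l2 z) \<in> null"
  proof (cases l1)
    case Nil
    then show ?thesis using slot_null[OF I_mult_left[OF z], of "[]" l2 a]
      by (simp add: slot_def plinear_of_lin_ext lin_ext_plus_left)
  next
    case (Cons b l1')
    then show ?thesis using slot_null[OF z, of "(a + b) # l1'" l2]
      by (simp add: slot_def plinear_of_lin_ext)
  qed
qed (auto simp: subspace_null)

lemma ract_null: "w \<in> null \<Longrightarrow> ract_bar a w \<in> null"
proof (erule null_into_subspace[rotated -1])
  fix l1 l2 and z :: "'w \<Rightarrow>\<^sub>0 'k" assume z: "z \<in> I"
  show "ract_bar a (slot l1 l2 z) \<in> null"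
  proof (cases l2 rule: rev_cases)
    case Nil
    then show ?thesis using slot_null[OF I_mult_right[OF z], of l1 "[]" a]
      by (simp add: slot_def plinear_of_lin_ext lin_ext_plus_right rmul_append)
  next
    case (snoc l2' b)
    have "rmul a (l1 @ u # l2) = l1 @ u # l2' @ [b + a]" for u
      using rmul_append[of a "l1 @ u # l2'" b] by (simp add: snoc)
    then show ?thesis using slot_null[OF z, of l1 "l2' @ [b + a]"]
      by (simp add: slot_def plinear_of_lin_ext)
  qed
qed (auto simp: subspace_null)

lemma bar_null: "w \<in> null \<Longrightarrow> bar w \<in> null"
proof (erule null_into_subspace[rotated -1])
  fix l1 l2 and z :: "'w \<Rightarrow>\<^sub>0 'k" assume z: "z \<in> I"
  show "bar (slot l1 l2 z) \<in> null"
  proof (induction l1)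
    case Nil
    show ?case
    proof (cases l2)
      case Nil
      thus ?thesis by (simp add: slot_def plinear_of_lin_ext) (simp add: lin_ext_def pm.scale_zero_right)
    next
      case (Cons b l)
      have "bar (slot [] l2 z) = slot [] l (z * bvec b) - lin_ext (\<lambda>u. lcons u (bar_list l2)) z"
        by (simp add: slot_def plinear_of_lin_ext Cons lin_ext_plus_right lin_ext_diff_fun)
      thus ?thesis using slot_null[OF I_mult_right[OF z]] lcons_sum_null[OF z] null_diff by simp
    qed
  next
    case (Cons b l1)
    have "slot l1 l2 z \<in> tensors (Suc (length l1 + length l2))"
      unfolding slot_def by (rule lin_ext_in_subspace) (auto simp: subspace_tensors)
    hence "bar (lcons b (slot l1 l2 z)) = lact_bar b (slot l1 l2 z) - lcons b (bar (slot l1 l2 z))"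
      by (rule bar_lcons)
    moreover have "lcons b (slot l1 l2 z) = slot (b # l1) l2 z"
      by (simp add: slot_def plinear_of_lin_ext)
    ultimately show ?case
      using Cons slot_null[OF z] lact_null lcons_null null_diff by metis
  qed
qed (auto simp: subspace_null)

text \<open>
  Only an interior slot needs a hypothesis. In an outer slot the relation acts on a fixed tensor,
  and an element of the ideal acts by zero modulo \<open>null\<close>.
\<close>

lemma bim_ext_null:
  assumes "\<And>l1 l2 z. z \<in> I \<Longrightarrow> lin_ext (\<lambda>u. g (l1 @ u # l2)) z \<in> null" and "w \<in> null"
  shows "bim_ext g w \<in> null"
  using assms(2)
proof (rule null_into_subspace[rotated -1])
  fix l1 l2 and z :: "'w \<Rightarrow>\<^sub>0 'k" assume z: "z \<in> I"
  have eq: "bim_ext g (slot l1 l2 z) = lin_ext (\<lambda>u. bim_ext g (bvec (l1 @ u # l2))) z"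
    by (simp add: slot_def plinear_of_lin_ext)
  have interior: "bim_ext g (slot (a # m1) (m2 @ [b]) z) \<in> null" for a m1 m2 b
  proof -
    have "bim_ext g (bvec ((a # m1) @ u # m2 @ [b])) = lact_bar a (ract_bar b (g (m1 @ u # m2)))" for u
      using bim_ext_bvec[of g a "m1 @ u # m2" b] by simp
    hence "bim_ext g (slot (a # m1) (m2 @ [b]) z)
      = lact_bar a (ract_bar b (lin_ext (\<lambda>u. g (m1 @ u # m2)) z))"
      by (simp add: slot_def plinear_of_lin_ext del: bim_ext_bvec)
    thus ?thesis using assms(1)[OF z] lact_null ract_null by simp
  qed
  show "bim_ext g (slot l1 l2 z) \<in> null"
  proof (cases l1)
    case Nil
    note l1 = this
    show ?thesis
    proof (cases l2 rule: rev_cases)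
      case Nil
      thus ?thesis unfolding eq by (simp add: l1 bim_ext_short) (simp add: lin_ext_def pm.scale_zero_right)
    next
      case (snoc m b)
      show ?thesis unfolding eq using lact_sum_null[OF z] by (simp add: l1 snoc)
    qed
  next
    case (Cons a m1)
    note l1 = this
    show ?thesis
    proof (cases l2 rule: rev_cases)
      case Nil
      show ?thesis unfolding eq 
        using ract_sum_null[OF z, of "lact_bar a (g m1)"] by (simp add: l1 Nil lact_ract_bar)
    next
      case (snoc m2 b)
      show ?thesis using interior by (simp add: l1 snoc)
    qed
  qed
qed (auto simp: subspace_null)

text \<open>
  If an endomorphism \<open>P\<close> of a term of the bar resolution has the same differential as the identity,
  then \<open>1 - P\<close> takes values in cycles, and prefixing the unit turns these cycles into boundaries.
  Prefixing is not left linear; doing it on free generators only and extending to a bimodule map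
  repairs this.
\<close>

definition step :: "(('w list \<Rightarrow>\<^sub>0 'k) \<Rightarrow> ('w list \<Rightarrow>\<^sub>0 'k)) \<Rightarrow> ('w list \<Rightarrow>\<^sub>0 'k) \<Rightarrow> ('w list \<Rightarrow>\<^sub>0 'k)"
  where "step P = bim_ext (\<lambda>l. lcons 0 (bvec (0 # l @ [0]) - P (bvec (0 # l @ [0]))))"

text \<open>
  Such a map induces a bimodule map between tensor powers of the quotient algebra.
\<close>

definition null_map :: "(('w list \<Rightarrow>\<^sub>0 'k) \<Rightarrow> ('w list \<Rightarrow>\<^sub>0 'k)) \<Rightarrow> bool"
  where "null_map f \<longleftrightarrow> bimodule_map f \<and> (\<forall>w\<in>null. f w \<in> null)"

lemma null_map_plinear: "null_map f \<Longrightarrow> plinear f"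
  and null_map_lact: "null_map f \<Longrightarrow> f (lact_bar a w) = lact_bar a (f w)"
  and null_map_ract: "null_map f \<Longrightarrow> f (ract_bar a w) = ract_bar a (f w)"
  and null_map_null: "null_map f \<Longrightarrow> w \<in> null \<Longrightarrow> f w \<in> null"
  by (auto simp: null_map_def bimodule_map_def)

lemma null_map_step:
  assumes "null_map P"
  shows "null_map (step P)"
  unfolding null_map_def
proof (intro conjI ballI)
  show "bimodule_map (step P)" unfolding step_def by (rule bimodule_map_bim_ext)
  fix w :: "'w list \<Rightarrow>\<^sub>0 'k" assume w: "w \<in> null"
  show "step P w \<in> null"
    unfolding step_def
  proof (rule bim_ext_null[OF _ w])
    fix l1 l2 and z :: "'w \<Rightarrow>\<^sub>0 'k" assume z: "z \<in> I"
    have "plinear (\<lambda>w. lcons 0 (w - P w))"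
      using null_map_plinear[OF assms] by (intro plinear_intros) auto
    hence "lin_ext (\<lambda>u. lcons 0 (bvec (0 # (l1 @ u # l2) @ [0]) - P (bvec (0 # (l1 @ u # l2) @ [0])))) z
      = lcons 0 (slot (0 # l1) (l2 @ [0]) z - P (slot (0 # l1) (l2 @ [0]) z))"
      using plinear_of_lin_ext[of "\<lambda>w. lcons 0 (w - P w)" "\<lambda>u. bvec ((0 # l1) @ u # l2 @ [0])" z]
      by (simp add: slot_def)
    also have "\<dots> \<in> null"
      by (intro lcons_null null_diff slot_null z null_map_null[OF assms])
    finally show "lin_ext (\<lambda>u. lcons 0 (bvec (0 # (l1 @ u # l2) @ [0]) - P (bvec (0 # (l1 @ u # l2) @ [0])))) z \<in> null" .
  qed
qed

lemma step_homotopy: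
  assumes P: "null_map P" and len: "length l = p" "2 \<le> p"
    and deg: "\<And>l. length l = p \<Longrightarrow> P (bvec l) \<in> tensors p"
    and lift: "\<And>l. length l = p \<Longrightarrow> bar (P (bvec l)) - bar_list l \<in> null"
  shows "bar (step P (bvec l)) - (bvec l - P (bvec l)) \<in> null"
proof -
  obtain a m b where l: "l = a # m @ [b]" using len by (cases l rule: list_ends_cases) auto
  define g where "g = 0 # m @ [0::'w]"
  define y :: "'w list \<Rightarrow>\<^sub>0 'k" where "y = bvec g - P (bvec g)"
  have g: "length g = p" using len by (simp add: g_def l)
  have gl: "bvec l = lact_bar a (ract_bar b (bvec g))"
    using rmul_append[of b "0 # m" 0] by (simp add: g_def l)
  obtain q where q: "p = Suc q" using len by (cases p) auto
  have y: "y \<in> tensors (Suc q)"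
    unfolding y_def using deg[OF g] g q by (intro pm.subspace_diff[OF subspace_tensors]) auto
  have "- (bar y) \<in> null"
    using lift[OF g] by (simp add: y_def bar_ops_linear)
  hence dy: "bar y \<in> null" using null_neg by fastforce
  have "bar (step P (bvec l)) = lact_bar a (ract_bar b (bar (lcons 0 y)))"
    by (simp add: step_def l bar_lact bar_ract y_def g_def)
  also have "\<dots> = lact_bar a (ract_bar b y) - lact_bar a (ract_bar b (lcons 0 (bar y)))"
    by (simp add: bar_lcons[OF y] lact_bar_0[OF y] bar_ops_linear)
  also have "lact_bar a (ract_bar b y) = bvec l - P (bvec l)"
    unfolding gl y_def by (simp add: null_map_lact[OF P] null_map_ract[OF P] bar_ops_linear del: ract_bar_bvec lact_bar_bvec)
  finally have "bar (step P (bvec l)) - (bvec l - P (bvec l)) = - lact_bar a (ract_bar b (lcons 0 (bar y)))"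
    by simp
  thus ?thesis
    using dy lact_null ract_null lcons_null null_neg by metis
qed

lemma step_tensors:
  assumes "\<And>l. length l = p \<Longrightarrow> P (bvec l) \<in> tensors p" "w \<in> tensors p"
  shows "step P w \<in> tensors (Suc p)"
  unfolding step_def
  by (rule bim_ext_tensors[OF _ assms(2)])
     (use assms(1) in \<open>auto intro!: lcons_tensors pm.subspace_diff[OF subspace_tensors] simp del: One_nat_def\<close>)

text \<open>
  The composite of the homotopy \<open>step P\<close> with the differential satisfies the hypotheses on \<open>P\<close> one
  degree higher. So a single bimodule splitting of the differential, which \<open>P\<close> encodes, contracts
  the bar resolution in all higher degrees.
\<close>

lemma contraction_above:
  assumes P: "null_map P"
    and deg: "\<And>l. length l = p \<Longrightarrow> P (bvec l) \<in> tensors p" and p: "2 \<le> p"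
    and lift: "\<And>l. length l = p \<Longrightarrow> bar (P (bvec l)) - bar_list l \<in> null"
    and vanish: "\<And>l. length l = Suc p \<Longrightarrow> P (bar_list l) \<in> null"
    and q: "p \<le> q"
  obtains S S' where "null_map S" "null_map S'"
    "\<And>w. w \<in> tensors q \<Longrightarrow> S w \<in> tensors (Suc q)"
    "\<And>w. w \<in> tensors (Suc q) \<Longrightarrow> S' w \<in> tensors (Suc (Suc q))"
    "\<And>w. w \<in> tensors (Suc q) \<Longrightarrow> bar (S' w) + S (bar w) - w \<in> null"
proof -
  define good where "good Q r \<longleftrightarrow> null_map Q \<and> (\<forall>l. length l = r \<longrightarrow> Q (bvec l) \<in> tensors r)
    \<and> (\<forall>l. length l = r \<longrightarrow> bar (Q (bvec l)) - bar_list l \<in> null)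
    \<and> (\<forall>l. length l = Suc r \<longrightarrow> Q (bar_list l) \<in> null)" for Q :: "('w list \<Rightarrow>\<^sub>0 'k) \<Rightarrow> ('w list \<Rightarrow>\<^sub>0 'k)" and r
  have nxt: "good (\<lambda>w. step Q (bar w)) (Suc r)" if Q: "good Q r" and r: "2 \<le> r" for Q r
  proof -
    have nQ: "null_map Q" and dQ: "\<And>l. length l = r \<Longrightarrow> Q (bvec l) \<in> tensors r"
      and lQ: "\<And>l. length l = r \<Longrightarrow> bar (Q (bvec l)) - bar_list l \<in> null"
      and vQ: "\<And>l. length l = Suc r \<Longrightarrow> Q (bar_list l) \<in> null"
      using Q by (auto simp: good_def)
    note nS = null_map_step[OF nQ]
    have pl: "plinear (\<lambda>w. step Q (bar w))"
      by (rule plinear_compose[OF plinear_bar null_map_plinear[OF nS]])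
    have n: "null_map (\<lambda>w. step Q (bar w))"
      unfolding null_map_def bimodule_map_def using pl
      by (auto simp: bar_lact bar_ract null_map_lact[OF nS] null_map_ract[OF nS] intro!: null_map_null[OF nS] bar_null)
    have lin: "bar (step Q w) - (w - Q w) \<in> null" if "w \<in> tensors r" for w
    proof (rule plinear_on_tensors[OF _ subspace_null _ that])
      show "plinear (\<lambda>w. bar (step Q w) - (w - Q w))"
        using null_map_plinear[OF nS] null_map_plinear[OF nQ] by (intro plinear_intros) auto
      show "bar (step Q (bvec l)) - (bvec l - Q (bvec l)) \<in> null" if "length l = r" for l
        using step_homotopy[OF nQ that r dQ lQ] .
    qed
    have "step Q (bar (bvec l)) \<in> tensors (Suc r)" if "length l = Suc r" for l
      using that by (intro step_tensors dQ) (auto intro: bar_list_tensors)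
    moreover have "bar (step Q (bar (bvec l))) - bar_list l \<in> null" if l: "length l = Suc r" for l
    proof -
      have "bar_list l \<in> tensors r" using l by (rule bar_list_tensors)
      from null_diff[OF lin[OF this] vQ[OF l]] show ?thesis by simp
    qed
    moreover have "step Q (bar (bar_list l)) \<in> null" for l
      using null_map_null[OF nS null_0] by (simp add: bar_bar_list)
    ultimately show ?thesis using n by (simp add: good_def)
  qed
  have "\<exists>Q. good Q q" using q
  proof (induction q rule: dec_induct)
    case base
    show ?case using P deg lift vanish by (auto simp: good_def)
  next
    case (step r)
    thus ?case using nxt p by (meson le_trans)
  qed
  then obtain Q where Q: "good Q q" by blast
  define S where "S = step Q"
  define Q' where "Q' = (\<lambda>w. S (bar w))"
  define S' where "S' = step Q'"
  have Q': "good Q' (Suc q)" unfolding Q'_def S_def using nxt[OF Q] p q by simp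
  have nQ: "null_map Q" and nQ': "null_map Q'" using Q Q' by (auto simp: good_def)
  have nS: "null_map S" "null_map S'"
    unfolding S_def S'_def by (intro null_map_step nQ nQ')+
  show ?thesis
  proof (rule that[OF nS])
    fix w :: "'w list \<Rightarrow>\<^sub>0 'k"
    show "w \<in> tensors q \<Longrightarrow> S w \<in> tensors (Suc q)"
      unfolding S_def by (rule step_tensors) (use Q in \<open>auto simp: good_def\<close>)
    show "w \<in> tensors (Suc q) \<Longrightarrow> S' w \<in> tensors (Suc (Suc q))"
      unfolding S'_def by (rule step_tensors) (use Q' in \<open>auto simp: good_def\<close>)
    assume w: "w \<in> tensors (Suc q)"
    show "bar (S' w) + S (bar w) - w \<in> null"
    proof (rule plinear_on_tensors[OF _ subspace_null _ w])
      show "plinear (\<lambda>w. bar (S' w) + S (bar w) - w)"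
        by (intro plinear_diff plinear_add plinear_id
            plinear_compose[OF null_map_plinear[OF nS(2)] plinear_bar]
            plinear_compose[OF plinear_bar null_map_plinear[OF nS(1)]])
      fix l :: "'w list" assume l: "length l = Suc q"
      have "bar (S' (bvec l)) - (bvec l - Q' (bvec l)) \<in> null"
        unfolding S'_def by (rule step_homotopy[OF nQ' l]) (use Q' p q in \<open>auto simp: good_def\<close>)
      thus "bar (S' (bvec l)) + S (bar (bvec l)) - bvec l \<in> null"
        by (simp add: Q'_def algebra_simps)
    qed
  qed
qed

end

section \<open>One quadratic relation: filtration by length\<close>

lemma letters_plus [simp]: "letters (u + v) = letters u @ letters v"
  by (simp add: plus_free_word_def)

lemma letters_zero [simp]: "letters 0 = []"
  by (simp add: zero_free_word_def)

lemma free_word_rev_cases: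
  obtains "u = 0" | v j where "u = v + Free_Word [j]"
proof (cases "letters u" rule: rev_cases)
  case Nil
  thus ?thesis using that(1) by (metis free_word.collapse zero_free_word_def)
next
  case (snoc l j)
  hence "u = Free_Word l + Free_Word [j]"
    by (metis free_word.collapse free_word.sel plus_free_word_def)
  thus ?thesis by (rule that(2))
qed

definition low :: "nat \<Rightarrow> ('n free_word \<Rightarrow>\<^sub>0 'k::field) set"
  where "low d = {p. \<forall>u\<in>Poly_Mapping.keys p. length (letters u) < d}"

lemma subspace_low: "pm.subspace (low d)"
  unfolding low_def
  using Poly_Mapping.keys_add
  by (intro pm.subspaceI) (fastforce simp: in_keys_iff lookup_add)+

lemmas low_add = pm.subspace_add[OF subspace_low]
  and low_diff = pm.subspace_diff[OF subspace_low]
  and low_scale = pm.subspace_scale[OF subspace_low]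
  and low_sum = pm.subspace_sum[OF subspace_low]
  and zero_in_low [simp] = pm.subspace_0[OF subspace_low]

lemma low_0: "p \<in> low 0 \<Longrightarrow> p = 0"
  by (auto simp: low_def)

lemma low_mono: "p \<in> low d \<Longrightarrow> d \<le> e \<Longrightarrow> p \<in> low e"
  by (force simp: low_def)

lemma bvec_low [simp]: "bvec u \<in> low d \<longleftrightarrow> length (letters u) < d"
  by (simp add: low_def)

lemma plinear_on_low:
  assumes "plinear f" "pm.subspace U" "\<And>u. length (letters u) < d \<Longrightarrow> f (bvec u) \<in> U" "p \<in> low d"
  shows "f p \<in> U"
  using assms by (intro plinear_into_subspace[of f U p]) (auto simp: low_def)

abbreviation letter :: "'n \<Rightarrow> ('n free_word \<Rightarrow>\<^sub>0 'k::field)"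
  where "letter i \<equiv> bvec (Free_Word [i])"

definition form :: "('n::finite \<Rightarrow> 'k) \<Rightarrow> ('n free_word \<Rightarrow>\<^sub>0 'k::field)"
  where "form v = (\<Sum>i\<in>UNIV. pscale (v i) (letter i))"

lemma mult_letter_low: "p \<in> low d \<Longrightarrow> p * letter i \<in> low (Suc d)"
  by (rule plinear_on_low[of "\<lambda>p. p * letter i", OF plinear_mult_right subspace_low])
     (simp add: bvec_mult)

lemma mult_form: "q * form v = (\<Sum>i\<in>UNIV. pscale (v i) (q * letter i))"
  by (simp add: form_def sum_distrib_left pscale_mult_right)

lemma mult_form_low: "p \<in> low d \<Longrightarrow> p * form v \<in> low (Suc d)"
  unfolding mult_form by (intro low_sum low_scale mult_letter_low)

text \<open>The left cofactor of a last letter: \<open>p\<close> is a constant plus the sum of \<open>rder j p * letter j\<close>.\<close>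

definition rder :: "'n \<Rightarrow> ('n free_word \<Rightarrow>\<^sub>0 'k::field) \<Rightarrow> ('n free_word \<Rightarrow>\<^sub>0 'k)"
  where "rder j = lin_ext (\<lambda>u. if letters u \<noteq> [] \<and> last (letters u) = j
    then bvec (Free_Word (butlast (letters u))) else 0)"

lemma plinear_rder [simp]: "plinear (rder j)" by (simp add: rder_def)

lemmas rder_add = pmp.linear_add[OF plinear_rder]
  and rder_diff = pmp.linear_diff[OF plinear_rder]
  and rder_scale = pmp.linear_scale[OF plinear_rder]
  and rder_sum = pmp.linear_sum[OF plinear_rder]

lemma rder_mult_letter: "rder j (p * letter i) = (if i = j then p else 0)"
proof (rule plinear_eqI[of "\<lambda>p. rder j (p * letter i)" "\<lambda>p. if i = j then p else 0"])
  show "plinear (\<lambda>p. rder j (p * letter i))"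
    by (rule plinear_compose[OF plinear_mult_right plinear_rder])
  show "plinear (\<lambda>p. if i = j then p else (0 :: 'a free_word \<Rightarrow>\<^sub>0 'b))"
    by (rule plinearI) (auto simp: pm.scale_zero_right)
  fix u
  show "rder j (bvec u * letter i) = (if i = j then bvec u else (0 :: 'a free_word \<Rightarrow>\<^sub>0 'b))"
    by (simp add: bvec_mult rder_def free_word.collapse)
qed

lemma rder_low: "p \<in> low (Suc d) \<Longrightarrow> rder j p \<in> low d"
  by (rule plinear_on_low[OF plinear_rder subspace_low]) (auto simp: rder_def less_Suc_eq_0_disj)

lemma rder_low': "p \<in> low d \<Longrightarrow> rder j p \<in> low d"
  by (rule rder_low[OF low_mono]) auto

lemma rder_mult_form: "rder j (p * form v) = pscale (v j) p"
proof -
  have "rder j (p * form v) = (\<Sum>i\<in>UNIV. if i = j then pscale (v i) p else 0)"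
    unfolding mult_form rder_sum
    by (rule sum.cong) (auto simp: rder_scale rder_mult_letter pm.scale_zero_right)
  thus ?thesis by simp
qed

lemma rder_sum_letters: "rder j (\<Sum>i\<in>UNIV. b i * letter i) = b (j :: 'n::finite)"
  by (simp add: rder_sum rder_mult_letter)

locale quadratic_relation =
  fixes F :: "'k::field^'n::finite^'n" and t :: 'k
  assumes two_generators: "CARD('n) \<ge> 2"
    and invertible_F: "invertible F"
begin

definition rho :: "'n free_word \<Rightarrow>\<^sub>0 'k"
  where "rho = (\<Sum>i\<in>UNIV. \<Sum>j\<in>UNIV. pscale (F $ i $ j) (letter i * letter j)) - pscale t 1"

definition rel :: "'n free_word \<Rightarrow> 'n free_word \<Rightarrow> ('n free_word \<Rightarrow>\<^sub>0 'k)"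
  where "rel u v = bvec u * rho * bvec v"

definition I :: "('n free_word \<Rightarrow>\<^sub>0 'k) set"
  where "I = pm.span {rel u v | u v. True}"

text \<open>The linear form that precedes the letter \<open>j\<close> in the quadratic part of the relator.\<close>

definition col_form :: "'n \<Rightarrow> ('n free_word \<Rightarrow>\<^sub>0 'k)"
  where "col_form j = form (\<lambda>i. F $ i $ j)"

lemma rho_col_form: "rho = (\<Sum>j\<in>UNIV. col_form j * letter j) - pscale t 1"
  unfolding rho_def col_form_def form_def sum_distrib_right pscale_mult_left
  by (subst sum.swap) simp

lemma mult_rho: "e * rho = (\<Sum>j\<in>UNIV. (e * col_form j) * letter j) - pscale t e"
  by (simp add: rho_col_form right_diff_distrib sum_distrib_left mult.assoc pscale_mult_right)

lemma rder_mult_rho: "rder j (e * rho) = e * col_form j - pscale t (rder j e)"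
  by (simp add: mult_rho rder_diff rder_scale rder_sum_letters)

text \<open>
  The consequences of the relator that can be derived without exceeding length \<open>d\<close>. A priori an
  element of the ideal of small length may need a longer derivation; \<open>I_low\<close> below excludes this.
\<close>

definition rel_low :: "nat \<Rightarrow> ('n free_word \<Rightarrow>\<^sub>0 'k) set"
  where "rel_low d = pm.span {rel u v | u v. length (letters u) + length (letters v) + 2 \<le> d}"

lemma subspace_rel_low: "pm.subspace (rel_low d)"
  unfolding rel_low_def by (rule pm.subspace_span)

lemmas rel_low_add = pm.subspace_add[OF subspace_rel_low]
  and rel_low_diff = pm.subspace_diff[OF subspace_rel_low]
  and rel_low_scale = pm.subspace_scale[OF subspace_rel_low]
  and rel_low_sum = pm.subspace_sum[OF subspace_rel_low]
  and zero_in_rel_low [simp] = pm.subspace_0[OF subspace_rel_low]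

lemma rel_in_rel_low: "length (letters u) + length (letters v) + 2 \<le> d \<Longrightarrow> rel u v \<in> rel_low d"
  unfolding rel_low_def by (rule pm.span_base) auto

lemma rel_low_induct [consumes 1]:
  assumes "z \<in> rel_low d" "pm.subspace U"
    "\<And>u v. length (letters u) + length (letters v) + 2 \<le> d \<Longrightarrow> rel u v \<in> U"
  shows "z \<in> U"
  using pm.span_minimal[OF _ assms(2), of "{rel u v | u v. length (letters u) + length (letters v) + 2 \<le> d}"]
    assms(1,3) unfolding rel_low_def by blast

lemma rel_low_mono: "z \<in> rel_low d \<Longrightarrow> d \<le> e \<Longrightarrow> z \<in> rel_low e"
  by (erule rel_low_induct) (auto simp: subspace_rel_low intro: rel_in_rel_low)

lemma rel_low_small: "d < 2 \<Longrightarrow> z \<in> rel_low d \<Longrightarrow> z = 0"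
  by (simp add: rel_low_def)

lemma subspace_preimage: "plinear f \<Longrightarrow> pm.subspace U \<Longrightarrow> pm.subspace {x. f x \<in> U}"
  by (intro pm.subspaceI)
     (auto simp: pmp.linear_0 pmp.linear_add pmp.linear_scale pm.subspace_0 pm.subspace_add pm.subspace_scale)

lemma rel_low_mult_letter: "z \<in> rel_low d \<Longrightarrow> z * letter j \<in> rel_low (Suc d)"
proof (drule rel_low_induct[where U = "{z. z * letter j \<in> rel_low (Suc d)}"])
  fix u v :: "'n free_word" assume "length (letters u) + length (letters v) + 2 \<le> d"
  hence "rel u (v + Free_Word [j]) \<in> rel_low (Suc d)" by (intro rel_in_rel_low) simp
  thus "rel u v \<in> {z. z * letter j \<in> rel_low (Suc d)}"
    by (simp add: rel_def mult.assoc bvec_mult)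
qed (auto intro: subspace_preimage plinear_mult_right subspace_rel_low)

lemma rel_low_mult_form: "z \<in> rel_low d \<Longrightarrow> z * form v \<in> rel_low (Suc d)"
  unfolding mult_form by (intro rel_low_sum rel_low_scale rel_low_mult_letter)

lemma low_mult_rho: "e \<in> low d \<Longrightarrow> e * rho \<in> rel_low (Suc d)"
proof (rule plinear_on_low[of "\<lambda>e. e * rho", OF plinear_mult_right subspace_rel_low])
  fix u :: "'n free_word" assume "length (letters u) < d"
  hence "rel u 0 \<in> rel_low (Suc d)" by (intro rel_in_rel_low) simp
  thus "bvec u * rho \<in> rel_low (Suc d)" by (simp add: rel_def)
qed

text \<open>
  A multiple \<open>u * rho * v\<close> either ends in the relator or has a last letter in \<open>v\<close>.
\<close>

lemma rel_low_decomp: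
  assumes "z \<in> rel_low (Suc d)"
  obtains b e where "\<And>j. b j \<in> rel_low d" "e \<in> low d"
    "z = (\<Sum>j\<in>UNIV. b j * letter j) + e * rho"
proof -
  define U where "U = {z. \<exists>b e. (\<forall>j. b j \<in> rel_low d) \<and> e \<in> low d \<and>
    z = (\<Sum>j\<in>UNIV. b j * letter j) + e * rho}"
  have "pm.subspace U"
  proof (rule pm.subspaceI)
    show "0 \<in> U" unfolding U_def
      by (intro CollectI exI[of _ "\<lambda>_. 0"] exI[of _ 0]) auto
  next
    fix x y assume "x \<in> U" "y \<in> U"
    then obtain b e b' e' where "\<And>j. b j \<in> rel_low d" "e \<in> low d" "\<And>j. b' j \<in> rel_low d" "e' \<in> low d"
      "x = (\<Sum>j\<in>UNIV. b j * letter j) + e * rho" "y = (\<Sum>j\<in>UNIV. b' j * letter j) + e' * rho"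
      unfolding U_def by blast
    thus "x + y \<in> U" unfolding U_def
      by (intro CollectI exI[of _ "\<lambda>j. b j + b' j"] exI[of _ "e + e'"])
         (auto simp: distrib_right sum.distrib intro: rel_low_add low_add)
  next
    fix c x assume "x \<in> U"
    then obtain b e where "\<And>j. b j \<in> rel_low d" "e \<in> low d"
      "x = (\<Sum>j\<in>UNIV. b j * letter j) + e * rho" unfolding U_def by blast
    thus "pscale c x \<in> U" unfolding U_def
      by (intro CollectI exI[of _ "\<lambda>j. pscale c (b j)"] exI[of _ "pscale c e"])
         (auto simp: pm.scale_right_distrib pm.scale_sum_right pscale_mult_left intro: rel_low_scale low_scale)
  qed
  with assms have "z \<in> U"
  proof (rule rel_low_induct)
    fix u v :: "'n free_word" assume len: "length (letters u) + length (letters v) + 2 \<le> Suc d"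
    show "rel u v \<in> U"
    proof (cases v rule: free_word_rev_cases)
      case 1
      thus ?thesis using len unfolding U_def rel_def
        by (intro CollectI exI[of _ "\<lambda>_. 0"] exI[of _ "bvec u"]) auto
    next
      case (2 v' i)
      have "rel u v = rel u v' * letter i" by (simp add: 2 rel_def mult.assoc bvec_mult)
      also have "\<dots> = (\<Sum>j\<in>UNIV. (if j = i then rel u v' else 0) * letter j) + 0 * rho"
        by (simp add: if_distrib[of "\<lambda>x. x * _"] cong: if_cong)
      finally show ?thesis using len 2 unfolding U_def
        by (intro CollectI exI[of _ "\<lambda>j. if j = i then rel u v' else 0"] exI[of _ 0])
           (auto intro!: rel_in_rel_low)
    qed
  qed
  thus ?thesis using that unfolding U_def by blast
qed

lemma nondegenerate:
  assumes "v \<noteq> (\<lambda>_. 0)"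
  shows "(\<lambda>i. \<Sum>j\<in>UNIV. v j * F $ i $ j) \<noteq> (\<lambda>_. 0)"
proof
  assume eq: "(\<lambda>i. \<Sum>j\<in>UNIV. v j * F $ i $ j) = (\<lambda>_. 0)"
  have "F *v (\<chi> j. v j) = 0"
    using fun_cong[OF eq] by (simp add: vec_eq_iff matrix_vector_mult_def mult.commute)
  moreover obtain G where "G ** F = mat 1"
    using invertible_F unfolding invertible_def by blast
  ultimately have "(\<chi> j. v j) = 0"
    by (metis matrix_vector_mul_assoc matrix_vector_mul_lid matrix_vector_mult_0_right)
  hence "v = (\<lambda>_. 0)" by (auto simp: vec_eq_iff)
  with assms show False by contradiction
qed

text \<open>
  With a single generator the only solution would be zero; this is where two generators enter.
\<close>

lemma orthogonal_exists:
  fixes v :: "'n \<Rightarrow> 'k"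
  assumes "v \<noteq> (\<lambda>_. 0)"
  obtains w where "w \<noteq> (\<lambda>_. 0)" "(\<Sum>j\<in>UNIV. w j * v j) = 0"
proof -
  obtain a where a: "v a \<noteq> 0" using assms by blast
  obtain b where b: "b \<noteq> a"
  proof -
    have "UNIV \<noteq> {a}" using two_generators by (metis card.empty card.insert empty_iff finite.emptyI not_less_eq_eq numeral_2_eq_2 le_refl)
    thus ?thesis using that by blast
  qed
  define w where "w j = (if j = b then v a else 0) - (if j = a then v b else 0)" for j
  have "(\<Sum>j\<in>UNIV. w j * v j) = 0"
    by (simp add: w_def left_diff_distrib sum_subtractf if_distrib[of "\<lambda>x. x * _"] mult.commute[of "v a"] cong: if_cong)
  moreover have "w b \<noteq> 0" using a b by (simp add: w_def)
  hence "w \<noteq> (\<lambda>_. 0)" by auto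
  ultimately show ?thesis by (rule that[rotated])
qed

text \<open>
  Right multiplication by a nonzero linear form is injective on the associated graded algebra, here
  expressed by representatives in the free algebra. Comparing last letters in \<open>c v = z\<close>, where
  \<open>z\<close> is a sum of \<open>b\<^sub>j x\<^sub>j\<close> and \<open>e rho\<close>, gives \<open>v\<^sub>j c = b\<^sub>j + e y\<^sub>j\<close> up to lower terms, \<open>y\<^sub>j\<close> being
  the form \<open>col_form j\<close>. A combination of these equations that is orthogonal to \<open>v\<close>
  eliminates \<open>c\<close> and shows that \<open>e\<close> times a linear form vanishes up to lower terms; the form is
  nonzero since the matrix is invertible. As \<open>e\<close> is shorter than
  \<open>c\<close>, induction applies to it, and then the equation with \<open>v\<^sub>j\<close> nonzero disposes of \<open>c\<close>.
\<close>

lemma right_regular: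
  assumes "c \<in> low (Suc d)" "v \<noteq> (\<lambda>_. 0)" "z \<in> rel_low (Suc d)" "c * form v - z \<in> low (Suc d)"
  shows "\<exists>g\<in>rel_low d. c - g \<in> low d"
  using assms
proof (induction d arbitrary: c v z)
  case (0 c v z)
  have "z = 0" using rel_low_small[OF _ 0(3)] by simp
  hence "rder j (c * form v) \<in> low 0" for j using rder_low[OF 0(4)] by simp
  hence "pscale (v j) c = 0" for j by (metis rder_mult_form low_0)
  moreover obtain a where "v a \<noteq> 0" using 0(2) by blast
  ultimately have "c = 0" by (metis pm.scale_eq_0_iff)
  thus ?case by (intro bexI[of _ 0]) auto
next
  case (Suc d c v z)
  obtain b e where b: "\<And>j. b j \<in> rel_low (Suc d)" and e: "e \<in> low (Suc d)"
    and z: "z = (\<Sum>j\<in>UNIV. b j * letter j) + e * rho"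
    by (rule rel_low_decomp[OF Suc.prems(3)]) blast
  have A: "pscale (v j) c - b j - e * col_form j \<in> low (Suc d)" for j
  proof -
    have "rder j (c * form v - z) = pscale (v j) c - b j - e * col_form j + pscale t (rder j e)"
      by (simp add: z rder_diff rder_add rder_mult_form rder_sum_letters rder_mult_rho)
    hence "pscale (v j) c - b j - e * col_form j = rder j (c * form v - z) - pscale t (rder j e)"
      by simp
    also have "\<dots> \<in> low (Suc d)"
      by (intro low_diff low_scale rder_low rder_low' Suc.prems(4) e)
    finally show ?thesis .
  qed
  \<comment> \<open>A combination of these equations that is orthogonal to \<open>v\<close> eliminates \<open>c\<close>.\<close>
  obtain w where w: "w \<noteq> (\<lambda>_. 0)" "(\<Sum>j\<in>UNIV. w j * v j) = 0"
    using orthogonal_exists[OF Suc.prems(2)] .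
  define w' where "w' = (\<lambda>i. \<Sum>j\<in>UNIV. w j * F $ i $ j)"
  have "(\<Sum>j\<in>UNIV. pscale (w j) (e * col_form j)) = e * form w'"
  proof -
    have "(\<Sum>j\<in>UNIV. pscale (w j) (e * col_form j))
      = (\<Sum>j\<in>UNIV. \<Sum>i\<in>UNIV. pscale (w j * F $ i $ j) (e * letter i))"
      by (simp add: col_form_def mult_form pm.scale_sum_right)
    also have "\<dots> = e * form w'"
      by (subst sum.swap) (simp add: mult_form w'_def pm.scale_sum_left)
    finally show ?thesis .
  qed
  moreover have "(\<Sum>j\<in>UNIV. pscale (w j) (pscale (v j) c)) = 0"
    using w(2) by (simp add: pm.scale_sum_left[symmetric])
  ultimately have "e * form w' - (- (\<Sum>j\<in>UNIV. pscale (w j) (b j)))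
      = - (\<Sum>j\<in>UNIV. pscale (w j) (pscale (v j) c - b j - e * col_form j))"
    by (simp add: pm.scale_right_diff_distrib sum_subtractf)
  also have "\<dots> \<in> low (Suc d)"
    by (intro pm.subspace_neg[OF subspace_low] low_sum low_scale A)
  finally have "e * form w' - (- (\<Sum>j\<in>UNIV. pscale (w j) (b j))) \<in> low (Suc d)" .
  moreover have "- (\<Sum>j\<in>UNIV. pscale (w j) (b j)) \<in> rel_low (Suc d)"
    by (intro pm.subspace_neg[OF subspace_rel_low] rel_low_sum rel_low_scale b)
  moreover have "w' \<noteq> (\<lambda>_. 0)" unfolding w'_def by (rule nondegenerate[OF w(1)])
  ultimately obtain g where g: "g \<in> rel_low d" "e - g \<in> low d"
    using Suc.IH[OF e] by blast
  obtain a where a: "v a \<noteq> 0" using Suc.prems(2) by blast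
  have "pscale (v a) c - b a - e * col_form a + (e - g) * col_form a \<in> low (Suc d)"
    using A[of a] mult_form_low[OF g(2)] by (intro low_add) (auto simp: col_form_def)
  hence "pscale (inverse (v a)) (pscale (v a) c - (b a + g * col_form a)) \<in> low (Suc d)"
    by (intro low_scale) (simp add: algebra_simps)
  hence "c - pscale (inverse (v a)) (b a + g * col_form a) \<in> low (Suc d)"
    using a by (simp add: pm.scale_right_diff_distrib)
  moreover have "pscale (inverse (v a)) (b a + g * col_form a) \<in> rel_low (Suc d)"
    using rel_low_mult_form[OF g(1)] by (intro rel_low_scale rel_low_add b) (simp add: col_form_def)
  ultimately show ?case by blast
qed

text \<open>
  The Poincare-Birkhoff-Witt property: when leading terms cancel in a combination of multiples of
  the relator, the result has a shorter derivation. The cofactor \<open>e\<close> of a trailing relator is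
  annihilated by a linear form up to lower terms, so \<open>right_regular\<close> replaces it by an element \<open>g\<close>
  of the ideal and a shorter remainder; expanding \<open>g rho\<close> letter by letter leaves cofactors of last
  letters that are covered by the induction hypothesis.
\<close>

lemma rel_low_descend:
  assumes "z \<in> rel_low (Suc d)" "z \<in> low (Suc d)"
  shows "z \<in> rel_low d"
  using assms
proof (induction d arbitrary: z)
  case (0 z)
  thus ?case using rel_low_small[of "Suc 0" z] by simp
next
  case (Suc d z)
  obtain b e where b: "\<And>j. b j \<in> rel_low (Suc d)" and e: "e \<in> low (Suc d)"
    and z: "z = (\<Sum>j\<in>UNIV. b j * letter j) + e * rho"
    by (rule rel_low_decomp[OF Suc.prems(1)]) blast
  have A: "e * col_form j - (- b j) \<in> low (Suc d)" for j
  proof -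
    have "e * col_form j - (- b j) = rder j z + pscale t (rder j e)"
      by (simp add: z rder_add rder_sum_letters rder_mult_rho)
    also have "\<dots> \<in> low (Suc d)"
      by (rule low_add[OF rder_low[OF Suc.prems(2)] low_scale[OF rder_low'[OF e]]])
    finally show ?thesis .
  qed
  \<comment> \<open>One letter suffices for the descent, and any letter serves.\<close>
  obtain a :: 'n where True by blast
  have "(\<lambda>j. if j = a then 1 else 0 :: 'k) \<noteq> (\<lambda>_. 0)" by (metis one_neq_zero)
  from nondegenerate[OF this] have "(\<lambda>i. F $ i $ a) \<noteq> (\<lambda>_. 0)"
    by (simp add: if_distrib[of "\<lambda>x. x * _"] cong: if_cong)
  then obtain g where g: "g \<in> rel_low d" "e - g \<in> low d"
    using right_regular[OF e _ _ A[of a, unfolded col_form_def]] pm.subspace_neg[OF subspace_rel_low b[of a]]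
    by blast
  define b' where "b' j = b j + g * col_form j" for j
  have zb': "z = (\<Sum>j\<in>UNIV. b' j * letter j) + (e - g) * rho - pscale t g"
    by (simp add: z b'_def distrib_right sum.distrib left_diff_distrib mult_rho[of g])
  have r: "(e - g) * rho \<in> rel_low (Suc d)" by (rule low_mult_rho[OF g(2)])
  have "b' j \<in> rel_low d" for j
  proof (rule Suc.IH)
    show "b' j \<in> rel_low (Suc d)"
      using rel_low_mult_form[OF g(1)] unfolding b'_def by (intro rel_low_add b) (simp add: col_form_def)
    have "b' j = (e * col_form j - (- b j)) - (e - g) * col_form j"
      by (simp add: b'_def algebra_simps)
    also have "\<dots> \<in> low (Suc d)"
      using mult_form_low[OF g(2)] by (intro low_diff A) (simp add: col_form_def)
    finally show "b' j \<in> low (Suc d)" .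
  qed
  thus ?case
    unfolding zb' using r rel_low_mono[OF g(1), of "Suc d"]
    by (intro rel_low_diff rel_low_add rel_low_sum rel_low_scale rel_low_mult_letter) auto
qed

lemma subspace_I: "pm.subspace I"
  unfolding I_def by (rule pm.subspace_span)

lemma rel_in_I: "rel u v \<in> I"
  unfolding I_def by (rule pm.span_base) auto

lemma I_induct [consumes 1]:
  assumes "z \<in> I" "pm.subspace U" "\<And>u v. rel u v \<in> U"
  shows "z \<in> U"
  using pm.span_minimal[OF _ assms(2), of "{rel u v | u v. True}"] assms(1,3) unfolding I_def by blast

lemma I_mult_left: "z \<in> I \<Longrightarrow> bvec u * z \<in> I"
proof (drule I_induct[where U = "{z. bvec u * z \<in> I}"])
  fix u' v show "rel u' v \<in> {z. bvec u * z \<in> I}"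
    using rel_in_I[of "u + u'" v] by (simp add: rel_def mult.assoc[symmetric] bvec_mult)
qed (auto intro: subspace_preimage plinear_mult_left subspace_I)

lemma I_mult_right: "z \<in> I \<Longrightarrow> z * bvec u \<in> I"
proof (drule I_induct[where U = "{z. z * bvec u \<in> I}"])
  fix u' v show "rel u' v \<in> {z. z * bvec u \<in> I}"
    using rel_in_I[of u' "v + u"] by (simp add: rel_def mult.assoc bvec_mult)
qed (auto intro: subspace_preimage plinear_mult_right subspace_I)

lemma I_mult_form: "z \<in> I \<Longrightarrow> z * form v \<in> I"
  unfolding mult_form
  by (intro pm.subspace_sum pm.subspace_scale subspace_I I_mult_right)

lemma rel_low_subset_I: "z \<in> rel_low d \<Longrightarrow> z \<in> I"
  by (erule rel_low_induct) (auto simp: subspace_I rel_in_I)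

lemma I_filtered: "z \<in> I \<Longrightarrow> \<exists>d. z \<in> rel_low d"
proof (drule I_induct[where U = "{z. \<exists>d. z \<in> rel_low d}"])
  show "pm.subspace {z. \<exists>d. z \<in> rel_low d}"
  proof (rule pm.subspaceI)
    fix x y :: "'n free_word \<Rightarrow>\<^sub>0 'k"
    assume "x \<in> {z. \<exists>d. z \<in> rel_low d}" "y \<in> {z. \<exists>d. z \<in> rel_low d}"
    then obtain a b where "x \<in> rel_low a" "y \<in> rel_low b" by blast
    hence "x \<in> rel_low (max a b)" "y \<in> rel_low (max a b)" by (auto intro: rel_low_mono)
    thus "x + y \<in> {z. \<exists>d. z \<in> rel_low d}" by (auto intro: rel_low_add)
  qed (auto intro: rel_low_scale)
qed (auto intro!: exI rel_in_rel_low)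

text \<open>
  The preimage of a piece of the length filtration of the quotient algebra.
\<close>

definition low_mod :: "nat \<Rightarrow> ('n free_word \<Rightarrow>\<^sub>0 'k) set"
  where "low_mod d = {c. \<exists>g\<in>I. c - g \<in> low d}"

lemma I_low: 
  assumes "z \<in> I" "z \<in> low (Suc d)" 
  shows "z \<in> rel_low d"
proof -
  have "z \<in> rel_low d" if "z \<in> rel_low (d + m)" for m
    using that
  proof (induction m)
    case (Suc m)
    thus ?case using rel_low_descend[of z "d + m"] low_mono[OF assms(2), of "Suc (d + m)"] by simp
  qed simp
  moreover obtain e where "z \<in> rel_low e" using I_filtered[OF assms(1)] by blast
  hence "z \<in> rel_low (d + e)" by (rule rel_low_mono) simp
  ultimately show ?thesis .
qed

lemma subspace_low_mod: "pm.subspace (low_mod d)"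
proof (rule pm.subspaceI)
  show "0 \<in> low_mod d" using pm.subspace_0[OF subspace_I] by (auto simp: low_mod_def intro!: bexI[of _ 0])
next
  fix x y assume "x \<in> low_mod d" "y \<in> low_mod d"
  then obtain g h where "g \<in> I" "x - g \<in> low d" "h \<in> I" "y - h \<in> low d"
    by (auto simp: low_mod_def)
  thus "x + y \<in> low_mod d"
    using low_add[of "x - g" d "y - h"] pm.subspace_add[OF subspace_I, of g h]
    by (auto simp: low_mod_def algebra_simps intro!: bexI[of _ "g + h"])
next
  fix c x assume "x \<in> low_mod d"
  then obtain g where "g \<in> I" "x - g \<in> low d" by (auto simp: low_mod_def)
  thus "pscale c x \<in> low_mod d"
    using low_scale[of "x - g" d c] pm.subspace_scale[OF subspace_I, of g c]
    by (auto simp: low_mod_def pm.scale_right_diff_distrib intro!: bexI[of _ "pscale c g"])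
qed

text \<open>
  The associated graded algebra of the quotient has no right socle: multiplication by a linear form
  raises the filtration degree exactly by one.
\<close>

lemma no_socle:
  assumes c: "c \<in> low_mod (Suc d)" and v: "v \<noteq> (\<lambda>_. 0)" and cv: "c * form v \<in> low_mod (Suc d)"
  shows "c \<in> low_mod d"
proof -
  obtain g where g: "g \<in> I" "c - g \<in> low (Suc d)" using c by (auto simp: low_mod_def)
  obtain h where h: "h \<in> I" "c * form v - h \<in> low (Suc d)" using cv by (auto simp: low_mod_def)
  define z where "z = h - g * form v"
  have zI: "z \<in> I" unfolding z_def by (intro pm.subspace_diff subspace_I h I_mult_form g)
  have eq: "(c - g) * form v - z = c * form v - h" by (simp add: z_def left_diff_distrib)
  have "z = (c - g) * form v - (c * form v - h)" using eq by (simp add: algebra_simps)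
  also have "\<dots> \<in> low (Suc (Suc d))"
    by (rule low_diff) (use mult_form_low[OF g(2)] low_mono[OF h(2), of "Suc (Suc d)"] in auto)
  finally have "z \<in> rel_low (Suc d)" by (intro I_low zI)
  with right_regular[OF g(2) v this] h(2) eq obtain g' where "g' \<in> rel_low d" "c - g - g' \<in> low d"
    by auto
  thus ?thesis using pm.subspace_add[OF subspace_I g(1) rel_low_subset_I, of g' d]
    by (auto simp: low_mod_def algebra_simps intro!: bexI[of _ "g + g'"])
qed

end

sublocale quadratic_relation \<subseteq> monoid_algebra_ideal I
  by unfold_locales (auto intro: subspace_I I_mult_left I_mult_right)

section \<open>Derivations and the conormal module\<close>

fun der_list :: "('n \<Rightarrow> ('n free_word list \<Rightarrow>\<^sub>0 'k::field)) \<Rightarrow> 'n list \<Rightarrow> ('n free_word list \<Rightarrow>\<^sub>0 'k)"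
  where "der_list c [] = 0"
  | "der_list c (x # xs) = ract_bar (Free_Word xs) (c x) + lact_bar (Free_Word [x]) (der_list c xs)"

text \<open>The derivation of the free algebra into a tensor power with prescribed values on letters.\<close>

definition der :: "('n \<Rightarrow> ('n free_word list \<Rightarrow>\<^sub>0 'k::field)) \<Rightarrow> ('n free_word \<Rightarrow>\<^sub>0 'k) \<Rightarrow> ('n free_word list \<Rightarrow>\<^sub>0 'k)"
  where "der c = lin_ext (\<lambda>u. der_list c (letters u))"

lemma plinear_der [simp]: "plinear (der c)" by (simp add: der_def)

lemma der_list_tensors: "(\<And>x. c x \<in> tensors (Suc p)) \<Longrightarrow> der_list c xs \<in> tensors (Suc p)"
  by (induction xs)
     (auto intro!: pm.subspace_add[OF subspace_tensors] pm.subspace_0[OF subspace_tensors]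
       ract_bar_tensors lact_bar_tensors)

lemma der_tensors: "(\<And>x. c x \<in> tensors (Suc p)) \<Longrightarrow> der c z \<in> tensors (Suc p)"
  unfolding der_def by (rule lin_ext_in_subspace[OF subspace_tensors]) (rule der_list_tensors)

lemma Free_Word_append: "Free_Word (xs @ ys) = Free_Word xs + Free_Word ys"
  by (simp add: plus_free_word_def)

lemma Free_Word_Cons: "Free_Word (x # xs) = Free_Word [x] + Free_Word xs"
  by (simp add: plus_free_word_def)

lemma Free_Word_Nil: "Free_Word [] = 0"
  by (simp add: zero_free_word_def)

lemma der_list_append:
  assumes c: "\<And>x. c x \<in> tensors (Suc p)"
  shows "der_list c (xs @ ys) = lact_bar (Free_Word xs) (der_list c ys) + ract_bar (Free_Word ys) (der_list c xs)"
proof (induction xs)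
  case Nil
  show ?case
    using lact_bar_0[OF der_list_tensors[OF c]] by (simp add: bar_ops_linear Free_Word_Nil)
next
  case (Cons x xs)
  show ?case
    by (simp add: Cons Free_Word_append Free_Word_Cons[of x xs] bar_ops_linear lact_bar_add ract_bar_add
        lact_ract_bar)
qed

lemma der_plus:
  assumes c: "\<And>x. c x \<in> tensors (Suc p)"
  shows "der c (bvec (u + v)) = lact_bar u (der c (bvec v)) + ract_bar v (der c (bvec u))"
  using der_list_append[where c = c and xs = "letters u" and ys = "letters v", OF c] by (simp add: der_def)

text \<open>
  A derivation restricts to a bimodule map on the ideal, because in the Leibniz rule the other two
  terms contain the action of an element of the ideal.
\<close>

lemma (in monoid_algebra_ideal) sum_sandwich:
  assumes "plinear \<delta>" and plus: "\<And>u v. \<delta> (bvec (u + v)) = lact_bar u (\<delta> (bvec v)) + ract_bar v (\<delta> (bvec u))"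
    and z: "z \<in> I"
  shows "\<delta> (bvec u * z * bvec v) - lact_bar u (ract_bar v (\<delta> z)) \<in> null"
proof -
  have "\<delta> (bvec u * z * bvec v) = lact_bar u (lin_ext (\<lambda>q. lact_bar q (\<delta> (bvec v))) z)
      + lact_bar u (ract_bar v (\<delta> z)) + ract_bar v (lin_ext (\<lambda>q. ract_bar q (\<delta> (bvec u))) z)"
  proof (rule plinear_eqI[of "\<lambda>z. \<delta> (bvec u * z * bvec v)"])
    show "plinear (\<lambda>z. \<delta> (bvec u * z * bvec v))"
      by (rule plinear_compose[OF plinear_compose[OF plinear_mult_left plinear_mult_right] assms(1)])
    show "plinear (\<lambda>z. lact_bar u (lin_ext (\<lambda>q. lact_bar q (\<delta> (bvec v))) z)
      + lact_bar u (ract_bar v (\<delta> z)) + ract_bar v (lin_ext (\<lambda>q. ract_bar q (\<delta> (bvec u))) z))"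
      by (intro plinear_intros plinear_id assms(1))
    fix q
    show "\<delta> (bvec u * bvec q * bvec v) = lact_bar u (lin_ext (\<lambda>q. lact_bar q (\<delta> (bvec v))) (bvec q))
      + lact_bar u (ract_bar v (\<delta> (bvec q))) + ract_bar v (lin_ext (\<lambda>q. ract_bar q (\<delta> (bvec u))) (bvec q))"
      by (simp add: bvec_mult add.assoc plus bar_ops_linear ract_bar_add)
  qed
  thus ?thesis
    using null_add[OF lact_null[OF lact_sum_null[OF z]] ract_null[OF ract_sum_null[OF z]]]
    by (simp add: algebra_simps)
qed

text \<open>
  The bimodule map out of the free bimodule of rank one that takes \<open>1 \<otimes> 1\<close>, the basis vector
  \<open>[0, 0]\<close>, to a given value.
\<close>

definition bim2 :: "('w::monoid_add list \<Rightarrow>\<^sub>0 'k::field) \<Rightarrow> ('w list \<Rightarrow>\<^sub>0 'k) \<Rightarrow> ('w list \<Rightarrow>\<^sub>0 'k)"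
  where "bim2 Y = bim_ext (\<lambda>l. if l = [] then Y else 0)"

lemma bim2_pair [simp]: "bim2 Y (bvec [u, v]) = lact_bar u (ract_bar v Y)"
  using bim_ext_bvec[of "\<lambda>l. if l = [] then Y else 0" u "[]" v] by (simp add: bim2_def)

lemma plinear_bim2 [simp]: "plinear (bim2 Y)" by (simp add: bim2_def)

lemma (in monoid_algebra_ideal) bim2_null: "w \<in> null \<Longrightarrow> bim2 Y w \<in> null"
  unfolding bim2_def by (rule bim_ext_null) (simp add: lin_ext_def pm.scale_zero_right)

lemma length_2_cases:
  assumes "length l = 2" obtains u v where "l = [u, v]"
  using assms by (auto simp: numeral_2_eq_2 length_Suc_conv)

definition functional :: "(('i \<Rightarrow>\<^sub>0 'k::field) \<Rightarrow> 'k) \<Rightarrow> bool"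
  where "functional \<phi> \<longleftrightarrow> (\<forall>x y. \<phi> (x + y) = \<phi> x + \<phi> y) \<and> (\<forall>c x. \<phi> (pscale c x) = c * \<phi> x)"

lemma functional_sum:
  assumes "functional \<phi>"
  shows "lin_ext (\<lambda>u. pscale (\<phi> (bvec u)) Y) z = pscale (\<phi> z) Y"
  by (rule plinear_eqI[of _ "\<lambda>z. pscale (\<phi> z) Y"])
     (use assms in \<open>auto intro!: plinearI simp: functional_def pm.scale_left_distrib\<close>)

text \<open>Contraction of the second factor of a square tensor power against a functional.\<close>

definition contr :: "(('w \<Rightarrow>\<^sub>0 'k::field) \<Rightarrow> 'k) \<Rightarrow> ('w list \<Rightarrow>\<^sub>0 'k) \<Rightarrow> ('w \<Rightarrow>\<^sub>0 'k)"
  where "contr \<phi> = lin_ext (\<lambda>l. if length l = 2 then pscale (\<phi> (bvec (l ! 1))) (bvec (l ! 0)) else 0)"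

lemma plinear_contr [simp]: "plinear (contr \<phi>)" by (simp add: contr_def)

lemma contr_pair [simp]: "contr \<phi> (bvec [u, v]) = pscale (\<phi> (bvec v)) (bvec u)"
  by (simp add: contr_def)

context monoid_algebra_ideal
begin

text \<open>
  A functional that kills the ideal is a functional on the quotient algebra, so the contraction is
  defined there.
\<close>

lemma contr_null:
  assumes \<phi>: "functional \<phi>" "\<And>z. z \<in> I \<Longrightarrow> \<phi> z = 0" and w: "w \<in> null"
  shows "contr \<phi> w \<in> I"
proof (rule null_into_subspace[OF plinear_contr subspace_I _ w])
  fix l1 l2 and z :: "'w \<Rightarrow>\<^sub>0 'k" assume z: "z \<in> I"
  have eq: "contr \<phi> (slot l1 l2 z) = lin_ext (\<lambda>u. contr \<phi> (bvec (l1 @ u # l2))) z"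
    by (simp add: slot_def plinear_of_lin_ext)
  consider v where "l1 = []" "l2 = [v]" | u where "l1 = [u]" "l2 = []" | "length l1 + length l2 \<noteq> 1"
    by (cases l1; cases l2) auto
  thus "contr \<phi> (slot l1 l2 z) \<in> I"
  proof cases
    case (1 v)
    have "lin_ext (\<lambda>u. pscale (\<phi> (bvec v)) (bvec u)) z = pscale (\<phi> (bvec v)) z"
      by (rule plinear_eqI[of _ "\<lambda>z. pscale (\<phi> (bvec v)) z"])
         (auto intro!: plinearI simp: pm.scale_right_distrib pm.scale_left_commute)
    thus ?thesis unfolding eq using 1 z by (simp add: pm.subspace_scale[OF subspace_I])
  next
    case (2 u)
    show ?thesis unfolding eq using 2 \<phi>(2)[OF z] pm.subspace_0[OF subspace_I]
      by (simp add: functional_sum[OF \<phi>(1)])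
  next
    case 3
    hence "contr \<phi> (bvec (l1 @ u # l2)) = 0" for u by (simp add: contr_def)
    thus ?thesis unfolding eq
      using pm.subspace_0[OF subspace_I] by (simp add: lin_ext_def pm.scale_zero_right)
  qed
qed

text \<open>
  Functionals on the quotient algebra separate points of its tensor square. In terms of a basis
  that extends a basis of the ideal, the coefficient of a basis vector in the second factor is the
  contraction against its coordinate functional; basis vectors inside the ideal contribute
  nothing, and the other coordinate functionals kill the ideal.
\<close>

lemma null_by_contraction:
  assumes w: "w \<in> tensors 2"
    and contr: "\<And>\<phi>. functional \<phi> \<Longrightarrow> (\<And>z. z \<in> I \<Longrightarrow> \<phi> z = 0) \<Longrightarrow> contr \<phi> w \<in> I"
  shows "w \<in> null"
proof -
  obtain B0 where B0: "B0 \<subseteq> I" "pm.independent B0" "I \<subseteq> pm.span B0"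
    using pm.maximal_independent_subset by blast
  define B where "B = pm.extend_basis B0"
  have B: "B0 \<subseteq> B" "pm.independent B" "pm.span B = UNIV"
    unfolding B_def using B0(2)
    by (auto simp: pm.extend_basis_superset pm.independent_extend_basis pm.span_extend_basis)
  define \<phi> where "\<phi> b x = pm.representation B x b" for b x :: "'w \<Rightarrow>\<^sub>0 'k"
  have fun\<phi>: "functional (\<phi> b)" for b
    using B by (auto simp: functional_def \<phi>_def pm.representation_add pm.representation_scale)
  have kill: "\<phi> b z = 0" if "z \<in> I" "b \<notin> B0" for b z
  proof -
    have "pm.representation B z = pm.representation B0 z"
      using B B0 that by (intro pm.representation_extend) auto
    thus ?thesis using that(2) pm.representation_ne_zero unfolding \<phi>_def by metis
  qed
  define S where "S = (\<Union>l\<in>Poly_Mapping.keys w. {b. \<phi> b (bvec (l ! 1)) \<noteq> 0})"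
  have finS: "finite S"
    unfolding S_def \<phi>_def by (auto intro: pm.finite_representation)
  define J where "J b p = lin_ext (\<lambda>u. slot [u] [] b) p" for b p :: "'w \<Rightarrow>\<^sub>0 'k"
  have "w = (\<Sum>b\<in>S. J b (contr (\<phi> b) w))"
  proof (rule plinear_eqI[of "\<lambda>w. w" "\<lambda>w. \<Sum>b\<in>S. J b (contr (\<phi> b) w)"])
    show "plinear (\<lambda>w. \<Sum>b\<in>S. J b (contr (\<phi> b) w))"
      unfolding J_def
      by (intro plinearI)
         (simp_all add: pmp.linear_add[OF plinear_contr] pmp.linear_scale[OF plinear_contr]
           lin_ext_add lin_ext_scale sum.distrib pm.scale_sum_right)
    fix l assume l: "l \<in> Poly_Mapping.keys w"
    hence "length l = 2" using w by (auto simp: tensors_def)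
    then obtain u v where uv: "l = [u, v]" by (rule length_2_cases)
    have sub: "{b. \<phi> b (bvec v) \<noteq> 0} \<subseteq> S" using l uv by (force simp: S_def)
    have "bvec v = (\<Sum>b | \<phi> b (bvec v) \<noteq> 0. pscale (\<phi> b (bvec v)) b)"
      unfolding \<phi>_def by (rule pm.sum_nonzero_representation_eq[symmetric]) (use B in auto)
    also have "\<dots> = (\<Sum>b\<in>S. pscale (\<phi> b (bvec v)) b)"
      using sub finS by (intro sum.mono_neutral_left) auto
    finally have v: "bvec v = (\<Sum>b\<in>S. pscale (\<phi> b (bvec v)) b)" .
    have "bvec l = slot [u] [] (bvec v)" by (simp add: uv)
    also have "\<dots> = (\<Sum>b\<in>S. pscale (\<phi> b (bvec v)) (slot [u] [] b))"
      by (subst v) (simp only: pmp.linear_sum[OF plinear_slot] pmp.linear_scale[OF plinear_slot])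
    also have "\<dots> = (\<Sum>b\<in>S. J b (contr (\<phi> b) (bvec l)))"
      by (simp add: uv J_def lin_ext_scale)
    finally show "bvec l = (\<Sum>b\<in>S. J b (contr (\<phi> b) (bvec l)))" .
  qed simp
  also have "\<dots> \<in> null"
  proof (rule pm.subspace_sum[OF subspace_null])
    fix b assume "b \<in> S"
    show "J b (contr (\<phi> b) w) \<in> null"
    proof (cases "b \<in> B0")
      case True
      thus ?thesis unfolding J_def using B0
        by (intro lin_ext_in_subspace subspace_null slot_null) auto
    next
      case False
      hence p: "contr (\<phi> b) w \<in> I" using contr[OF fun\<phi>] kill by blast
      show ?thesis unfolding J_def
      proof (rule plinear_into_subspace[of "\<lambda>b. lin_ext (\<lambda>u. slot [u] [] b) (contr (\<phi> _) w)", OF _ subspace_null])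
        fix v
        show "lin_ext (\<lambda>u. slot [u] [] (bvec v)) (contr (\<phi> b) w) \<in> null"
          using slot_null[OF p, of "[]" "[v]"] by (simp add: slot_def)
      qed (auto intro: plinear_lin_ext_param)
    qed
  qed
  finally show ?thesis .
qed

end

context quadratic_relation
begin

text \<open>
  The Fox derivative with respect to the letter \<open>j\<close>; together they form the universal derivation
  of the free algebra.
\<close>

definition fox :: "'n \<Rightarrow> ('n free_word \<Rightarrow>\<^sub>0 'k) \<Rightarrow> ('n free_word list \<Rightarrow>\<^sub>0 'k)"
  where "fox j = der (\<lambda>x. if x = j then bvec [0, 0] else 0)"

lemma plinear_fox [simp]: "plinear (fox j)" by (simp add: fox_def)

lemma fox_plus: "fox j (bvec (u + v)) = lact_bar u (fox j (bvec v)) + ract_bar v (fox j (bvec u))"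
  unfolding fox_def by (rule der_plus[of _ 1]) (auto simp: pm.subspace_0[OF subspace_tensors])

definition row_form :: "'n \<Rightarrow> ('n free_word \<Rightarrow>\<^sub>0 'k)"
  where "row_form j = form (\<lambda>i. F $ j $ i)"

lemma fox_rho: "fox j rho = slot [] [0] (col_form j) + slot [0] [] (row_form j)"
proof -
  have l: "fox j (letter i) = (if i = j then bvec [0, 0] else 0)" for i
    by (simp add: fox_def der_def Free_Word_Nil bar_ops_linear)
  have ll: "fox j (letter i * letter i') = (if i' = j then bvec [Free_Word [i], 0] else 0)
      + (if i = j then bvec [0, Free_Word [i']] else 0)" for i i'
    by (simp add: bvec_mult fox_plus l bar_ops_linear)
  have one: "fox j 1 = 0" unfolding bvec_zero[symmetric] fox_def der_def lin_ext_bvec by simp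
  have "fox j rho = (\<Sum>i\<in>UNIV. \<Sum>i'\<in>UNIV. pscale (F $ i $ i') (if i' = j then bvec [Free_Word [i], 0] else 0))
    + (\<Sum>i\<in>UNIV. \<Sum>i'\<in>UNIV. pscale (F $ i $ i') (if i = j then bvec [0, Free_Word [i']] else 0))"
    unfolding rho_def
    by (simp add: pmp.linear_diff[OF plinear_fox] pmp.linear_sum[OF plinear_fox] pmp.linear_scale[OF plinear_fox]
        ll one pm.scale_right_distrib sum.distrib pm.scale_zero_right)
  also have "(\<Sum>i\<in>UNIV. \<Sum>i'\<in>UNIV. pscale (F $ i $ i') (if i' = j then bvec [Free_Word [i], 0] else 0))
      = slot [] [0] (col_form j)"
    by (simp add: col_form_def form_def pmp.linear_sum[OF plinear_slot] pmp.linear_scale[OF plinear_slot]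
        if_distrib[of "pscale _"] pm.scale_zero_right cong: if_cong)
  also have "(\<Sum>i\<in>UNIV. \<Sum>i'\<in>UNIV. pscale (F $ i $ i') (if i = j then bvec [0, Free_Word [i']] else 0))
      = slot [0] [] (row_form j)"
    by (subst sum.swap) (simp add: row_form_def form_def pmp.linear_sum[OF plinear_slot] pmp.linear_scale[OF plinear_slot]
        if_distrib[of "pscale _"] pm.scale_zero_right cong: if_cong)
  finally show ?thesis .
qed

text \<open>
  Puts the relator between the two factors, \<open>u \<otimes> v\<close> going to \<open>u rho v\<close>.
\<close>

definition subst_rel :: "('n free_word list \<Rightarrow>\<^sub>0 'k) \<Rightarrow> ('n free_word \<Rightarrow>\<^sub>0 'k)"
  where "subst_rel = lin_ext (\<lambda>l. if length l = 2 then rel (l ! 0) (l ! 1) else 0)"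

lemma plinear_subst_rel [simp]: "plinear subst_rel" by (simp add: subst_rel_def)
lemma subst_rel_pair [simp]: "subst_rel (bvec [u, v]) = rel u v" by (simp add: subst_rel_def)

lemma rho_in_I: "rho \<in> I"
  using rel_in_I[of 0 0] by (simp add: rel_def)

lemma derivation_subst_rel:
  assumes "plinear \<delta>" and plus: "\<And>u v. \<delta> (bvec (u + v)) = lact_bar u (\<delta> (bvec v)) + ract_bar v (\<delta> (bvec u))"
    and w: "w \<in> tensors 2"
  shows "\<delta> (subst_rel w) - bim2 (\<delta> rho) w \<in> null"
proof (rule plinear_on_tensors[of "\<lambda>w. \<delta> (subst_rel w) - bim2 (\<delta> rho) w", OF _ subspace_null _ w])
  show "plinear (\<lambda>w. \<delta> (subst_rel w) - bim2 (\<delta> rho) w)"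
    by (intro plinear_diff plinear_bim2 plinear_compose[OF plinear_subst_rel assms(1)])
  fix l :: "'n free_word list" assume "length l = 2"
  then obtain u v where "l = [u, v]" by (rule length_2_cases)
  thus "\<delta> (subst_rel (bvec l)) - bim2 (\<delta> rho) (bvec l) \<in> null"
    using sum_sandwich[OF assms(1) plus rho_in_I, of u v] by (simp add: rel_def)
qed

lemma contr_fox:
  assumes \<phi>: "functional \<phi>" and w: "w \<in> tensors 2"
  shows "contr \<phi> (bim2 (fox j rho) w) = contr \<phi> w * col_form j + contr (\<lambda>v. \<phi> (row_form j * v)) w"
proof (rule plinear_eq_on_tensors[of "\<lambda>w. contr \<phi> (bim2 (fox j rho) w)"
      "\<lambda>w. contr \<phi> w * col_form j + contr (\<lambda>v. \<phi> (row_form j * v)) w", OF _ _ _ w])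
  show "plinear (\<lambda>w. contr \<phi> (bim2 (fox j rho) w))"
    by (rule plinear_compose[OF plinear_bim2 plinear_contr])
  show "plinear (\<lambda>w. contr \<phi> w * col_form j + contr (\<lambda>v. \<phi> (row_form j * v)) w)"
    by (intro plinear_add plinear_contr plinear_compose[OF plinear_contr plinear_mult_right])
  fix l :: "'n free_word list" assume "length l = 2"
  then obtain u v where uv: "l = [u, v]" by (rule length_2_cases)
  have "contr \<phi> (bim2 (fox j rho) (bvec l)) = 
      lin_ext (\<lambda>q. pscale (\<phi> (bvec v)) (bvec (u + q))) (col_form j)
    + lin_ext (\<lambda>q. pscale (\<phi> (bvec (q + v))) (bvec u)) (row_form j)"
    by (simp add: uv fox_rho bar_ops_linear slot_def plinear_of_lin_ext pmp.linear_add[OF plinear_contr])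
  also have "lin_ext (\<lambda>q. pscale (\<phi> (bvec v)) (bvec (u + q))) (col_form j) = pscale (\<phi> (bvec v)) (bvec u * col_form j)"
    by (rule plinear_eqI[of _ "\<lambda>z. pscale (\<phi> (bvec v)) (bvec u * z)"])
       (auto intro!: plinearI simp: pm.scale_right_distrib pm.scale_left_commute distrib_left pscale_mult_right bvec_mult)
  also have "lin_ext (\<lambda>q. pscale (\<phi> (bvec (q + v))) (bvec u)) (row_form j) = pscale (\<phi> (row_form j * bvec v)) (bvec u)"
    using functional_sum[of "\<lambda>z. \<phi> (z * bvec v)" "bvec u" "row_form j"] \<phi>
    by (simp add: bvec_mult functional_def distrib_right pscale_mult_left)
  finally show "contr \<phi> (bim2 (fox j rho) (bvec l))
      = contr \<phi> (bvec l) * col_form j + contr (\<lambda>v. \<phi> (row_form j * v)) (bvec l)"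
    by (simp add: uv pscale_mult_left)
qed

lemma I_mult_row: "z \<in> I \<Longrightarrow> row_form j * z \<in> I"
  unfolding row_form_def form_def sum_distrib_right pscale_mult_left
  by (intro pm.subspace_sum pm.subspace_scale subspace_I I_mult_left)

text \<open>
  The bimodule \<open>I / I\<^sup>2\<close> is free on the class of the relator. Applying the Fox derivatives to a
  relation \<open>subst_rel w = 0\<close> shows, by \<open>contr_fox\<close>, that right multiplication of the first
  factor of \<open>w\<close> by a linear form equals left multiplication of its second factor by another one,
  up to sign. The second operation does not raise the length of the first factor, so by \<open>no_socle\<close>
  this length can be lowered, until nothing is left.
\<close>

lemma relation_free:
  assumes w: "w \<in> tensors 2" and zero: "subst_rel w = 0"
  shows "w \<in> null"
proof (rule null_by_contraction[OF w])
  have d: "bim2 (fox j rho) w \<in> null" for j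
    using null_neg[OF derivation_subst_rel[OF plinear_fox fox_plus w, of j]]
    by (simp add: zero pmp.linear_0[OF plinear_fox])
  define kills where "kills \<phi> \<longleftrightarrow> functional \<phi> \<and> (\<forall>z\<in>I. \<phi> z = 0)" for \<phi> :: "('n free_word \<Rightarrow>\<^sub>0 'k) \<Rightarrow> 'k"
  \<comment> \<open>One letter suffices for the descent, and any letter serves.\<close>
  obtain a :: 'n where True by blast
  have "(\<lambda>j. if j = a then 1 else 0 :: 'k) \<noteq> (\<lambda>_. 0)" by (metis one_neq_zero)
  from nondegenerate[OF this] have a: "(\<lambda>i. F $ i $ a) \<noteq> (\<lambda>_. 0)"
    by (simp add: if_distrib[of "\<lambda>x. x * _"] cong: if_cong)
  have descend: "\<forall>\<phi>. kills \<phi> \<longrightarrow> contr \<phi> w \<in> low_mod d" if "\<forall>\<phi>. kills \<phi> \<longrightarrow> contr \<phi> w \<in> low_mod (Suc d)" for d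
  proof (intro allI impI)
    fix \<phi> assume \<phi>: "kills \<phi>"
    have \<phi>': "kills (\<lambda>v. \<phi> (row_form a * v))"
      using \<phi> I_mult_row by (auto simp: kills_def functional_def distrib_left pscale_mult_right)
    have "contr \<phi> (bim2 (fox a rho) w) \<in> I"
      using \<phi> d by (intro contr_null) (auto simp: kills_def)
    hence "contr \<phi> w * col_form a + contr (\<lambda>v. \<phi> (row_form a * v)) w \<in> low_mod (Suc d)"
      using \<phi> contr_fox[OF _ w, of \<phi> a] by (auto simp: kills_def low_mod_def intro!: bexI)
    hence "contr \<phi> w * col_form a \<in> low_mod (Suc d)"
      using pm.subspace_diff[OF subspace_low_mod, of "contr \<phi> w * col_form a + contr (\<lambda>v. \<phi> (row_form a * v)) w" "Suc d"
          "contr (\<lambda>v. \<phi> (row_form a * v)) w"] that \<phi>' by simp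
    thus "contr \<phi> w \<in> low_mod d"
      using no_socle[OF _ a] that \<phi> unfolding col_form_def by blast
  qed
  obtain D where D: "\<And>l. l \<in> Poly_Mapping.keys w \<Longrightarrow> length (letters (l ! 0)) < D"
    using finite_imageI[OF finite_keys[of w], of "\<lambda>l. length (letters (l ! 0))"]
    unfolding finite_nat_set_iff_bounded by auto
  have "\<forall>\<phi>. kills \<phi> \<longrightarrow> contr \<phi> w \<in> low_mod D"
  proof (intro allI impI)
    fix \<phi>
    have "contr \<phi> w \<in> low D"
      unfolding contr_def using D
      by (intro lin_ext_in_subspace subspace_low) (auto intro: low_scale)
    thus "contr \<phi> w \<in> low_mod D"
      using pm.subspace_0[OF subspace_I] by (auto simp: low_mod_def intro!: bexI[of _ 0])
  qed
  hence "\<forall>\<phi>. kills \<phi> \<longrightarrow> contr \<phi> w \<in> low_mod 0"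
  proof (induction D)
    case (Suc D)
    from Suc.IH show ?case using descend[of D] Suc.prems by blast
  qed blast
  moreover have "low_mod 0 \<subseteq> I"
    by (auto simp: low_mod_def dest: low_0)
  ultimately show "contr \<phi> w \<in> I" if "functional \<phi>" "\<And>z. z \<in> I \<Longrightarrow> \<phi> z = 0" for \<phi>
    using that by (auto simp: kills_def)
qed

end

section \<open>Contracting the bar resolution in high degrees\<close>

context quadratic_relation
begin

text \<open>
  The universal derivation with values in the third tensor power: the sum of all ways to single out
  a letter as the middle entry.
\<close>

definition Du :: "('n free_word \<Rightarrow>\<^sub>0 'k) \<Rightarrow> ('n free_word list \<Rightarrow>\<^sub>0 'k)"
  where "Du = der (\<lambda>x. bvec [0, Free_Word [x], 0])"

lemma plinear_Du [simp]: "plinear Du" by (simp add: Du_def)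

lemma Du_tensors: "Du z \<in> tensors (Suc 2)"
  unfolding Du_def by (rule der_tensors) simp

lemma Du_plus: "Du (bvec (u + v)) = lact_bar u (Du (bvec v)) + ract_bar v (Du (bvec u))"
  unfolding Du_def by (rule der_plus[of _ 2]) simp

text \<open>
  The sum telescopes. So \<open>[0, u, 0] - Du u\<close> is a cycle, and prefixing the unit makes it a boundary;
  this is what \<open>split_free\<close> records.
\<close>

lemma bar_Du: "bar (Du (bvec u)) = bvec [u, 0] - bvec [0, u]"
proof -
  have "bar (der_list (\<lambda>x. bvec [0, Free_Word [x], 0]) xs)
      = (bvec [Free_Word xs, 0] - bvec [0, Free_Word xs] :: 'n free_word list \<Rightarrow>\<^sub>0 'k)" for xs
  proof (induction xs)
    case Nil
    show ?case by (simp add: bar_ops_linear Free_Word_Nil)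
  next
    case (Cons x xs)
    show ?case
      by (simp add: bar_ops_linear bar_lact bar_ract Cons Free_Word_Cons[of x xs] del: ract_bar_bvec)
         (simp add: bar_ops_linear)
  qed
  from this[of "letters u"] show ?thesis by (simp add: Du_def der_def)
qed

definition split_free :: "('n free_word \<Rightarrow>\<^sub>0 'k) \<Rightarrow> ('n free_word list \<Rightarrow>\<^sub>0 'k)"
  where "split_free = lin_ext (\<lambda>u. lcons 0 (bvec [0, u, 0] - Du (bvec u)))"

lemma plinear_split_free [simp]: "plinear split_free" by (simp add: split_free_def)

lemma split_Du_tensors: "bvec [0, u, 0] - Du (bvec u) \<in> tensors (Suc 2)"
  using Du_tensors by (intro pm.subspace_diff[OF subspace_tensors]) auto

lemma split_free_tensors: "split_free z \<in> tensors (Suc 3)"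
  unfolding split_free_def using lcons_tensors[OF split_Du_tensors]
  by (intro lin_ext_in_subspace subspace_tensors) (simp add: eval_nat_numeral)

lemma bar_split_free: "bar (split_free z) = slot [0] [0] z - Du z"
proof (rule plinear_eqI[of "\<lambda>z. bar (split_free z)" "\<lambda>z. slot [0] [0] z - Du z"])
  show "plinear (\<lambda>z. bar (split_free z))" by (rule plinear_compose[OF plinear_split_free plinear_bar])
  show "plinear (\<lambda>z. slot [0] [0] z - Du z)" by (intro plinear_diff plinear_slot plinear_Du)
  fix u
  have "bar (bvec [0, u, 0] - Du (bvec u)) = 0"
    by (simp add: bar_ops_linear bar_Du)
  thus "bar (split_free (bvec u)) = slot [0] [0] (bvec u) - Du (bvec u)"
    unfolding split_free_def lin_ext_bvec bar_lcons[OF split_Du_tensors] lact_bar_0[OF split_Du_tensors]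
    by (simp add: pmp.linear_0[OF plinear_lcons])
qed

lemma subspace_eq_UNIV:
  assumes "pm.span B = UNIV" "pm.subspace U" "B \<subseteq> U"
  shows "z \<in> U"
  using pm.span_minimal[OF assms(3,2)] assms(1) by auto

text \<open>
  The map \<open>split_free\<close> does not respect the ideal. It is redefined on a basis of the ideal formed by
  multiples of the relator, as the bimodule map that agrees with \<open>split_free\<close> on the relator. Its
  differential is unchanged modulo \<open>null\<close>, because the derivation \<open>Du\<close> is a bimodule map on the
  ideal. By \<open>relation_free\<close> the choice of the basis is immaterial: the formula holds for every
  multiple of the relator.
\<close>

lemma adjusted_splitting:
  obtains E' where "plinear E'" "\<And>z. E' z \<in> tensors (Suc 3)"
    "\<And>z. bar (E' z) - (slot [0] [0] z - Du z) \<in> null"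
    "\<And>u v. E' (rel u v) - lact_bar u (ract_bar v (split_free rho)) \<in> null"
proof -
  obtain B0 where B0: "B0 \<subseteq> {rel u v | u v. True}" "pm.independent B0" "{rel u v | u v. True} \<subseteq> pm.span B0"
    using pm.maximal_independent_subset by blast
  define B where "B = pm.extend_basis B0"
  have B: "B0 \<subseteq> B" "pm.independent B" "pm.span B = UNIV"
    unfolding B_def using B0(2)
    by (auto simp: pm.extend_basis_superset pm.independent_extend_basis pm.span_extend_basis)
  have "\<forall>b\<in>B0. \<exists>p q. b = rel p q" using B0(1) by blast
  then obtain p q where pq: "\<And>b. b \<in> B0 \<Longrightarrow> b = rel (p b) (q b)" by metis
  obtain E' where E': "plinear E'" and E'B0: "\<And>b. b \<in> B0 \<Longrightarrow> E' b = lact_bar (p b) (ract_bar (q b) (split_free rho))"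
    and E'B: "\<And>b. b \<in> B - B0 \<Longrightarrow> E' b = split_free b"
    using pmp.linear_independent_extend[OF B(2), of "\<lambda>b. if b \<in> B0 then lact_bar (p b) (ract_bar (q b) (split_free rho)) else split_free b"] B(1)
    by (metis DiffD1 DiffD2 subsetD)
  show ?thesis
  proof (rule that[OF E'])
    show "E' z \<in> tensors (Suc 3)" for z
    proof -
      have "B \<subseteq> {z. E' z \<in> tensors (Suc 3)}"
      proof
        fix b assume "b \<in> B"
        hence "E' b \<in> tensors (Suc 3)"
          by (cases "b \<in> B0") (simp_all only: E'B0 E'B Diff_iff simp_thms lact_bar_tensors ract_bar_tensors split_free_tensors)
        thus "b \<in> {z. E' z \<in> tensors (Suc 3)}" by simp
      qed
      from subspace_eq_UNIV[OF B(3) subspace_preimage[OF E' subspace_tensors] this] show ?thesis by simp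
    qed
    show "bar (E' z) - (slot [0] [0] z - Du z) \<in> null" for z
    proof -
      have lin: "plinear (\<lambda>z. bar (E' z) - (slot [0] [0] z - Du z))"
        by (intro plinear_diff plinear_slot plinear_Du plinear_compose[OF E' plinear_bar])
      have "B \<subseteq> {z. bar (E' z) - (slot [0] [0] z - Du z) \<in> null}"
      proof
        fix b assume b: "b \<in> B"
        show "b \<in> {z. bar (E' z) - (slot [0] [0] z - Du z) \<in> null}"
        proof (cases "b \<in> B0")
          case False
          thus ?thesis using b by (simp add: E'B bar_split_free)
        next
          case True
          let ?u = "p b" and ?v = "q b"
          have "bar (E' b) - (slot [0] [0] b - Du b)
            = lact_bar ?u (ract_bar ?v (slot [0] [0] rho)) - slot [0] [0] b
              + (Du (rel ?u ?v) - lact_bar ?u (ract_bar ?v (Du rho)))"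
            by (simp add: E'B0[OF True] bar_lact bar_ract bar_split_free bar_ops_linear flip: pq[OF True])
          also have "\<dots> \<in> null"
          proof (rule null_add)
            have "b \<in> I" using rel_in_I[of ?u ?v] pq[OF True] by simp
            thus "lact_bar ?u (ract_bar ?v (slot [0] [0] rho)) - slot [0] [0] b \<in> null"
              by (intro null_diff lact_null ract_null slot_null rho_in_I)
            show "Du (rel ?u ?v) - lact_bar ?u (ract_bar ?v (Du rho)) \<in> null"
              unfolding rel_def by (rule sum_sandwich[OF plinear_Du Du_plus rho_in_I])
          qed
          finally show ?thesis by simp
        qed
      qed
      from subspace_eq_UNIV[OF B(3) subspace_preimage[OF lin subspace_null] this] show ?thesis by simp
    qed
    show "E' (rel u v) - lact_bar u (ract_bar v (split_free rho)) \<in> null" for u v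
    proof -
      have "rel u v \<in> pm.span B0" using B0(3) by blast
      then obtain S c where S: "finite S" "S \<subseteq> B0" "rel u v = (\<Sum>b\<in>S. pscale (c b) b)"
        unfolding pm.span_explicit by blast
      define w where "w = bvec [u, v] - (\<Sum>b\<in>S. pscale (c b) (bvec [p b, q b]))"
      have "w \<in> tensors 2"
        unfolding w_def
        by (intro pm.subspace_diff pm.subspace_sum pm.subspace_scale subspace_tensors) auto
      moreover have "subst_rel w = 0"
      proof -
        have "(\<Sum>b\<in>S. pscale (c b) (rel (p b) (q b))) = (\<Sum>b\<in>S. pscale (c b) b)"
          using S(2) pq by (intro sum.cong) auto
        thus ?thesis
          by (simp add: w_def pmp.linear_diff[OF plinear_subst_rel] pmp.linear_sum[OF plinear_subst_rel]
              pmp.linear_scale[OF plinear_subst_rel] S(3))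
      qed
      ultimately have "w \<in> null" by (rule relation_free)
      hence "bim2 (split_free rho) w \<in> null" by (rule bim2_null)
      moreover have "bim2 (split_free rho) w = lact_bar u (ract_bar v (split_free rho)) - E' (rel u v)"
      proof -
        have "(\<Sum>b\<in>S. pscale (c b) (lact_bar (p b) (ract_bar (q b) (split_free rho)))) = (\<Sum>b\<in>S. pscale (c b) (E' b))"
          using S(2) E'B0 by (intro sum.cong) auto
        thus ?thesis
          by (simp add: w_def pmp.linear_diff[OF plinear_bim2] pmp.linear_sum[OF plinear_bim2]
              pmp.linear_scale[OF plinear_bim2] S(3) pmp.linear_sum[OF E'] pmp.linear_scale[OF E'])
      qed
      ultimately show ?thesis using null_neg by fastforce
    qed
  qed
qed

text \<open>
  The function \<open>h u v = u E' v - E' (u v) + (E' u) v\<close> is a Hochschild coboundary, so its bimodule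
  extension kills boundaries; it respects the ideal because \<open>E'\<close> is a bimodule map there; and its
  differential is that of the generator \<open>[0, u, v, 0]\<close>, since the contributions of the derivation
  cancel. Thus the second syzygy of the algebra, the image of the differential in the third tensor
  power, splits off the fourth one.
\<close>

lemma resolution_endomorphism:
  obtains P where "null_map P" "\<And>l. length l = 4 \<Longrightarrow> P (bvec l) \<in> tensors 4"
    "\<And>l. length l = 4 \<Longrightarrow> bar (P (bvec l)) - bar_list l \<in> null"
    "\<And>l. length l = Suc 4 \<Longrightarrow> P (bar_list l) \<in> null"
proof -
  obtain E' where E': "plinear E'" and ten: "\<And>z. E' z \<in> tensors (Suc 3)"
    and lift: "\<And>z. bar (E' z) - (slot [0] [0] z - Du z) \<in> null"
    and rel: "\<And>u v. E' (rel u v) - lact_bar u (ract_bar v (split_free rho)) \<in> null"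
    using adjusted_splitting by blast
  have left: "E' (bvec a * z) - lact_bar a (E' z) \<in> null" if "z \<in> I" for a z
  proof -
    have lin: "plinear (\<lambda>z. E' (bvec a * z) - lact_bar a (E' z))"
      by (intro plinear_diff plinear_compose[OF plinear_mult_left E'] plinear_compose[OF E' plinear_lact_bar])
    have "z \<in> {z. E' (bvec a * z) - lact_bar a (E' z) \<in> null}"
    proof (rule I_induct[OF that subspace_preimage[OF lin subspace_null]])
      fix u v
      have "E' (rel (a + u) v) - lact_bar (a + u) (ract_bar v (split_free rho))
          - lact_bar a (E' (rel u v) - lact_bar u (ract_bar v (split_free rho))) \<in> null"
        by (intro null_diff rel lact_null)
      thus "rel u v \<in> {z. E' (bvec a * z) - lact_bar a (E' z) \<in> null}"
        by (simp add: lact_bar_add bar_ops_linear rel_def mult.assoc[symmetric] bvec_mult)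
    qed
    thus ?thesis by simp
  qed
  have right: "E' (z * bvec a) - ract_bar a (E' z) \<in> null" if "z \<in> I" for a z
  proof -
    have lin: "plinear (\<lambda>z. E' (z * bvec a) - ract_bar a (E' z))"
      by (intro plinear_diff plinear_compose[OF plinear_mult_right E'] plinear_compose[OF E' plinear_ract_bar])
    have "z \<in> {z. E' (z * bvec a) - ract_bar a (E' z) \<in> null}"
    proof (rule I_induct[OF that subspace_preimage[OF lin subspace_null]])
      fix u v
      have "E' (rel u (v + a)) - lact_bar u (ract_bar (v + a) (split_free rho))
          - ract_bar a (E' (rel u v) - lact_bar u (ract_bar v (split_free rho))) \<in> null"
        by (intro null_diff rel ract_null)
      thus "rel u v \<in> {z. E' (z * bvec a) - ract_bar a (E' z) \<in> null}"
        by (simp add: ract_bar_add bar_ops_linear lact_ract_bar rel_def mult.assoc bvec_mult)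
    qed
    thus ?thesis by simp
  qed
  define h where "h u v = lact_bar u (E' (bvec v)) - E' (bvec (u + v)) + ract_bar v (E' (bvec u))" for u v
  define g where "g l = (if length l = 2 then h (l ! 0) (l ! 1) else 0)" for l
  define P where "P = bim_ext g"
  have P4: "P (bvec [a, u, v, b]) = lact_bar a (ract_bar b (h u v))" for a u v b
    using bim_ext_bvec[of g a "[u, v]" b] by (simp add: P_def g_def)
  have htens: "h u v \<in> tensors (Suc 3)" for u v
    unfolding h_def
    by (intro pm.subspace_add pm.subspace_diff subspace_tensors lact_bar_tensors ract_bar_tensors ten)
  have linP: "plinear P" by (simp add: P_def)
  have dh: "bar (h u v) - bar_list [0, u, v, 0] \<in> null" for u v
  proof -
    have "bar (h u v) - bar_list [0, u, v, 0]
      = lact_bar u (bar (E' (bvec v)) - (slot [0] [0] (bvec v) - Du (bvec v)))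
      - (bar (E' (bvec (u + v))) - (slot [0] [0] (bvec (u + v)) - Du (bvec (u + v))))
      + ract_bar v (bar (E' (bvec u)) - (slot [0] [0] (bvec u) - Du (bvec u)))"
      by (simp add: h_def bar_ops_linear bar_lact bar_ract Du_plus)
    also have "\<dots> \<in> null"
      by (intro null_add null_diff lift lact_null ract_null)
    finally show ?thesis .
  qed
  show ?thesis
  proof (rule that)
    show "null_map P"
      unfolding null_map_def
    proof (intro conjI ballI)
      show "bimodule_map P" unfolding P_def by (rule bimodule_map_bim_ext)
      fix w :: "'n free_word list \<Rightarrow>\<^sub>0 'k" assume w: "w \<in> null"
      show "P w \<in> null"
        unfolding P_def
      proof (rule bim_ext_null[OF _ w])
        fix l1 l2 :: "'n free_word list" and z :: "'n free_word \<Rightarrow>\<^sub>0 'k" assume z: "z \<in> I"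
        consider v where "l1 = []" "l2 = [v]" | u where "l1 = [u]" "l2 = []" | "length l1 + length l2 \<noteq> 1"
          by (cases l1; cases l2) auto
        thus "lin_ext (\<lambda>u. g (l1 @ u # l2)) z \<in> null"
        proof cases
          case (1 v)
          have "lin_ext (\<lambda>u. g (l1 @ u # l2)) z
            = lin_ext (\<lambda>u. lact_bar u (E' (bvec v))) z - (E' (z * bvec v) - ract_bar v (E' z))"
            unfolding 1
            by (rule plinear_eqI[of _ "\<lambda>z. lin_ext (\<lambda>u. lact_bar u (E' (bvec v))) z - (E' (z * bvec v) - ract_bar v (E' z))"])
               (auto intro!: plinear_diff plinear_compose[OF plinear_mult_right E'] plinear_compose[OF E' plinear_ract_bar]
                  simp: g_def h_def bvec_mult)
          thus ?thesis using null_diff[OF lact_sum_null[OF z] right[OF z]] by simp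
        next
          case (2 u)
          have "lin_ext (\<lambda>v. g (l1 @ v # l2)) z
            = lin_ext (\<lambda>v. ract_bar v (E' (bvec u))) z - (E' (bvec u * z) - lact_bar u (E' z))"
            unfolding 2
            by (rule plinear_eqI[of _ "\<lambda>z. lin_ext (\<lambda>v. ract_bar v (E' (bvec u))) z - (E' (bvec u * z) - lact_bar u (E' z))"])
               (auto intro!: plinear_diff plinear_compose[OF plinear_mult_left E'] plinear_compose[OF E' plinear_lact_bar]
                  simp: g_def h_def bvec_mult)
          thus ?thesis using null_diff[OF ract_sum_null[OF z] left[OF z]] by simp
        next
          case 3
          hence "g (l1 @ u # l2) = 0" for u by (simp add: g_def)
          thus ?thesis by (simp add: lin_ext_def pm.scale_zero_right)
        qed
      qed
    qed
    fix l :: "'n free_word list"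
    have len4: "\<exists>a u v b. l = [a, u, v, b]" if "length l = 4"
      using that by (auto simp: eval_nat_numeral length_Suc_conv)
    show "P (bvec l) \<in> tensors 4" if l4: "length l = 4"
    proof -
      obtain a u v b where l: "l = [a, u, v, b]" using len4[OF l4] by blast
      have "P (bvec l) \<in> tensors (Suc 3)"
        unfolding l P4 by (intro lact_bar_tensors ract_bar_tensors htens)
      thus ?thesis by simp
    qed
    show "bar (P (bvec l)) - bar_list l \<in> null" if l4: "length l = 4"
    proof -
      obtain a u v b where l: "l = [a, u, v, b]" using len4[OF l4] by blast
      have "bar_list l = lact_bar a (ract_bar b (bar_list [0, u, v, 0]))"
        by (simp add: l bar_ops_linear)
      hence "bar (P (bvec l)) - bar_list l = lact_bar a (ract_bar b (bar (h u v) - bar_list [0, u, v, 0]))"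
        by (simp add: l P4 bar_lact bar_ract bar_ops_linear del: bar_list.simps)
      thus ?thesis using lact_null[OF ract_null[OF dh]] by simp
    qed
    show "P (bar_list l) \<in> null" if l5: "length l = Suc 4"
    proof -
      obtain a u v w b where l: "l = [a, u, v, w, b]"
        using l5 by (auto simp: eval_nat_numeral length_Suc_conv)
      have cocycle: "lact_bar u (h v w) - h (u + v) w + h u (v + w) - ract_bar w (h u v) = 0"
        by (simp add: h_def bar_ops_linear lact_bar_add ract_bar_add lact_ract_bar add.assoc)
      have "P (bar_list l) = P (bvec [a + u, v, w, b]) - P (bvec [a, u + v, w, b])
          + P (bvec [a, u, v + w, b]) - P (bvec [a, u, v, w + b])"
        by (simp add: l bar_ops_linear pmp.linear_diff[OF linP] pmp.linear_add[OF linP])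
      also have "\<dots> = lact_bar a (ract_bar b (lact_bar u (h v w) - h (u + v) w + h u (v + w) - ract_bar w (h u v)))"
        by (simp add: P4 bar_ops_linear lact_bar_add ract_bar_add lact_ract_bar)
      also have "\<dots> = 0" by (simp add: cocycle bar_ops_linear)
      finally show ?thesis by simp
    qed
  qed
qed

lemma bar_contraction:
  assumes "4 \<le> q"
  obtains S S' where "null_map S" "null_map S'"
    "\<And>w. w \<in> tensors q \<Longrightarrow> S w \<in> tensors (Suc q)"
    "\<And>w. w \<in> tensors (Suc q) \<Longrightarrow> S' w \<in> tensors (Suc (Suc q))"
    "\<And>w. w \<in> tensors (Suc q) \<Longrightarrow> bar (S' w) + S (bar w) - w \<in> null"
proof -
  obtain P where P: "null_map P" "\<And>l. length l = 4 \<Longrightarrow> P (bvec l) \<in> tensors 4"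
    "\<And>l. length l = 4 \<Longrightarrow> bar (P (bvec l)) - bar_list l \<in> null"
    "\<And>l. length l = Suc 4 \<Longrightarrow> P (bar_list l) \<in> null"
    by (rule resolution_endomorphism) blast
  show ?thesis
    by (rule contraction_above[OF P(1,2) _ P(3,4) assms]) (simp_all add: that)
qed

end

section \<open>Evaluation of bar chains in coefficients\<close>

locale algebra_presentation = monoid_algebra_ideal I
  for I :: "('w::monoid_add \<Rightarrow>\<^sub>0 'k::field) set" +
  fixes A :: "('k, 'a) module" (structure) and cls :: "('w \<Rightarrow>\<^sub>0 'k) \<Rightarrow> 'a"
  assumes algebra: "assoc_algebra A"
    and cls_image: "range cls = carrier A"
    and cls_add: "cls (p + q) = cls p \<oplus> cls q"
    and cls_mult: "cls (p * q) = cls p \<otimes> cls q"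
    and cls_one: "cls 1 = \<one>"
    and cls_scale: "cls (pscale c p) = c \<odot> cls p"
    and cls_eq_iff: "cls p = cls q \<longleftrightarrow> p - q \<in> I"
begin

sublocale ring A using algebra by (rule assoc_algebra.is_ring)

lemma cls_closed [simp, intro]: "cls p \<in> carrier A"
  using cls_image by auto

lemma smult_closed [simp, intro]: "a \<in> carrier A \<Longrightarrow> c \<odot> a \<in> carrier A"
  using cls_image cls_scale by (metis cls_closed imageE)

definition rep :: "'a \<Rightarrow> ('w \<Rightarrow>\<^sub>0 'k)"
  where "rep a = (SOME p. cls p = a)"

lemma cls_rep [simp]: "a \<in> carrier A \<Longrightarrow> cls (rep a) = a"
  unfolding rep_def using cls_image by (metis (mono_tags, lifting) imageE someI_ex)

abbreviation wcls :: "'w \<Rightarrow> 'a"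
  where "wcls u \<equiv> cls (bvec u)"

lemma smult_mult_left: "a \<in> carrier A \<Longrightarrow> b \<in> carrier A \<Longrightarrow> (c \<odot> a) \<otimes> b = c \<odot> (a \<otimes> b)"
  and smult_mult_right: "a \<in> carrier A \<Longrightarrow> b \<in> carrier A \<Longrightarrow> a \<otimes> (c \<odot> b) = c \<odot> (a \<otimes> b)"
  using algebra by (auto intro: assoc_algebra.smult_mult_left assoc_algebra.smult_mult_right)

fun ten :: "('w \<Rightarrow>\<^sub>0 'k) list \<Rightarrow> ('w list \<Rightarrow>\<^sub>0 'k)"
  where "ten [] = bvec []"
  | "ten (p # ps) = lin_ext (\<lambda>u. lcons u (ten ps)) p"

lemma ten_tensors: "ten ps \<in> tensors (length ps)"
  by (induction ps) (auto intro!: lin_ext_in_subspace subspace_tensors lcons_tensors)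

lemma ten_bvec: "ten (map bvec l) = bvec l"
  by (induction l) auto

lemma plinear_lcons_sum: "plinear (\<lambda>Y. lin_ext (\<lambda>u. lcons u Y) p)"
  by (rule plinear_lin_ext_param) simp

lemma plinear_ten: "plinear (\<lambda>p. ten (l1 @ p # l2))"
proof (induction l1)
  case Nil
  show ?case by simp
next
  case (Cons q l1)
  show ?case using plinear_compose[OF Cons plinear_lcons_sum] by simp
qed

lemma lcons_sum_preserves_null: "Y \<in> null \<Longrightarrow> lin_ext (\<lambda>u. lcons u Y) p \<in> null"
  by (intro lin_ext_in_subspace subspace_null lcons_null)

lemma ten_cong:
  assumes "list_all2 (\<lambda>p q. p - q \<in> I) ps qs"
  shows "ten ps - ten qs \<in> null"
  using assms
proof (induction rule: list_all2_induct)
  case (Cons p ps q qs)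
  have "ten (p # ps) - ten (q # qs)
    = lin_ext (\<lambda>u. lcons u (ten ps - ten qs)) p + lin_ext (\<lambda>u. lcons u (ten qs)) (p - q)"
    by (simp add: lin_ext_diff lin_ext_diff_fun bar_ops_linear)
  thus ?case
    using Cons lcons_sum_null lcons_sum_preserves_null by (auto intro: null_add)
qed simp

lemma lin_ext_mult: "lin_ext g (p * q) = lin_ext (\<lambda>u. lin_ext (\<lambda>v. g (u + v)) q) p"
proof (rule plinear_eqI[of "\<lambda>p. lin_ext g (p * q)"])
  fix u
  show "lin_ext g (bvec u * q) = lin_ext (\<lambda>u. lin_ext (\<lambda>v. g (u + v)) q) (bvec u)"
    by (simp add: lin_ext_plus_left)
qed (auto intro!: plinear_compose[OF plinear_mult_right])

lemma lact_ten: "lin_ext (\<lambda>u. lact_bar u (ten (q # ps))) p = ten (p * q # ps)"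
  by (simp add: plinear_of_lin_ext lact_lcons lin_ext_mult)

lemma ract_ten: "lin_ext (\<lambda>u. ract_bar u (ten (ps @ [q]))) p = ten (ps @ [q * p])"
proof (induction ps)
  case Nil
  have "lin_ext (\<lambda>u. ract_bar u (ten [q])) p = lin_ext (\<lambda>u. lin_ext (\<lambda>v. bvec [v + u]) q) p"
    by (simp add: plinear_of_lin_ext)
  also have "\<dots> = lin_ext (\<lambda>v. bvec [v]) (q * p)"
  proof (rule plinear_eqI[of _ "\<lambda>p. lin_ext (\<lambda>v. bvec [v]) (q * p)"])
    show "plinear (\<lambda>p. lin_ext (\<lambda>v. bvec [v]) (q * p))"
      by (rule plinear_compose[OF plinear_mult_left plinear_lin_ext])
  qed (simp_all add: lin_ext_plus_right)
  finally show ?case by simp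
next
  case (Cons r ps)
  have t: "ten (ps @ [q]) \<in> tensors (Suc (length ps))"
    using ten_tensors[of "ps @ [q]"] by simp
  have "lin_ext (\<lambda>u. ract_bar u (ten ((r # ps) @ [q]))) p
    = lin_ext (\<lambda>u. lin_ext (\<lambda>v. lcons v (ract_bar u (ten (ps @ [q])))) r) p"
    by (simp add: plinear_of_lin_ext ract_lcons[OF t])
  also have "\<dots> = lin_ext (\<lambda>v. lcons v (lin_ext (\<lambda>u. ract_bar u (ten (ps @ [q]))) p)) r"
    using plinear_of_lin_ext[OF plinear_lcons_sum[of r], of "\<lambda>u. ract_bar u (ten (ps @ [q]))" p]
    by simp
  finally show ?case by (simp add: Cons)
qed

end

text \<open>
  Coefficients in an abelian group modulo a subgroup \<open>N\<close>. A function of a scalar and a tuple in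
  the algebra that is balanced modulo \<open>N\<close> is a map from a tensor power to the quotient.
\<close>

locale coefficients = algebra_presentation I A cls
  for I :: "('w::monoid_add \<Rightarrow>\<^sub>0 'k::field) set" and A :: "('k, 'a) module" (structure) and cls +
  fixes N :: "'g::ab_group_add set"
  assumes N_zero [simp]: "0 \<in> N"
    and N_add: "x \<in> N \<Longrightarrow> y \<in> N \<Longrightarrow> x + y \<in> N"
    and N_uminus: "x \<in> N \<Longrightarrow> - x \<in> N"
begin

definition cong_N :: "'g \<Rightarrow> 'g \<Rightarrow> bool" (infix \<open>\<doteq>\<close> 50)
  where "x \<doteq> y \<longleftrightarrow> x - y \<in> N"

lemma cong_refl [simp]: "x \<doteq> x" by (simp add: cong_N_def)

lemma cong_sym: "x \<doteq> y \<Longrightarrow> y \<doteq> x"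
  using N_uminus by (fastforce simp: cong_N_def)

lemma cong_trans [trans]: "x \<doteq> y \<Longrightarrow> y \<doteq> z \<Longrightarrow> x \<doteq> z"
  using N_add[of "x - y" "y - z"] by (simp add: cong_N_def)

lemma cong_add: "x \<doteq> y \<Longrightarrow> x' \<doteq> y' \<Longrightarrow> x + x' \<doteq> y + y'"
  using N_add[of "x - y" "x' - y'"] by (simp add: cong_N_def algebra_simps)

lemma cong_uminus: "x \<doteq> y \<Longrightarrow> - x \<doteq> - y"
  using N_uminus[of "x - y"] by (simp add: cong_N_def)

lemma cong_diff: "x \<doteq> y \<Longrightarrow> x' \<doteq> y' \<Longrightarrow> x - x' \<doteq> y - y'"
  using cong_add[OF _ cong_uminus] by fastforce

lemma cong_sum: "(\<And>i. i \<in> S \<Longrightarrow> f i \<doteq> g i) \<Longrightarrow> sum f S \<doteq> sum g S"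
  by (induction S rule: infinite_finite_induct) (auto intro: cong_add)

lemma cong_iff_diff: "x \<doteq> y \<longleftrightarrow> x - y \<doteq> 0" by (simp add: cong_N_def)

definition additive_N :: "('v::ab_group_add \<Rightarrow> 'g) \<Rightarrow> bool"
  where "additive_N f \<longleftrightarrow> (\<forall>x y. f (x + y) \<doteq> f x + f y)"

lemma additive_zero:
  assumes "additive_N f" shows "f 0 \<doteq> 0"
  using assms[unfolded additive_N_def, rule_format, of 0 0] N_uminus
  by (fastforce simp: cong_N_def)

lemma additive_sum:
  assumes "additive_N f"
  shows "f (sum g S) \<doteq> (\<Sum>i\<in>S. f (g i))"
proof (induction S rule: infinite_finite_induct)
  case (insert x S)
  hence "f (sum g (insert x S)) \<doteq> f (g x) + f (sum g S)"
    using assms by (simp add: additive_N_def)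
  also have "\<dots> \<doteq> f (g x) + (\<Sum>i\<in>S. f (g i))"
    by (intro cong_add insert.IH) simp
  finally show ?case using insert by simp
qed (use additive_zero[OF assms] in auto)

lemma additive_eq:
  assumes "additive_N f" "additive_N g"
    "\<And>l c. l \<in> Poly_Mapping.keys w \<Longrightarrow> f (pscale c (bvec l)) \<doteq> g (pscale c (bvec l))"
  shows "f w \<doteq> g (w :: 'i \<Rightarrow>\<^sub>0 'k)"
proof -
  let ?s = "\<lambda>l. pscale (Poly_Mapping.lookup w l) (bvec l)"
  have "f (\<Sum>l\<in>Poly_Mapping.keys w. ?s l) \<doteq> (\<Sum>l\<in>Poly_Mapping.keys w. f (?s l))"
    by (rule additive_sum[OF assms(1)])
  also have "\<dots> \<doteq> (\<Sum>l\<in>Poly_Mapping.keys w. g (?s l))"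
    by (rule cong_sum) (rule assms(3))
  also have "\<dots> \<doteq> g (\<Sum>l\<in>Poly_Mapping.keys w. ?s l)"
    by (rule cong_sym[OF additive_sum[OF assms(2)]])
  finally show ?thesis by (simp only: bvec_expansion[symmetric])
qed

text \<open>
  The scalar is an argument of its own, so that no slot of the tuple is privileged and the empty
  tuple needs no special treatment.
\<close>

definition balanced :: "('k \<Rightarrow> 'a list \<Rightarrow> 'g) \<Rightarrow> bool"
  where "balanced \<beta> \<longleftrightarrow>
    (\<forall>c c' l. set l \<subseteq> carrier A \<longrightarrow> \<beta> (c + c') l \<doteq> \<beta> c l + \<beta> c' l) \<and>
    (\<forall>c l1 a b l2. set l1 \<subseteq> carrier A \<and> a \<in> carrier A \<and> b \<in> carrier A \<and> set l2 \<subseteq> carrier A \<longrightarrow>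
       \<beta> c (l1 @ (a \<oplus> b) # l2) \<doteq> \<beta> c (l1 @ a # l2) + \<beta> c (l1 @ b # l2)) \<and>
    (\<forall>c c' l1 a l2. set l1 \<subseteq> carrier A \<and> a \<in> carrier A \<and> set l2 \<subseteq> carrier A \<longrightarrow>
       \<beta> c (l1 @ (c' \<odot> a) # l2) \<doteq> \<beta> (c * c') (l1 @ a # l2))"

lemma balanced_scalar:
  "balanced \<beta> \<Longrightarrow> set l \<subseteq> carrier A \<Longrightarrow> \<beta> (c + c') l \<doteq> \<beta> c l + \<beta> c' l"
  by (simp add: balanced_def)

lemma balanced_slot_add:
  "balanced \<beta> \<Longrightarrow> set l1 \<subseteq> carrier A \<Longrightarrow> a \<in> carrier A \<Longrightarrow> b \<in> carrier A \<Longrightarrow> set l2 \<subseteq> carrier A \<Longrightarrow>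
    \<beta> c (l1 @ (a \<oplus> b) # l2) \<doteq> \<beta> c (l1 @ a # l2) + \<beta> c (l1 @ b # l2)"
  by (simp add: balanced_def)

lemma balanced_slot_smult:
  "balanced \<beta> \<Longrightarrow> set l1 \<subseteq> carrier A \<Longrightarrow> a \<in> carrier A \<Longrightarrow> set l2 \<subseteq> carrier A \<Longrightarrow>
    \<beta> c (l1 @ (c' \<odot> a) # l2) \<doteq> \<beta> (c * c') (l1 @ a # l2)"
  by (simp add: balanced_def)

lemma balanced_zero:
  assumes "balanced \<beta>" "set l \<subseteq> carrier A" shows "\<beta> 0 l \<doteq> 0"
  using balanced_scalar[OF assms, of 0 0] N_uminus by (fastforce simp: cong_N_def)

lemma balanced_scale: "balanced \<beta> \<Longrightarrow> balanced (\<lambda>c' l. \<beta> (c * c') l)"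
  by (simp add: balanced_def distrib_left flip: mult.assoc)

definition beta_cons :: "'a \<Rightarrow> ('k \<Rightarrow> 'a list \<Rightarrow> 'g) \<Rightarrow> 'k \<Rightarrow> 'a list \<Rightarrow> 'g"
  where "beta_cons a \<beta> c l = \<beta> c (a # l)"

lemma balanced_cons:
  assumes "balanced \<beta>" "a \<in> carrier A" shows "balanced (beta_cons a \<beta>)"
  unfolding balanced_def beta_cons_def
  using balanced_scalar[OF assms(1), of "a # _"] balanced_slot_add[OF assms(1), of "a # _"]
    balanced_slot_smult[OF assms(1), of "a # _"] assms(2)
  by simp

definition beta_left :: "'a \<Rightarrow> ('k \<Rightarrow> 'a list \<Rightarrow> 'g) \<Rightarrow> 'k \<Rightarrow> 'a list \<Rightarrow> 'g"
  where "beta_left a \<beta> c l = \<beta> c (case l of [] \<Rightarrow> [a] | b # l' \<Rightarrow> (a \<otimes> b) # l')"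

definition beta_right :: "'a \<Rightarrow> ('k \<Rightarrow> 'a list \<Rightarrow> 'g) \<Rightarrow> 'k \<Rightarrow> 'a list \<Rightarrow> 'g"
  where "beta_right a \<beta> c l = \<beta> c (if l = [] then [a] else butlast l @ [last l \<otimes> a])"

lemma beta_cons_apply: "beta_cons a \<beta> c l = \<beta> c (a # l)"
  and beta_left_apply: "beta_left a \<beta> c l = \<beta> c (case l of [] \<Rightarrow> [a] | b # l' \<Rightarrow> (a \<otimes> b) # l')"
  and beta_right_apply: "beta_right a \<beta> c l = \<beta> c (if l = [] then [a] else butlast l @ [last l \<otimes> a])"
  by (simp_all only: beta_cons_def beta_left_def beta_right_def)

lemma beta_right_snoc [simp]: "beta_right a \<beta> c (l @ [b]) = \<beta> c (l @ [b \<otimes> a])"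
  by (simp add: beta_right_def)

lemma beta_left_Cons [simp]: "beta_left a \<beta> c (b # l) = \<beta> c ((a \<otimes> b) # l)"
  by (simp add: beta_left_def)

lemma balanced_left:
  assumes \<beta>: "balanced \<beta>" and a: "a \<in> carrier A"
  shows "balanced (beta_left a \<beta>)"
  unfolding balanced_def
proof (intro conjI allI impI; (elim conjE)?)
  fix c c' l assume "set l \<subseteq> carrier A"
  thus "beta_left a \<beta> (c + c') l \<doteq> beta_left a \<beta> c l + beta_left a \<beta> c' l"
    unfolding beta_left_def using a by (intro balanced_scalar \<beta>) (auto split: list.splits)
next
  fix c l1 x y l2
  assume *: "set l1 \<subseteq> carrier A" "x \<in> carrier A" "y \<in> carrier A" "set l2 \<subseteq> carrier A"
  show "beta_left a \<beta> c (l1 @ (x \<oplus> y) # l2) \<doteq> beta_left a \<beta> c (l1 @ x # l2) + beta_left a \<beta> c (l1 @ y # l2)"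
  proof (cases l1)
    case Nil
    thus ?thesis using * a balanced_slot_add[OF \<beta>, of "[]" "a \<otimes> x" "a \<otimes> y" l2 c] by (simp add: r_distr)
  next
    case (Cons b l1')
    thus ?thesis using * a balanced_slot_add[OF \<beta>, of "(a \<otimes> b) # l1'" x y l2 c] by simp
  qed
next
  fix c c' l1 x l2
  assume *: "set l1 \<subseteq> carrier A" "x \<in> carrier A" "set l2 \<subseteq> carrier A"
  show "beta_left a \<beta> c (l1 @ (c' \<odot> x) # l2) \<doteq> beta_left a \<beta> (c * c') (l1 @ x # l2)"
  proof (cases l1)
    case Nil
    thus ?thesis using * a balanced_slot_smult[OF \<beta>, of "[]" "a \<otimes> x" l2 c c'] by (simp add: smult_mult_right)
  next
    case (Cons b l1')
    thus ?thesis using * a balanced_slot_smult[OF \<beta>, of "(a \<otimes> b) # l1'" x l2 c c'] by simp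
  qed
qed

lemma balanced_right:
  assumes \<beta>: "balanced \<beta>" and a: "a \<in> carrier A"
  shows "balanced (beta_right a \<beta>)"
  unfolding balanced_def
proof (intro conjI allI impI; (elim conjE)?)
  fix c c' l assume "set l \<subseteq> carrier A"
  thus "beta_right a \<beta> (c + c') l \<doteq> beta_right a \<beta> c l + beta_right a \<beta> c' l"
    unfolding beta_right_def using a by (intro balanced_scalar \<beta>) (cases l rule: rev_cases; auto)
next
  fix c l1 x y l2
  assume *: "set l1 \<subseteq> carrier A" "x \<in> carrier A" "y \<in> carrier A" "set l2 \<subseteq> carrier A"
  show "beta_right a \<beta> c (l1 @ (x \<oplus> y) # l2) \<doteq> beta_right a \<beta> c (l1 @ x # l2) + beta_right a \<beta> c (l1 @ y # l2)"
  proof (cases l2 rule: rev_cases)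
    case Nil
    thus ?thesis using * a balanced_slot_add[OF \<beta>, of l1 "x \<otimes> a" "y \<otimes> a" "[]" c] by (simp add: l_distr)
  next
    case (snoc l2' b)
    have "beta_right a \<beta> c (l1 @ z # l2) = \<beta> c (l1 @ z # l2' @ [b \<otimes> a])" for z
      using beta_right_snoc[of a \<beta> c "l1 @ z # l2'" b] by (simp add: snoc)
    thus ?thesis using * a snoc balanced_slot_add[OF \<beta>, of l1 x y "l2' @ [b \<otimes> a]" c] by simp
  qed
next
  fix c c' l1 x l2
  assume *: "set l1 \<subseteq> carrier A" "x \<in> carrier A" "set l2 \<subseteq> carrier A"
  show "beta_right a \<beta> c (l1 @ (c' \<odot> x) # l2) \<doteq> beta_right a \<beta> (c * c') (l1 @ x # l2)"
  proof (cases l2 rule: rev_cases)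
    case Nil
    thus ?thesis using * a balanced_slot_smult[OF \<beta>, of l1 "x \<otimes> a" "[]" c c'] by (simp add: smult_mult_left)
  next
    case (snoc l2' b)
    have "beta_right a \<beta> c (l1 @ z # l2) = \<beta> c (l1 @ z # l2' @ [b \<otimes> a])" for c z
      using beta_right_snoc[of a \<beta> c "l1 @ z # l2'" b] by (simp add: snoc)
    thus ?thesis using * a snoc balanced_slot_smult[OF \<beta>, of l1 x "l2' @ [b \<otimes> a]" c c'] by simp
  qed
qed

definition ev :: "('k \<Rightarrow> 'a list \<Rightarrow> 'g) \<Rightarrow> ('w list \<Rightarrow>\<^sub>0 'k) \<Rightarrow> 'g"
  where "ev \<beta> w = (\<Sum>l\<in>Poly_Mapping.keys w. \<beta> (Poly_Mapping.lookup w l) (map wcls l))"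

lemma set_map_wcls: "set (map wcls l) \<subseteq> carrier A" by auto

lemma ev_superset:
  assumes "balanced \<beta>" "finite S" "Poly_Mapping.keys w \<subseteq> S"
  shows "ev \<beta> w \<doteq> (\<Sum>l\<in>S. \<beta> (Poly_Mapping.lookup w l) (map wcls l))"
proof -
  have "(\<Sum>l\<in>S. \<beta> (Poly_Mapping.lookup w l) (map wcls l))
    \<doteq> (\<Sum>l\<in>S. if l \<in> Poly_Mapping.keys w then \<beta> (Poly_Mapping.lookup w l) (map wcls l) else 0)"
    using balanced_zero[OF assms(1) set_map_wcls] by (intro cong_sum) (auto simp: in_keys_iff)
  also have "\<dots> = ev \<beta> w"
    unfolding ev_def sum.inter_restrict[OF assms(2), symmetric] using assms(3)
    by (simp add: Int_absorb1)
  finally show ?thesis by (rule cong_sym)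
qed

lemma additive_ev:
  assumes "balanced \<beta>" shows "additive_N (ev \<beta>)"
  unfolding additive_N_def
proof (intro allI)
  fix x y :: "'w list \<Rightarrow>\<^sub>0 'k"
  let ?S = "Poly_Mapping.keys x \<union> Poly_Mapping.keys y"
  have "ev \<beta> (x + y) \<doteq> (\<Sum>l\<in>?S. \<beta> (Poly_Mapping.lookup (x + y) l) (map wcls l))"
    by (rule ev_superset[OF assms]) (use Poly_Mapping.keys_add[of x y] in auto)
  also have "\<dots> \<doteq> (\<Sum>l\<in>?S. \<beta> (Poly_Mapping.lookup x l) (map wcls l) + \<beta> (Poly_Mapping.lookup y l) (map wcls l))"
    by (rule cong_sum) (simp only: lookup_add balanced_scalar[OF assms set_map_wcls])
  also have "\<dots> = (\<Sum>l\<in>?S. \<beta> (Poly_Mapping.lookup x l) (map wcls l)) + (\<Sum>l\<in>?S. \<beta> (Poly_Mapping.lookup y l) (map wcls l))"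
    by (rule sum.distrib)
  also have "\<dots> \<doteq> ev \<beta> x + ev \<beta> y"
    by (intro cong_add cong_sym[OF ev_superset[OF assms]]) auto
  finally show "ev \<beta> (x + y) \<doteq> ev \<beta> x + ev \<beta> y" .
qed

lemma ev_add: "balanced \<beta> \<Longrightarrow> ev \<beta> (x + y) \<doteq> ev \<beta> x + ev \<beta> y"
  using additive_ev by (simp add: additive_N_def)

lemma ev_diff: "balanced \<beta> \<Longrightarrow> ev \<beta> (x - y) \<doteq> ev \<beta> x - ev \<beta> y"
  using ev_add[of \<beta> "x - y" y] cong_sym[of "ev \<beta> x" "ev \<beta> (x - y) + ev \<beta> y"]
  by (simp add: cong_N_def algebra_simps)

lemma additive_ev_linear: "balanced \<beta> \<Longrightarrow> plinear f \<Longrightarrow> additive_N (\<lambda>w. ev \<beta> (f w))"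
  using ev_add by (simp add: additive_N_def pmp.linear_add)

lemma ev_cong:
  assumes "\<And>c l. l \<in> Poly_Mapping.keys w \<Longrightarrow> \<beta> c (map wcls l) \<doteq> \<beta>' c (map wcls l)"
  shows "ev \<beta> w \<doteq> ev \<beta>' w"
  unfolding ev_def by (rule cong_sum) (rule assms)

lemma ev_cong': "(\<And>c l. set l \<subseteq> carrier A \<Longrightarrow> \<beta> c l \<doteq> \<beta>' c l) \<Longrightarrow> ev \<beta> w \<doteq> ev \<beta>' w"
  using set_map_wcls by (intro ev_cong) blast

lemma ev_bvec: "ev \<beta> (bvec l) = \<beta> 1 (map wcls l)"
  by (simp add: ev_def)

lemma ev_scale:
  assumes "balanced \<beta>" shows "ev \<beta> (pscale c w) \<doteq> ev (\<lambda>c' l. \<beta> (c * c') l) w"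
proof -
  have "Poly_Mapping.keys (pscale c w) \<subseteq> Poly_Mapping.keys w" by (auto simp: in_keys_iff)
  from ev_superset[OF assms finite_keys this] show ?thesis by (simp add: ev_def)
qed

lemma ev_single: "balanced \<beta> \<Longrightarrow> ev \<beta> (pscale c (bvec l)) \<doteq> \<beta> c (map wcls l)"
  using ev_scale[of \<beta> c "bvec l"] by (simp add: ev_bvec)

lemma ev_operator:
  assumes \<beta>: "balanced \<beta>" and \<beta>': "balanced \<beta>'" and f: "plinear f"
    and single: "\<And>c l. f (pscale c (bvec l)) = pscale c (bvec (g l))"
    and eq: "\<And>c l. \<beta> c (map wcls (g l)) = \<beta>' c (map wcls l)"
  shows "ev \<beta> (f Y) \<doteq> ev \<beta>' Y"
proof (rule additive_eq[OF additive_ev_linear[OF \<beta> f] additive_ev[OF \<beta>']])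
  fix c l
  have "ev \<beta> (f (pscale c (bvec l))) \<doteq> \<beta>' c (map wcls l)"
    using ev_single[OF \<beta>, of c "g l"] by (simp add: single eq)
  also have "\<dots> \<doteq> ev \<beta>' (pscale c (bvec l))"
    by (rule cong_sym[OF ev_single[OF \<beta>']])
  finally show "ev \<beta> (f (pscale c (bvec l))) \<doteq> ev \<beta>' (pscale c (bvec l))" .
qed

lemma wcls_add: "wcls (u + v) = wcls u \<otimes> wcls v"
  by (simp flip: cls_mult add: bvec_mult)

lemma ev_lcons: "balanced \<beta> \<Longrightarrow> ev \<beta> (lcons u Y) \<doteq> ev (beta_cons (wcls u) \<beta>) Y"
proof (rule ev_operator[where g = "\<lambda>l. u # l"])
  show "\<beta> c (map wcls (u # l)) = beta_cons (wcls u) \<beta> c (map wcls l)" for c l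
    by (simp add: beta_cons_apply)
qed (auto simp: balanced_cons bar_ops_linear)

lemma ev_lact: "balanced \<beta> \<Longrightarrow> ev \<beta> (lact_bar u Y) \<doteq> ev (beta_left (wcls u) \<beta>) Y"
proof (rule ev_operator[where g = "lmul u"])
  show "\<beta> c (map wcls (lmul u l)) = beta_left (wcls u) \<beta> c (map wcls l)" for c l
    by (cases l) (auto simp: beta_left_apply wcls_add)
qed (auto simp: balanced_left bar_ops_linear)

lemma ev_ract: "balanced \<beta> \<Longrightarrow> ev \<beta> (ract_bar u Y) \<doteq> ev (beta_right (wcls u) \<beta>) Y"
proof (rule ev_operator[where g = "rmul u"])
  show "\<beta> c (map wcls (rmul u l)) = beta_right (wcls u) \<beta> c (map wcls l)" for c l
    by (cases l rule: rev_cases) (auto simp: beta_right_apply wcls_add rmul_append)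
qed (auto simp: balanced_right bar_ops_linear)

text \<open>An operation by words extends linearly to an operation by elements of the algebra.\<close>

lemma ev_family:
  assumes \<beta>: "balanced \<beta>" and f: "\<And>u. plinear (f u)"
    and word: "\<And>\<beta> u. balanced \<beta> \<Longrightarrow> ev \<beta> (f u Y) \<doteq> ev (B (wcls u) \<beta>) Y"
    and scalar: "\<And>a c c' l \<beta>. B a (\<lambda>c'. \<beta> (c * c')) c' l = B a \<beta> (c * c') l"
    and add: "\<And>a b c l. a \<in> carrier A \<Longrightarrow> b \<in> carrier A \<Longrightarrow> set l \<subseteq> carrier A \<Longrightarrow>
      B (a \<oplus> b) \<beta> c l \<doteq> B a \<beta> c l + B b \<beta> c l"
    and smult: "\<And>a c c' l. a \<in> carrier A \<Longrightarrow> set l \<subseteq> carrier A \<Longrightarrow> B (c' \<odot> a) \<beta> c l \<doteq> B a \<beta> (c * c') l"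
  shows "ev \<beta> (lin_ext (\<lambda>u. f u Y) p) \<doteq> ev (B (cls p) \<beta>) Y"
proof (rule additive_eq[OF additive_ev_linear[OF \<beta> plinear_lin_ext]])
  show "additive_N (\<lambda>p. ev (B (cls p) \<beta>) Y)"
    unfolding additive_N_def cls_add
    by (auto simp: ev_def sum.distrib[symmetric] intro!: cong_sum add)
  fix c u
  have "ev \<beta> (lin_ext (\<lambda>u. f u Y) (pscale c (bvec u))) \<doteq> ev (\<lambda>c' l. \<beta> (c * c') l) (f u Y)"
    using ev_scale[OF \<beta>] by (simp add: lin_ext_scale)
  also have "\<dots> \<doteq> ev (B (wcls u) (\<lambda>c' l. \<beta> (c * c') l)) Y"
    by (rule word) (rule balanced_scale[OF \<beta>])
  also have "\<dots> \<doteq> ev (B (c \<odot> wcls u) \<beta>) Y"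
  proof (rule ev_cong')
    fix c' l assume "set l \<subseteq> carrier A"
    hence "B (c \<odot> wcls u) \<beta> c' l \<doteq> B (wcls u) \<beta> (c' * c) l" by (intro smult) auto
    thus "B (wcls u) (\<lambda>c' l. \<beta> (c * c') l) c' l \<doteq> B (c \<odot> wcls u) \<beta> c' l"
      using cong_sym by (simp add: scalar mult.commute[of c c'])
  qed
  finally show "ev \<beta> (lin_ext (\<lambda>u. f u Y) (pscale c (bvec u))) \<doteq> ev (B (cls (pscale c (bvec u))) \<beta>) Y"
    by (simp add: cls_scale)
qed

lemma ev_lcons_sum:
  assumes "balanced \<beta>"
  shows "ev \<beta> (lin_ext (\<lambda>u. lcons u Y) p) \<doteq> ev (beta_cons (cls p) \<beta>) Y"
proof (rule ev_family[where f = lcons and B = beta_cons, OF assms _ ev_lcons])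
  show "beta_cons (a \<oplus> b) \<beta> c l \<doteq> beta_cons a \<beta> c l + beta_cons b \<beta> c l"
    if "a \<in> carrier A" "b \<in> carrier A" "set l \<subseteq> carrier A" for a b c l
    using balanced_slot_add[OF assms, of "[]" a b l c] that by (simp add: beta_cons_apply)
  show "beta_cons (c' \<odot> a) \<beta> c l \<doteq> beta_cons a \<beta> (c * c') l"
    if "a \<in> carrier A" "set l \<subseteq> carrier A" for a c c' l
    using balanced_slot_smult[OF assms, of "[]" a l c c'] that by (simp add: beta_cons_apply)
qed (simp_all add: beta_cons_apply)

lemma ev_lact_sum:
  assumes "balanced \<beta>"
  shows "ev \<beta> (lin_ext (\<lambda>u. lact_bar u Y) p) \<doteq> ev (beta_left (cls p) \<beta>) Y"
proof (rule ev_family[where f = lact_bar and B = beta_left, OF assms _ ev_lact])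
  show "beta_left (a \<oplus> b) \<beta> c l \<doteq> beta_left a \<beta> c l + beta_left b \<beta> c l"
    if "a \<in> carrier A" "b \<in> carrier A" "set l \<subseteq> carrier A" for a b c l
    using balanced_slot_add[OF assms, of "[]"] that
    by (auto simp: beta_left_apply l_distr split: list.splits)
  show "beta_left (c' \<odot> a) \<beta> c l \<doteq> beta_left a \<beta> (c * c') l"
    if "a \<in> carrier A" "set l \<subseteq> carrier A" for a c c' l
    using balanced_slot_smult[OF assms, of "[]"] that
    by (auto simp: beta_left_apply smult_mult_left split: list.splits)
qed (simp_all add: beta_left_apply)

lemma ev_ract_sum:
  assumes "balanced \<beta>"
  shows "ev \<beta> (lin_ext (\<lambda>u. ract_bar u Y) p) \<doteq> ev (beta_right (cls p) \<beta>) Y"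
proof (rule ev_family[where f = ract_bar and B = beta_right, OF assms _ ev_ract])
  fix a b c l assume *: "a \<in> carrier A" "b \<in> carrier A" "set l \<subseteq> carrier A"
  show "beta_right (a \<oplus> b) \<beta> c l \<doteq> beta_right a \<beta> c l + beta_right b \<beta> c l"
  proof (cases l rule: rev_cases)
    case Nil
    thus ?thesis using * balanced_slot_add[OF assms, of "[]" a b "[]" c] by (simp add: beta_right_apply)
  next
    case (snoc m d)
    thus ?thesis using * balanced_slot_add[OF assms, of m "d \<otimes> a" "d \<otimes> b" "[]" c] by (simp add: r_distr)
  qed
next
  fix a c c' l assume *: "a \<in> carrier A" "set l \<subseteq> carrier A"
  show "beta_right (c' \<odot> a) \<beta> c l \<doteq> beta_right a \<beta> (c * c') l"
  proof (cases l rule: rev_cases)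
    case Nil
    thus ?thesis using * balanced_slot_smult[OF assms, of "[]" a "[]" c c'] by (simp add: beta_right_apply)
  next
    case (snoc m d)
    thus ?thesis using * balanced_slot_smult[OF assms, of m "d \<otimes> a" "[]" c c'] by (simp add: smult_mult_right)
  qed
qed (simp_all add: beta_right_apply)

lemma ev_ten: "balanced \<beta> \<Longrightarrow> ev \<beta> (ten ps) \<doteq> \<beta> 1 (map cls ps)"
proof (induction ps arbitrary: \<beta>)
  case Nil
  show ?case by (simp add: ev_bvec)
next
  case (Cons p ps)
  have "ev \<beta> (ten (p # ps)) \<doteq> ev (beta_cons (cls p) \<beta>) (ten ps)"
    using ev_lcons_sum[OF Cons.prems] by simp
  also have "\<dots> \<doteq> beta_cons (cls p) \<beta> 1 (map cls ps)"
    by (rule Cons.IH) (simp add: balanced_cons Cons.prems)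
  finally show ?case by (simp add: beta_cons_apply)
qed

lemma ev_ten_scale:
  assumes "balanced \<beta>" shows "ev \<beta> (pscale c (ten ps)) \<doteq> \<beta> c (map cls ps)"
  using cong_trans[OF ev_scale[OF assms] ev_ten[OF balanced_scale[OF assms]]] by simp

lemma cls_I: "z \<in> I \<Longrightarrow> cls z = \<zero>"
  using cls_eq_iff[of z 0] cls_add[of 0 0] add.l_cancel[of "cls 0" "cls 0" \<zero>] by simp

text \<open>
  Evaluation factors through the tensor powers of the quotient algebra.
\<close>

lemma ev_null:
  assumes "w \<in> null" "balanced \<beta>" shows "ev \<beta> w \<doteq> 0"
proof -
  have slot0: "ev \<beta> (slot l1 l2 z) \<doteq> 0" if "z \<in> I" "balanced \<beta>" for z l1 l2 \<beta>
    using that(2)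
  proof (induction l1 arbitrary: \<beta>)
    case Nil
    have "slot [] l2 z = lin_ext (\<lambda>u. lcons u (bvec l2)) z" by (simp add: slot_def)
    hence "ev \<beta> (slot [] l2 z) \<doteq> beta_cons (cls z) \<beta> 1 (map wcls l2)"
      using ev_lcons_sum[OF Nil, of "bvec l2" z] by (simp add: ev_bvec)
    also have "\<dots> = \<beta> 1 ([] @ \<zero> # map wcls l2)"
      by (simp add: beta_cons_apply cls_I[OF that(1)])
    also have "\<dots> \<doteq> 0"
    proof -
      have "\<beta> 1 ([] @ (\<zero> \<oplus> \<zero>) # map wcls l2) \<doteq> \<beta> 1 ([] @ \<zero> # map wcls l2) + \<beta> 1 ([] @ \<zero> # map wcls l2)"
        by (rule balanced_slot_add[OF Nil]) auto
      thus ?thesis using N_uminus by (fastforce simp: cong_N_def)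
    qed
    finally show ?case .
  next
    case (Cons u l1)
    have "slot (u # l1) l2 z = lcons u (slot l1 l2 z)"
      by (simp add: slot_def plinear_of_lin_ext)
    hence "ev \<beta> (slot (u # l1) l2 z) \<doteq> ev (beta_cons (wcls u) \<beta>) (slot l1 l2 z)"
      using ev_lcons[OF Cons.prems] by simp
    also have "\<dots> \<doteq> 0" by (rule Cons.IH) (simp add: balanced_cons Cons.prems)
    finally show ?case .
  qed
  have "pm.subspace {w. \<forall>\<beta>. balanced \<beta> \<longrightarrow> ev \<beta> w \<doteq> 0}"
  proof (rule pm.subspaceI; clarify)
    fix \<beta> assume \<beta>: "balanced \<beta>"
    show "ev \<beta> 0 \<doteq> 0" by (simp add: ev_def)
    fix x y assume "\<forall>\<beta>. balanced \<beta> \<longrightarrow> ev \<beta> x \<doteq> 0" "\<forall>\<beta>. balanced \<beta> \<longrightarrow> ev \<beta> y \<doteq> 0"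
    hence "ev \<beta> x + ev \<beta> y \<doteq> 0 + 0" using \<beta> by (intro cong_add) auto
    thus "ev \<beta> (x + y) \<doteq> 0" using cong_trans[OF ev_add[OF \<beta>]] by simp
  next
    fix c x \<beta> assume "\<forall>\<beta>. balanced \<beta> \<longrightarrow> ev \<beta> x \<doteq> 0" and \<beta>: "balanced \<beta>"
    thus "ev \<beta> (pscale c x) \<doteq> 0"
      using cong_trans[OF ev_scale[OF \<beta>]] balanced_scale[OF \<beta>] by blast
  qed
  hence "null \<subseteq> {w. \<forall>\<beta>. balanced \<beta> \<longrightarrow> ev \<beta> w \<doteq> 0}"
    unfolding null_def by (intro pm.span_minimal) (auto intro: slot0)
  thus ?thesis using assms by blast
qed

lemma ev_cong_null: "balanced \<beta> \<Longrightarrow> x - y \<in> null \<Longrightarrow> ev \<beta> x \<doteq> ev \<beta> y"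
  using cong_trans[OF cong_sym[OF ev_diff] ev_null] cong_iff_diff by blast

end

context coefficients
begin

text \<open>The differential that the bar differential induces on coefficient functions.\<close>

fun dual_bar :: "('k \<Rightarrow> 'a list \<Rightarrow> 'g) \<Rightarrow> 'k \<Rightarrow> 'a list \<Rightarrow> 'g"
  where "dual_bar \<beta> c [] = 0"
  | "dual_bar \<beta> c [a] = 0"
  | "dual_bar \<beta> c (a # b # l) = \<beta> c ((a \<otimes> b) # l) - dual_bar (beta_cons a \<beta>) c (b # l)"

lemma dual_bar_cong:
  assumes "\<And>c l'. set l' \<subseteq> carrier A \<Longrightarrow> Suc (length l') = length l \<Longrightarrow> \<beta> c l' \<doteq> \<beta>' c l'" "set l \<subseteq> carrier A"
  shows "dual_bar \<beta> c l \<doteq> dual_bar \<beta>' c l"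
  using assms
proof (induction \<beta> c l arbitrary: \<beta>' rule: dual_bar.induct)
  case (3 \<beta> c a b l)
  have "dual_bar (beta_cons a \<beta>) c (b # l) \<doteq> dual_bar (beta_cons a \<beta>') c (b # l)"
    by (rule 3(1)) (use 3(2,3) in \<open>auto simp: beta_cons_apply\<close>)
  moreover have "\<beta> c ((a \<otimes> b) # l) \<doteq> \<beta>' c ((a \<otimes> b) # l)"
    by (rule 3(2)) (use 3(3) in auto)
  ultimately show ?case by (simp add: cong_diff)
qed auto

lemma dual_bar_add:
  "dual_bar (\<lambda>c l. \<beta> c l + \<beta>' c l) c l = dual_bar \<beta> c l + dual_bar \<beta>' c l"
proof (induction \<beta> c l arbitrary: \<beta>' rule: dual_bar.induct)
  case (3 \<beta> c a b l)
  have "beta_cons a (\<lambda>c l. \<beta> c l + \<beta>' c l) = (\<lambda>c l. beta_cons a \<beta> c l + beta_cons a \<beta>' c l)"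
    by (intro ext) (simp add: beta_cons_apply)
  thus ?case by (simp add: 3)
qed auto

lemma dual_bar_scale: "dual_bar (\<lambda>c' l. \<beta> (c * c') l) c' l = dual_bar \<beta> (c * c') l"
proof (induction \<beta> c' l rule: dual_bar.induct)
  case (3 \<beta> c' a b l)
  have "beta_cons a (\<lambda>c' l. \<beta> (c * c') l) = (\<lambda>c' l. beta_cons a \<beta> (c * c') l)"
    by (intro ext) (simp add: beta_cons_apply)
  thus ?case using 3 by simp
qed auto

lemma balanced_dual_bar:
  assumes "balanced \<beta>" shows "balanced (dual_bar \<beta>)"
  unfolding balanced_def
proof (intro conjI allI impI; (elim conjE)?)
  fix c c' l assume "set l \<subseteq> carrier A"
  with assms show "dual_bar \<beta> (c + c') l \<doteq> dual_bar \<beta> c l + dual_bar \<beta> c' l"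
  proof (induction \<beta> c l rule: dual_bar.induct)
    case (3 \<beta> c a b l)
    have "\<beta> (c + c') ((a \<otimes> b) # l) - dual_bar (beta_cons a \<beta>) (c + c') (b # l)
      \<doteq> (\<beta> c ((a \<otimes> b) # l) + \<beta> c' ((a \<otimes> b) # l))
        - (dual_bar (beta_cons a \<beta>) c (b # l) + dual_bar (beta_cons a \<beta>) c' (b # l))"
      using 3(3) by (intro cong_diff balanced_scalar 3 balanced_cons) auto
    thus ?case by (simp add: algebra_simps)
  qed auto
next
  fix c l1 x y l2
  assume "set l1 \<subseteq> carrier A" "x \<in> carrier A" "y \<in> carrier A" "set l2 \<subseteq> carrier A"
  with assms show "dual_bar \<beta> c (l1 @ (x \<oplus> y) # l2) \<doteq> dual_bar \<beta> c (l1 @ x # l2) + dual_bar \<beta> c (l1 @ y # l2)"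
  proof (induction l1 arbitrary: \<beta>)
    case Nil
    show ?case
    proof (cases l2)
      case (Cons b l)
      have b: "b \<in> carrier A" "set l \<subseteq> carrier A" using Nil Cons by auto
      have "dual_bar (beta_cons (x \<oplus> y) \<beta>) c l2
          \<doteq> dual_bar (\<lambda>c l. beta_cons x \<beta> c l + beta_cons y \<beta> c l) c l2"
      proof (rule dual_bar_cong)
        fix c l' assume "set l' \<subseteq> carrier A"
        thus "beta_cons (x \<oplus> y) \<beta> c l' \<doteq> beta_cons x \<beta> c l' + beta_cons y \<beta> c l'"
          using balanced_slot_add[OF Nil(1), of "[]" x y l' c] Nil by (simp add: beta_cons_apply)
      qed (use Nil in auto)
      hence 1: "dual_bar (beta_cons (x \<oplus> y) \<beta>) c l2
          \<doteq> dual_bar (beta_cons x \<beta>) c l2 + dual_bar (beta_cons y \<beta>) c l2"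
        by (simp add: dual_bar_add)
      have 2: "\<beta> c (((x \<oplus> y) \<otimes> b) # l) \<doteq> \<beta> c ((x \<otimes> b) # l) + \<beta> c ((y \<otimes> b) # l)"
        using balanced_slot_add[OF Nil(1), of "[]" "x \<otimes> b" "y \<otimes> b" l c] Nil b by (simp add: l_distr)
      show ?thesis using cong_diff[OF 2 1] by (simp add: Cons algebra_simps)
    qed simp
  next
    case (Cons u l1)
    have IH: "dual_bar (beta_cons u \<beta>) c (l1 @ (x \<oplus> y) # l2)
        \<doteq> dual_bar (beta_cons u \<beta>) c (l1 @ x # l2) + dual_bar (beta_cons u \<beta>) c (l1 @ y # l2)"
      by (rule Cons.IH) (use Cons.prems in \<open>auto intro: balanced_cons\<close>)
    show ?case
    proof (cases l1)
      case Nil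
      have "\<beta> c ((u \<otimes> (x \<oplus> y)) # l2) \<doteq> \<beta> c ((u \<otimes> x) # l2) + \<beta> c ((u \<otimes> y) # l2)"
        using balanced_slot_add[OF Cons.prems(1), of "[]" "u \<otimes> x" "u \<otimes> y" l2 c] Cons.prems by (simp add: r_distr)
      from cong_diff[OF this IH] show ?thesis by (simp add: Nil algebra_simps)
    next
      case (Cons v l1')
      have "\<beta> c (((u \<otimes> v) # l1') @ (x \<oplus> y) # l2) \<doteq> \<beta> c (((u \<otimes> v) # l1') @ x # l2) + \<beta> c (((u \<otimes> v) # l1') @ y # l2)"
        by (rule balanced_slot_add) (use Cons.prems Cons in auto)
      from cong_diff[OF this IH] show ?thesis by (simp add: Cons algebra_simps)
    qed
  qed
next
  fix c c' l1 x l2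
  assume "set l1 \<subseteq> carrier A" "x \<in> carrier A" "set l2 \<subseteq> carrier A"
  with assms show "dual_bar \<beta> c (l1 @ (c' \<odot> x) # l2) \<doteq> dual_bar \<beta> (c * c') (l1 @ x # l2)"
  proof (induction l1 arbitrary: \<beta>)
    case Nil
    show ?case
    proof (cases l2)
      case (Cons b l)
      have b: "b \<in> carrier A" "set l \<subseteq> carrier A" using Nil Cons by auto
      have "dual_bar (beta_cons (c' \<odot> x) \<beta>) c l2
          \<doteq> dual_bar (\<lambda>c l. beta_cons x \<beta> (c' * c) l) c l2"
      proof (rule dual_bar_cong)
        fix c l' assume "set l' \<subseteq> carrier A"
        thus "beta_cons (c' \<odot> x) \<beta> c l' \<doteq> beta_cons x \<beta> (c' * c) l'"
          using balanced_slot_smult[OF Nil(1), of "[]" x l' c c'] Nil by (simp add: beta_cons_apply mult.commute)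
      qed (use Nil in auto)
      hence 1: "dual_bar (beta_cons (c' \<odot> x) \<beta>) c l2 \<doteq> dual_bar (beta_cons x \<beta>) (c * c') l2"
        by (simp only: dual_bar_scale mult.commute[of c' c])
      have 2: "\<beta> c (((c' \<odot> x) \<otimes> b) # l) \<doteq> \<beta> (c * c') ((x \<otimes> b) # l)"
        using balanced_slot_smult[OF Nil(1), of "[]" "x \<otimes> b" l c c'] Nil b by (simp add: smult_mult_left)
      show ?thesis using cong_diff[OF 2 1] by (simp add: Cons)
    qed simp
  next
    case (Cons u l1)
    have IH: "dual_bar (beta_cons u \<beta>) c (l1 @ (c' \<odot> x) # l2)
        \<doteq> dual_bar (beta_cons u \<beta>) (c * c') (l1 @ x # l2)"
      by (rule Cons.IH) (use Cons.prems in \<open>auto intro: balanced_cons\<close>)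
    show ?case
    proof (cases l1)
      case Nil
      have "\<beta> c ((u \<otimes> (c' \<odot> x)) # l2) \<doteq> \<beta> (c * c') ((u \<otimes> x) # l2)"
        using balanced_slot_smult[OF Cons.prems(1), of "[]" "u \<otimes> x" l2 c c'] Cons.prems by (simp add: smult_mult_right)
      from cong_diff[OF this IH] show ?thesis by (simp add: Nil)
    next
      case (Cons v l1')
      have "\<beta> c (((u \<otimes> v) # l1') @ (c' \<odot> x) # l2) \<doteq> \<beta> (c * c') (((u \<otimes> v) # l1') @ x # l2)"
        by (rule balanced_slot_smult) (use Cons.prems Cons in auto)
      from cong_diff[OF this IH] show ?thesis by (simp add: Cons)
    qed
  qed
qed

text \<open>
  The induced differential is adjoint to the bar differential under evaluation; therefore it
  squares to zero.
\<close>

lemma ev_bar: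
  assumes "balanced \<beta>"
  shows "ev \<beta> (bar Y) \<doteq> ev (dual_bar \<beta>) Y"
proof (rule additive_eq[OF additive_ev_linear[OF assms plinear_bar] additive_ev[OF balanced_dual_bar[OF assms]]])
  fix l c
  have "ev \<beta> (pscale c (bar_list l)) \<doteq> dual_bar \<beta> c (map wcls l)"
    using assms
  proof (induction l arbitrary: \<beta> rule: bar_list.induct)
    case (3 a b l)
    have "ev \<beta> (pscale c (bar_list (a # b # l)))
        = ev \<beta> (pscale c (bvec ((a + b) # l)) - lcons a (pscale c (bar_list (b # l))))"
      by (simp add: pm.scale_right_diff_distrib bar_ops_linear)
    also have "\<dots> \<doteq> ev \<beta> (pscale c (bvec ((a + b) # l))) - ev \<beta> (lcons a (pscale c (bar_list (b # l))))"
      by (rule ev_diff) fact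
    also have "\<dots> \<doteq> \<beta> c (map wcls ((a + b) # l)) - ev (beta_cons (wcls a) \<beta>) (pscale c (bar_list (b # l)))"
      by (intro cong_diff ev_single ev_lcons 3)
    also have "\<dots> \<doteq> \<beta> c (map wcls ((a + b) # l)) - dual_bar (beta_cons (wcls a) \<beta>) c (map wcls (b # l))"
      by (intro cong_diff cong_refl 3(1) balanced_cons 3(2)) simp
    finally show ?case by (simp add: wcls_add)
  qed (simp_all add: ev_def pm.scale_zero_right)
  also have "\<dots> \<doteq> ev (dual_bar \<beta>) (pscale c (bvec l))"
    by (rule cong_sym[OF ev_single[OF balanced_dual_bar[OF assms]]])
  finally show "ev \<beta> (bar (pscale c (bvec l))) \<doteq> ev (dual_bar \<beta>) (pscale c (bvec l))"
    by (simp add: bar_ops_linear)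
qed

lemma map_cls_rep: "set l \<subseteq> carrier A \<Longrightarrow> map cls (map rep l) = l"
  by (induction l) auto

lemma dual_bar_square:
  assumes "balanced \<beta>" "set l \<subseteq> carrier A"
  shows "dual_bar (dual_bar \<beta>) c l \<doteq> 0"
proof -
  define Y where "Y = pscale c (ten (map rep l))"
  have l: "map cls (map rep l) = l" by (rule map_cls_rep[OF assms(2)])
  have "dual_bar (dual_bar \<beta>) c l \<doteq> ev (dual_bar (dual_bar \<beta>)) Y"
    using cong_sym[OF ev_ten_scale[OF balanced_dual_bar[OF balanced_dual_bar[OF assms(1)]], of c "map rep l"]]
    unfolding l Y_def .
  also have "\<dots> \<doteq> ev (dual_bar \<beta>) (bar Y)"
    by (rule cong_sym[OF ev_bar[OF balanced_dual_bar[OF assms(1)]]])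
  also have "\<dots> \<doteq> ev \<beta> (bar (bar Y))"
    by (rule cong_sym[OF ev_bar[OF assms(1)]])
  also have "\<dots> = 0" by (simp add: bar_bar ev_def)
  finally show ?thesis .
qed

text \<open>
  The dual of an endomorphism of the tensor powers. Entries in the algebra are lifted to
  representatives in the monoid algebra; for maps that preserve \<open>null\<close> their choice is immaterial.
\<close>

definition pull :: "(('w list \<Rightarrow>\<^sub>0 'k) \<Rightarrow> ('w list \<Rightarrow>\<^sub>0 'k)) \<Rightarrow> ('k \<Rightarrow> 'a list \<Rightarrow> 'g) \<Rightarrow> 'k \<Rightarrow> 'a list \<Rightarrow> 'g"
  where "pull S \<beta> c l = ev \<beta> (S (pscale c (ten (map rep l))))"

lemma rep_diff_I: "a \<in> carrier A \<Longrightarrow> cls p = a \<Longrightarrow> rep a - p \<in> I"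
  by (simp flip: cls_eq_iff)

lemma pull_rep_change:
  assumes S: "null_map S" and \<beta>: "balanced \<beta>" and l: "list_all2 (\<lambda>a p. a \<in> carrier A \<and> cls p = a) l ps"
  shows "pull S \<beta> c l \<doteq> ev \<beta> (S (pscale c (ten ps)))"
proof -
  have "list_all2 (\<lambda>p q. p - q \<in> I) (map rep l) ps"
    using l by (auto simp: list_all2_map1 elim!: list_all2_mono intro: rep_diff_I)
  hence "pscale c (ten (map rep l) - ten ps) \<in> null" by (intro null_scale ten_cong)
  hence "S (pscale c (ten (map rep l)) - pscale c (ten ps)) \<in> null"
    using null_map_null[OF S] by (simp add: pm.scale_right_diff_distrib)
  thus ?thesis unfolding pull_def
    by (intro ev_cong_null \<beta>) (simp add: pmp.linear_diff[OF null_map_plinear[OF S]])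
qed

lemma list_all2_rep: "set l \<subseteq> carrier A \<Longrightarrow> list_all2 (\<lambda>a p. a \<in> carrier A \<and> cls p = a) l (map rep l)"
  by (induction l) auto

lemma balanced_pull:
  assumes S: "null_map S" and \<beta>: "balanced \<beta>"
  shows "balanced (pull S \<beta>)"
  unfolding balanced_def
proof (intro conjI allI impI; (elim conjE)?)
  note lin = null_map_plinear[OF S]
  fix c c' l assume "set l \<subseteq> carrier A"
  show "pull S \<beta> (c + c') l \<doteq> pull S \<beta> c l + pull S \<beta> c' l"
    unfolding pull_def pm.scale_left_distrib pmp.linear_add[OF lin] by (rule ev_add[OF \<beta>])
next
  note lin = null_map_plinear[OF S]
  fix c l1 x y l2
  assume *: "set l1 \<subseteq> carrier A" "x \<in> carrier A" "y \<in> carrier A" "set l2 \<subseteq> carrier A"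
  have "pull S \<beta> c (l1 @ (x \<oplus> y) # l2)
      \<doteq> ev \<beta> (S (pscale c (ten (map rep l1 @ (rep x + rep y) # map rep l2))))"
    by (intro pull_rep_change S \<beta> list_all2_appendI list_all2_rep list.rel_intros) (use * in \<open>auto simp: cls_add\<close>)
  also have "\<dots> = ev \<beta> (S (pscale c (ten (map rep l1 @ rep x # map rep l2)))
      + S (pscale c (ten (map rep l1 @ rep y # map rep l2))))"
    by (simp add: pmp.linear_add[OF plinear_ten] pm.scale_right_distrib pmp.linear_add[OF lin])
  also have "\<dots> \<doteq> ev \<beta> (S (pscale c (ten (map rep l1 @ rep x # map rep l2))))
      + ev \<beta> (S (pscale c (ten (map rep l1 @ rep y # map rep l2))))"
    by (rule ev_add[OF \<beta>])
  finally show "pull S \<beta> c (l1 @ (x \<oplus> y) # l2) \<doteq> pull S \<beta> c (l1 @ x # l2) + pull S \<beta> c (l1 @ y # l2)"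
    by (simp add: pull_def)
next
  fix c c' l1 x l2
  assume *: "set l1 \<subseteq> carrier A" "x \<in> carrier A" "set l2 \<subseteq> carrier A"
  have "pull S \<beta> c (l1 @ (c' \<odot> x) # l2)
      \<doteq> ev \<beta> (S (pscale c (ten (map rep l1 @ pscale c' (rep x) # map rep l2))))"
    by (intro pull_rep_change S \<beta> list_all2_appendI list_all2_rep list.rel_intros) (use * in \<open>auto simp: cls_scale\<close>)
  thus "pull S \<beta> c (l1 @ (c' \<odot> x) # l2) \<doteq> pull S \<beta> (c * c') (l1 @ x # l2)"
    by (simp add: pull_def pmp.linear_scale[OF plinear_ten])
qed

lemma ev_pull:
  assumes S: "null_map S" and \<beta>: "balanced \<beta>"
  shows "ev \<beta> (S Y) \<doteq> ev (pull S \<beta>) Y"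
proof (rule additive_eq[OF additive_ev_linear[OF \<beta> null_map_plinear[OF S]] additive_ev[OF balanced_pull[OF S \<beta>]]])
  fix l c
  have "list_all2 (\<lambda>a p. a \<in> carrier A \<and> cls p = a) (map wcls l) (map bvec l)"
    by (induction l) auto
  from pull_rep_change[OF S \<beta> this, of c]
  have "pull S \<beta> c (map wcls l) \<doteq> ev \<beta> (S (pscale c (bvec l)))" by (simp add: ten_bvec)
  from cong_trans[OF cong_sym[OF this] cong_sym[OF ev_single[OF balanced_pull[OF S \<beta>]]]]
  show "ev \<beta> (S (pscale c (bvec l))) \<doteq> ev (pull S \<beta>) (pscale c (bvec l))" .
qed

text \<open>
  A homotopy on the bar complex becomes a homotopy on coefficient functions.
\<close>

lemma pull_homotopy:
  assumes S: "null_map S" "null_map S'"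
    and hom: "\<And>w. w \<in> tensors (Suc q) \<Longrightarrow> bar (S' w) + S (bar w) - w \<in> null"
    and \<beta>: "balanced \<beta>" and l: "set l \<subseteq> carrier A" "length l = Suc q"
  shows "pull S' (dual_bar \<beta>) c l + dual_bar (pull S \<beta>) c l \<doteq> \<beta> c l"
proof -
  define Y where "Y = pscale c (ten (map rep l))"
  have clsrep: "map cls (map rep l) = l" by (rule map_cls_rep[OF l(1)])
  have Y: "Y \<in> tensors (Suc q)"
    unfolding Y_def using ten_tensors[of "map rep l"] l(2) by (intro pm.subspace_scale subspace_tensors) simp
  note bal = balanced_pull[OF S(1) \<beta>]
  have "dual_bar (pull S \<beta>) c l \<doteq> ev (dual_bar (pull S \<beta>)) Y"
    using cong_sym[OF ev_ten_scale[OF balanced_dual_bar[OF bal], of c "map rep l"]] unfolding clsrep Y_def .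
  also have "\<dots> \<doteq> ev (pull S \<beta>) (bar Y)" by (rule cong_sym[OF ev_bar[OF bal]])
  also have "\<dots> \<doteq> ev \<beta> (S (bar Y))" by (rule cong_sym[OF ev_pull[OF S(1) \<beta>]])
  finally have 1: "dual_bar (pull S \<beta>) c l \<doteq> ev \<beta> (S (bar Y))" .
  have 2: "pull S' (dual_bar \<beta>) c l \<doteq> ev \<beta> (bar (S' Y))"
    unfolding pull_def Y_def by (rule cong_sym[OF ev_bar[OF \<beta>]])
  have "pull S' (dual_bar \<beta>) c l + dual_bar (pull S \<beta>) c l \<doteq> ev \<beta> (bar (S' Y)) + ev \<beta> (S (bar Y))"
    by (rule cong_add[OF 2 1])
  also have "\<dots> \<doteq> ev \<beta> (bar (S' Y) + S (bar Y))" by (rule cong_sym[OF ev_add[OF \<beta>]])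
  also have "\<dots> \<doteq> ev \<beta> Y" by (rule ev_cong_null[OF \<beta> hom[OF Y]])
  also have "\<dots> \<doteq> \<beta> c l"
    using ev_ten_scale[OF \<beta>, of c "map rep l"] unfolding clsrep Y_def .
  finally show ?thesis .
qed

lemma pull_left:
  assumes S: "null_map S" and \<beta>: "balanced \<beta>" and ab: "a \<in> carrier A" "b \<in> carrier A" "set l \<subseteq> carrier A"
  shows "pull S (beta_left a \<beta>) c (b # l) \<doteq> pull S \<beta> c ((a \<otimes> b) # l)"
proof -
  note lin = null_map_plinear[OF S]
  have "pull S (beta_left a \<beta>) c (b # l) = ev (beta_left (cls (rep a)) \<beta>) (S (pscale c (ten (map rep (b # l)))))"
    using ab by (simp add: pull_def)
  also have "\<dots> \<doteq> ev \<beta> (lin_ext (\<lambda>u. lact_bar u (S (pscale c (ten (map rep (b # l)))))) (rep a))"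
    by (rule cong_sym[OF ev_lact_sum[OF \<beta>]])
  also have "lin_ext (\<lambda>u. lact_bar u (S (pscale c (ten (map rep (b # l)))))) (rep a)
    = S (pscale c (lin_ext (\<lambda>u. lact_bar u (ten (map rep (b # l)))) (rep a)))"
    by (simp only: pmp.linear_scale[OF lin] plinear_of_lin_ext[OF lin] null_map_lact[OF S] bar_ops_linear
        plinear_of_lin_ext[OF pm.linear_scale_self])
  also have "lin_ext (\<lambda>u. lact_bar u (ten (map rep (b # l)))) (rep a) = ten (rep a * rep b # map rep l)"
    by (simp only: list.map lact_ten)
  also have "ev \<beta> (S (pscale c (ten (rep a * rep b # map rep l)))) \<doteq> pull S \<beta> c ((a \<otimes> b) # l)"
    by (intro cong_sym[OF pull_rep_change] S \<beta> list.rel_intros list_all2_rep) (use ab in \<open>auto simp: cls_mult\<close>)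
  finally show ?thesis .
qed

lemma pull_right:
  assumes S: "null_map S" and \<beta>: "balanced \<beta>" and ab: "a \<in> carrier A" "b \<in> carrier A" "set l \<subseteq> carrier A"
  shows "pull S (beta_right a \<beta>) c (l @ [b]) \<doteq> pull S \<beta> c (l @ [b \<otimes> a])"
proof -
  note lin = null_map_plinear[OF S]
  have "pull S (beta_right a \<beta>) c (l @ [b]) = ev (beta_right (cls (rep a)) \<beta>) (S (pscale c (ten (map rep (l @ [b])))))"
    using ab by (simp add: pull_def)
  also have "\<dots> \<doteq> ev \<beta> (lin_ext (\<lambda>u. ract_bar u (S (pscale c (ten (map rep (l @ [b])))))) (rep a))"
    by (rule cong_sym[OF ev_ract_sum[OF \<beta>]])
  also have "lin_ext (\<lambda>u. ract_bar u (S (pscale c (ten (map rep (l @ [b])))))) (rep a)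
    = S (pscale c (lin_ext (\<lambda>u. ract_bar u (ten (map rep (l @ [b])))) (rep a)))"
    by (simp only: pmp.linear_scale[OF lin] plinear_of_lin_ext[OF lin] null_map_ract[OF S] bar_ops_linear
        plinear_of_lin_ext[OF pm.linear_scale_self])
  also have "lin_ext (\<lambda>u. ract_bar u (ten (map rep (l @ [b])))) (rep a) = ten (map rep l @ [rep b * rep a])"
    by (simp only: list.map map_append ract_ten)
  also have "ev \<beta> (S (pscale c (ten (map rep l @ [rep b * rep a])))) \<doteq> pull S \<beta> c (l @ [b \<otimes> a])"
    by (intro cong_sym[OF pull_rep_change] S \<beta> list.rel_intros list_all2_rep list_all2_appendI) (use ab in \<open>auto simp: cls_mult\<close>)
  finally show ?thesis .
qed

lemma pull_cong:
  assumes "\<And>c l. set l \<subseteq> carrier A \<Longrightarrow> \<beta> c l \<doteq> \<beta>' c l"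
  shows "pull S \<beta> c l \<doteq> pull S \<beta>' c l"
  unfolding pull_def by (rule ev_cong') (rule assms)

lemma pull_scale:
  assumes "null_map S" "balanced \<beta>"
  shows "pull S (\<lambda>c' l. \<beta> (c * c') l) c' l \<doteq> pull S \<beta> (c * c') l"
proof -
  have "S (pscale (c * c') (ten (map rep l))) = pscale c (S (pscale c' (ten (map rep l))))"
    by (simp add: pmp.linear_scale[OF null_map_plinear[OF assms(1)]])
  thus ?thesis using cong_sym[OF ev_scale[OF assms(2)]] by (simp add: pull_def)
qed

text \<open>The pull-back is compatible with the outer entries, which form the bimodule structure.\<close>

lemma pull_outer:
  assumes S: "null_map S" and \<beta>: "balanced \<beta>"
    and ab: "a \<in> carrier A" "b \<in> carrier A" "set l \<subseteq> carrier A"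
    and \<beta>': "\<And>c' l. set l \<subseteq> carrier A \<Longrightarrow> beta_left a (beta_right b \<beta>) (c * c') l \<doteq> \<beta>' c' l"
  shows "pull S \<beta> c (a # l @ [b]) \<doteq> pull S \<beta>' 1 (\<one> # l @ [\<one>])"
proof -
  have "pull S \<beta> c (a # l @ [b]) = pull S \<beta> (c * 1) ((a # l) @ [\<one> \<otimes> b])" using ab by simp
  also have "\<dots> \<doteq> pull S (beta_right b \<beta>) (c * 1) ((a # l) @ [\<one>])"
    by (rule cong_sym[OF pull_right[OF S \<beta>]]) (use ab in auto)
  also have "\<dots> = pull S (beta_right b \<beta>) (c * 1) ((a \<otimes> \<one>) # (l @ [\<one>]))" using ab by simp
  also have "\<dots> \<doteq> pull S (beta_left a (beta_right b \<beta>)) (c * 1) (\<one> # (l @ [\<one>]))"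
    by (rule cong_sym[OF pull_left[OF S balanced_right[OF \<beta>]]]) (use ab in auto)
  also have "\<dots> \<doteq> pull S (\<lambda>c' l. beta_left a (beta_right b \<beta>) (c * c') l) 1 (\<one> # (l @ [\<one>]))"
    by (rule cong_sym[OF pull_scale[OF S balanced_left[OF balanced_right[OF \<beta>]]]]) (use ab in auto)
  also have "\<dots> \<doteq> pull S \<beta>' 1 (\<one> # (l @ [\<one>]))"
    by (rule pull_cong) (rule \<beta>')
  finally show ?thesis .
qed

lemma contract_Suc: "contract A (Suc i) (a # l) = a # contract A i l"
  by (simp add: contract_def)

lemma contract_0: "contract A 0 (a # b # l) = (a \<otimes> b) # l"
  by (simp add: contract_def)

lemma dual_bar_contract:
  "dual_bar \<beta> c l = (\<Sum>i<length l - 1. if even i then \<beta> c (contract A i l) else - \<beta> c (contract A i l))"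
proof (induction \<beta> c l rule: dual_bar.induct)
  case (3 \<beta> c a b l)
  have "dual_bar (beta_cons a \<beta>) c (b # l)
    = - (\<Sum>i<length l. if even (Suc i) then \<beta> c (contract A (Suc i) (a # b # l)) else - \<beta> c (contract A (Suc i) (a # b # l)))"
    unfolding 3 by (auto simp: contract_Suc beta_cons_apply sum_negf[symmetric] intro!: sum.cong)
  thus ?case by (simp add: contract_0 sum.lessThan_Suc_shift del: sum.lessThan_Suc)
qed auto

end

section \<open>The presented algebra\<close>

context quadratic_relation
begin

definition T :: "('n, 'k) free_algebra ring"
  where "T = ring_of_type_algebra"

lemma T_simps [simp]:
  "carrier T = UNIV" "p \<otimes>\<^bsub>T\<^esub> q = p * q" "p \<oplus>\<^bsub>T\<^esub> q = p + q" "\<zero>\<^bsub>T\<^esub> = 0" "\<one>\<^bsub>T\<^esub> = 1"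
  by (simp_all add: T_def ring_of_type_algebra_def)

lemma ring_T: "ring T" unfolding T_def by (rule ring_of_type_algebra_is_ring)

lemma I_mult_left_any: "z \<in> I \<Longrightarrow> p * z \<in> I"
  by (rule plinear_into_subspace[OF plinear_mult_right subspace_I]) (rule I_mult_left)

lemma I_mult_right_any: "z \<in> I \<Longrightarrow> z * p \<in> I"
  by (rule plinear_into_subspace[OF plinear_mult_left subspace_I]) (rule I_mult_right)

lemma ideal_I: "ideal I T"
proof (rule idealI[OF ring_T])
  interpret T: ring T by (rule ring_T)
  have "\<exists>y\<in>I. y + x = 0" if "x \<in> I" for x
    using pm.subspace_neg[OF subspace_I that] by (intro bexI[of _ "- x"]) auto
  show "subgroup I (add_monoid T)"
  proof (rule T.add.subgroupI)
    show "I \<noteq> {}" using pm.subspace_0[OF subspace_I] by auto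
    fix a b assume ab: "a \<in> I" "b \<in> I"
    have "\<ominus>\<^bsub>T\<^esub> a = - a" by (rule T.minus_equality) auto
    thus "\<ominus>\<^bsub>T\<^esub> a \<in> I" using pm.subspace_neg[OF subspace_I ab(1)] by simp
    show "a \<oplus>\<^bsub>T\<^esub> b \<in> I" using pm.subspace_add[OF subspace_I ab] by simp
  qed simp
qed (simp_all add: I_mult_left_any I_mult_right_any)

text \<open>
  The ideal generated by the relator in the ring of the presentation is the linear span of its
  multiples by words.
\<close>

lemma genideal_I: "Idl\<^bsub>T\<^esub> {rho} = I"
proof
  interpret T: ring T by (rule ring_T)
  show "Idl\<^bsub>T\<^esub> {rho} \<subseteq> I"
    by (rule T.genideal_minimal[OF ideal_I]) (simp add: rho_in_I)
  interpret J: ideal "Idl\<^bsub>T\<^esub> {rho}" T by (rule T.genideal_ideal) simp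
  have "pm.subspace (Idl\<^bsub>T\<^esub> {rho})"
    using J.zero_closed J.a_closed J.I_l_closed by (intro pm.subspaceI) (auto simp: pscale_eq_mult)
  moreover have "rel u v \<in> Idl\<^bsub>T\<^esub> {rho}" for u v
    using J.I_r_closed[OF J.I_l_closed[OF T.genideal_self'[of rho], of "bvec u"], of "bvec v"]
    by (simp add: rel_def)
  ultimately show "I \<subseteq> Idl\<^bsub>T\<^esub> {rho}" using I_induct by blast
qed

definition cls :: "('n, 'k) free_algebra \<Rightarrow> ('n, 'k) free_algebra set"
  where "cls p = I +>\<^bsub>T\<^esub> p"

lemma cls_def': "cls p = {z + p | z. z \<in> I}"
  by (auto simp: cls_def a_r_coset_def')

lemma relator_eq_rho:
  "(\<Sum>i\<in>UNIV. \<Sum>j\<in>UNIV. free_const (F $ i $ j) * free_gen i * free_gen j) - free_const t = rho"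
  unfolding rho_def free_const_def free_gen_def pscale_eq_mult by (simp add: mult.assoc)

lemma AFt_eq: "AFt F t = \<lparr>carrier = carrier (T Quot I), monoid.mult = monoid.mult (T Quot I),
    one = one (T Quot I), ring.zero = ring.zero (T Quot I), add = add (T Quot I),
    smult = (\<lambda>c u. cls (free_const c) \<otimes>\<^bsub>T Quot I\<^esub> u)\<rparr>"
  unfolding AFt_def presented_algebra_def relator_eq_rho Let_def cls_def genideal_I[symmetric] T_def ..

end

sublocale quadratic_relation \<subseteq> algebra_presentation I "AFt F t" cls
proof (intro algebra_presentation.intro algebra_presentation_axioms.intro)
  show "monoid_algebra_ideal I" by (rule monoid_algebra_ideal_axioms)
  interpret J: ideal I T by (rule ideal_I)
  interpret h: ring_hom_ring T "T Quot I" cls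
    unfolding cls_def[abs_def] by (rule J.rcos_ring_hom_ring)
  show "assoc_algebra (AFt F t)" unfolding AFt_def by (rule assoc_algebra_presented_algebra)
  show "range cls = carrier (AFt F t)"
    by (auto simp: AFt_eq FactRing_def A_RCOSETS_def' cls_def)
  show "cls (p + q) = cls p \<oplus>\<^bsub>AFt F t\<^esub> cls q" for p q
    using h.hom_add[of p q] by (simp add: AFt_eq)
  show "cls (p * q) = cls p \<otimes>\<^bsub>AFt F t\<^esub> cls q" for p q
    using h.hom_mult[of p q] by (simp add: AFt_eq)
  show "cls 1 = \<one>\<^bsub>AFt F t\<^esub>" using h.hom_one by (simp add: AFt_eq)
  show "cls (pscale c p) = c \<odot>\<^bsub>AFt F t\<^esub> cls p" for c p
    using h.hom_mult[of "free_const c" p] by (simp add: AFt_eq pscale_eq_mult free_const_def)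
  show "cls p = cls q \<longleftrightarrow> p - q \<in> I" for p q
  proof
    assume "cls p = cls q"
    moreover have "p \<in> cls p" using pm.subspace_0[OF subspace_I] by (force simp: cls_def')
    ultimately obtain z where "z \<in> I" "p = z + q" by (auto simp: cls_def')
    thus "p - q \<in> I" by simp
  next
    assume pq: "p - q \<in> I"
    have "z + p \<in> cls q" if "z \<in> I" for z
      using pm.subspace_add[OF subspace_I that pq] by (force simp: cls_def' intro: exI[of _ "z + (p - q)"])
    moreover have "z + q \<in> cls p" if "z \<in> I" for z
      using pm.subspace_diff[OF subspace_I that pq] by (force simp: cls_def' intro: exI[of _ "z - (p - q)"])
    ultimately show "cls p = cls q" unfolding cls_def'[of p] cls_def'[of q] by (auto simp: cls_def')
  qed
qed

section \<open>The Hochschild complexes as coefficient functions\<close>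

lemma contract_snoc: "Suc i < length k \<Longrightarrow> contract A i (k @ [e]) = contract A i k @ [e]"
  by (simp add: contract_def nth_append)

lemma contract_last:
  "k \<noteq> [] \<Longrightarrow> contract A (length k - 1) (k @ [e]) = butlast k @ [last k \<otimes>\<^bsub>A\<^esub> e]"
  by (cases k rule: rev_cases) (auto simp: contract_def nth_append)

text \<open>
  The shape of the Hochschild differentials: the two products that involve an outer entry become
  the actions on the coefficients.
\<close>

lemma (in coefficients) dual_bar_outer:
  "dual_bar \<beta> c (b # (d # m) @ [e]) = \<beta> c ((b \<otimes> d) # m @ [e])
    + (\<Sum>i<length m. if even i then - \<beta> c (b # contract A i (d # m) @ [e]) else \<beta> c (b # contract A i (d # m) @ [e]))
    + (if odd (length m) then \<beta> c (b # butlast (d # m) @ [last (d # m) \<otimes> e])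
       else - \<beta> c (b # butlast (d # m) @ [last (d # m) \<otimes> e]))"
proof -
  let ?l = "b # (d # m) @ [e]"
  let ?f = "\<lambda>i. if even i then \<beta> c (contract A i ?l) else - \<beta> c (contract A i ?l)"
  have inner: "contract A (Suc i) ?l = b # contract A i (d # m) @ [e]" if "i < length m" for i
    using that contract_snoc[where i = i and k = "d # m" and e = e and A = A] by (simp add: contract_Suc)
  have lst: "contract A (Suc (length m)) ?l = b # butlast (d # m) @ [last (d # m) \<otimes> e]"
    using contract_last[of "d # m" A e] by (simp add: contract_Suc)
  have "dual_bar \<beta> c ?l = (\<Sum>i<Suc (Suc (length m)). ?f i)"
    by (subst dual_bar_contract) simp
  also have "\<dots> = ?f 0 + (\<Sum>i<length m. ?f (Suc i)) + ?f (Suc (length m))"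
    unfolding sum.lessThan_Suc[of ?f "Suc (length m)"] sum.lessThan_Suc_shift[of ?f "length m"] by simp
  also have "(\<Sum>i<length m. ?f (Suc i)) = (\<Sum>i<length m. if even i then - \<beta> c (b # contract A i (d # m) @ [e]) else \<beta> c (b # contract A i (d # m) @ [e]))"
    by (rule sum.cong) (auto simp: inner[simplified])
  finally show ?thesis unfolding lst by (simp add: contract_0 del: butlast.simps last.simps dual_bar.simps)
qed

locale bimodule_presentation = algebra_presentation I A cls
  for I :: "('w::monoid_add \<Rightarrow>\<^sub>0 'k::field) set" and A :: "('k, 'a) module" (structure) and cls +
  fixes scl :: "'k \<Rightarrow> 'm::ab_group_add \<Rightarrow> 'm" and lact :: "'a \<Rightarrow> 'm \<Rightarrow> 'm" and ract :: "'m \<Rightarrow> 'a \<Rightarrow> 'm"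
  assumes bimodule: "alg_bimodule A scl lact ract"
begin

sublocale M: alg_bimodule A scl lact ract by (rule bimodule)

sublocale S: vector_space scl by (rule M.is_vector_space)

lemma lact_0 [simp]: "a \<in> carrier A \<Longrightarrow> lact a 0 = 0"
  using M.lact_add_right[of a 0 0] by simp

lemma ract_0 [simp]: "a \<in> carrier A \<Longrightarrow> ract 0 a = 0"
  using M.ract_add_left[of a 0 0] by simp

lemma lact_uminus: "a \<in> carrier A \<Longrightarrow> lact a (- x) = - lact a x"
  using M.lact_add_right[of a x "- x"] by (simp add: eq_neg_iff_add_eq_0 add.commute)

lemma ract_uminus: "a \<in> carrier A \<Longrightarrow> ract (- x) a = - ract x a"
  using M.ract_add_left[of a x "- x"] by (simp add: eq_neg_iff_add_eq_0 add.commute)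

lemma lact_sum: "a \<in> carrier A \<Longrightarrow> lact a (sum f S) = (\<Sum>i\<in>S. lact a (f i))"
  by (induction S rule: infinite_finite_induct) (auto simp: M.lact_add_right)

lemma ract_sum: "a \<in> carrier A \<Longrightarrow> ract (sum f S) a = (\<Sum>i\<in>S. ract (f i) a)"
  by (induction S rule: infinite_finite_induct) (auto simp: M.ract_add_left)

abbreviation tuples :: "nat \<Rightarrow> 'a list set"
  where "tuples m \<equiv> alg_tuples A m"

lemma tuples_iff: "l \<in> tuples m \<longleftrightarrow> length l = m \<and> set l \<subseteq> carrier A"
  by (simp add: alg_tuples_def)

lemma contract_tuples: "l \<in> tuples (Suc m) \<Longrightarrow> i < m \<Longrightarrow> contract A i l \<in> tuples m"
  by (auto simp: tuples_iff contract_def dest: in_set_takeD in_set_dropD intro!: m_closed)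

lemma outer_cases:
  assumes "l \<in> tuples (m + 2)"
  obtains a l' b where "l = a # l' @ [b]" "a \<in> carrier A" "b \<in> carrier A" "l' \<in> tuples m"
  using assms by (cases l rule: list_ends_cases) (auto simp: tuples_iff)

lemma slot_cases:
  assumes "length l1 + length l2 = m + 1"
  obtains (first) l2' b where "l1 = []" "l2 = l2' @ [b]" "length l2' = m"
  | (last) d l1' where "l1 = d # l1'" "l2 = []" "length l1' = m"
  | (inner) d l1' l2' b where "l1 = d # l1'" "l2 = l2' @ [b]" "length l1' + length l2' + 1 = m"
proof (cases l1)
  case Nil
  thus ?thesis using assms first by (cases l2 rule: rev_cases) auto
next
  case (Cons d l1')
  thus ?thesis using assms last inner by (cases l2 rule: rev_cases) auto
qed

subsection \<open>Cochains\<close>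

text \<open>
  A cochain as a function on the bar resolution: the outer entries act on its value. It is zero on
  tuples of other lengths, so that it can be evaluated on arbitrary elements.
\<close>

definition cochain_beta :: "nat \<Rightarrow> ('a list \<Rightarrow> 'm) \<Rightarrow> 'k \<Rightarrow> 'a list \<Rightarrow> 'm"
  where "cochain_beta m f c l =
    (if length l = m + 2 then scl c (lact (hd l) (ract (f (butlast (tl l))) (last l))) else 0)"

lemma cochain_beta_outer:
  "length l = m \<Longrightarrow> cochain_beta m f c (a # l @ [b]) = scl c (lact a (ract (f l) b))"
  by (simp add: cochain_beta_def)

lemma cochain_beta_outside: "length l \<noteq> m + 2 \<Longrightarrow> cochain_beta m f c l = 0"
  by (simp add: cochain_beta_def)

sublocale cochain: coefficients I A cls "{0 :: 'm}"
  by unfold_locales auto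

lemma cochain_cong [simp]: "cochain.cong_N x y \<longleftrightarrow> x = y"
  by (simp add: cochain.cong_N_def)

lemma multilinear_add:
  assumes "multilinear_on A scl m f" "l1 @ a # l2 \<in> tuples m" "b \<in> carrier A"
  shows "f (l1 @ (a \<oplus> b) # l2) = f (l1 @ a # l2) + f (l1 @ b # l2)"
  using assms(1)[unfolded multilinear_on_def, rule_format, of "l1 @ a # l2" "length l1" a] assms(2,3)
  by (auto simp: tuples_iff)

lemma multilinear_smult:
  assumes "multilinear_on A scl m f" "l1 @ a # l2 \<in> tuples m"
  shows "f (l1 @ (c \<odot> a) # l2) = scl c (f (l1 @ a # l2))"
  using assms(1)[unfolded multilinear_on_def, rule_format, of "l1 @ a # l2" "length l1" a] assms(2)
  by (auto simp: tuples_iff)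

lemma multilinearI:
  assumes "\<And>l1 a b l2. l1 @ a # l2 \<in> tuples m \<Longrightarrow> b \<in> carrier A \<Longrightarrow> f (l1 @ (a \<oplus> b) # l2) = f (l1 @ a # l2) + f (l1 @ b # l2)"
    and "\<And>l1 c a l2. l1 @ a # l2 \<in> tuples m \<Longrightarrow> f (l1 @ (c \<odot> a) # l2) = scl c (f (l1 @ a # l2))"
  shows "multilinear_on A scl m f"
  unfolding multilinear_on_def
proof (intro ballI allI impI conjI)
  fix l i a assume *: "l \<in> tuples m" "i < m" "a \<in> carrier A"
  have upd: "l[i := x] = take i l @ x # drop (Suc i) l" for x
    using * by (intro upd_conv_take_nth_drop) (simp add: tuples_iff)
  have mem: "take i l @ a # drop (Suc i) l \<in> tuples m"
    using * by (auto simp: tuples_iff dest: in_set_takeD in_set_dropD)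
  show "f (l[i := a \<oplus> b]) = f (l[i := a]) + f (l[i := b])" if "b \<in> carrier A" for b
    unfolding upd by (rule assms(1)[OF mem that])
  show "f (l[i := c \<odot> a]) = scl c (f (l[i := a]))" for c
    unfolding upd by (rule assms(2)[OF mem])
qed

lemma balanced_cochain_beta:
  assumes f: "multilinear_on A scl m f"
  shows "cochain.balanced (cochain_beta m f)"
  unfolding cochain.balanced_def cochain_cong
proof (intro conjI allI impI; (elim conjE)?)
  fix c c' l
  show "cochain_beta m f (c + c') l = cochain_beta m f c l + cochain_beta m f c' l"
    by (simp add: cochain_beta_def S.scale_left_distrib)
next
  fix c l1 a b l2
  assume *: "set l1 \<subseteq> carrier A" "a \<in> carrier A" "b \<in> carrier A" "set l2 \<subseteq> carrier A"
  show "cochain_beta m f c (l1 @ (a \<oplus> b) # l2) = cochain_beta m f c (l1 @ a # l2) + cochain_beta m f c (l1 @ b # l2)"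
  proof (cases "length l1 + length l2 = m + 1")
    case True
    from True show ?thesis
    proof (cases rule: slot_cases)
      case (first l2' e)
      thus ?thesis using * by (simp add: cochain_beta_outer M.lact_add_left S.scale_right_distrib)
    next
      case (last d l1')
      thus ?thesis using * by (simp add: cochain_beta_outer M.ract_add_right M.lact_add_right S.scale_right_distrib)
    next
      case (inner d l1' l2' e)
      have "f (l1' @ (a \<oplus> b) # l2') = f (l1' @ a # l2') + f (l1' @ b # l2')"
        using * inner by (intro multilinear_add[OF f]) (auto simp: tuples_iff)
      thus ?thesis using * inner cochain_beta_outer[of "l1' @ _ # l2'" m f c d e]
        by (simp add: M.ract_add_left M.lact_add_right S.scale_right_distrib)
    qed
  qed (simp add: cochain_beta_outside)
next
  fix c c' l1 a l2
  assume *: "set l1 \<subseteq> carrier A" "a \<in> carrier A" "set l2 \<subseteq> carrier A"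
  show "cochain_beta m f c (l1 @ (c' \<odot> a) # l2) = cochain_beta m f (c * c') (l1 @ a # l2)"
  proof (cases "length l1 + length l2 = m + 1")
    case True
    from True show ?thesis
    proof (cases rule: slot_cases)
      case (first l2' e)
      thus ?thesis using * by (simp add: cochain_beta_outer M.lact_scale_left)
    next
      case (last d l1')
      thus ?thesis using * by (simp add: cochain_beta_outer M.ract_scale_right M.lact_scale_right)
    next
      case (inner d l1' l2' e)
      have "f (l1' @ (c' \<odot> a) # l2') = scl c' (f (l1' @ a # l2'))"
        using * inner by (intro multilinear_smult[OF f]) (auto simp: tuples_iff)
      thus ?thesis using * inner cochain_beta_outer[of "l1' @ _ # l2'" m f _ d e]
        by (simp add: M.ract_scale_left M.lact_scale_right)
    qed
  qed (simp add: cochain_beta_outside)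
qed

lemma scl_sign: "scl ((-1) ^ n) x = (if even n then x else - x)"
  by simp

text \<open>
  Hence cocycles are bimodule maps on the bar resolution that vanish on boundaries.
\<close>

lemma dual_bar_cochain_beta:
  assumes "l \<in> tuples (m + 3)"
  shows "cochain.dual_bar (cochain_beta m f) c l
    = cochain_beta (Suc m) (hochschild_coboundary A scl lact ract m f) c l"
proof -
  have "l \<in> tuples (Suc m + 2)" using assms by (simp add: numeral_3_eq_3)
  then obtain b k e where l: "l = b # k @ [e]" "b \<in> carrier A" "e \<in> carrier A" "k \<in> tuples (Suc m)"
    by (rule outer_cases)
  obtain d q where k: "k = d # q" "d \<in> carrier A" "q \<in> tuples m"
    using l(4) by (cases k) (auto simp: tuples_iff)
  have lst: "last k \<in> carrier A" "butlast k \<in> tuples m"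
    using l(4) last_in_set[of k] in_set_butlastD[of _ k] by (auto simp: tuples_iff k(1) simp del: last.simps butlast.simps)
  have lk: "length k = Suc m" using l(4) by (simp add: tuples_iff)
  have len: "length q = m" "length (butlast k) = m" "\<And>i. i < m \<Longrightarrow> length (contract A i k) = m"
    using k lst contract_tuples[OF l(4)] by (auto simp: tuples_iff)
  let ?s = "\<lambda>x. scl c (lact b (ract x e))"
  have neg: "?s (- x) = - ?s x" for x using l by (simp add: lact_uminus ract_uminus)
  have add: "?s (x + y) = ?s x + ?s y" for x y
    using l by (simp add: M.lact_add_right M.ract_add_left S.scale_right_distrib)
  have sm: "?s (sum g S) = (\<Sum>i\<in>S. ?s (g i))" for g :: "nat \<Rightarrow> 'm" and S
    using l by (simp add: lact_sum ract_sum S.scale_sum_right)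
  have mid: "(\<Sum>i<m. if even i then - cochain_beta m f c (b # contract A i k @ [e]) else cochain_beta m f c (b # contract A i k @ [e]))
    = (\<Sum>i<m. if even i then - ?s (f (contract A i k)) else ?s (f (contract A i k)))"
    by (rule sum.cong) (auto simp: cochain_beta_outer len(3))
  have "cochain.dual_bar (cochain_beta m f) c l
    = ?s (lact d (f q)) + (\<Sum>i<m. if even i then - ?s (f (contract A i k)) else ?s (f (contract A i k)))
      + (if odd m then ?s (ract (f (butlast k)) (last k)) else - ?s (ract (f (butlast k)) (last k)))"
    unfolding l(1) k(1) cochain.dual_bar_outer unfolding k(1)[symmetric] len(1)
    using l k lst by (simp add: mid cochain_beta_outer len M.lact_mult M.ract_mult M.lact_ract del: last.simps butlast.simps)
  also have "\<dots> = ?s (lact d (f q) + (\<Sum>i<m. scl ((-1) ^ Suc i) (f (contract A i k)))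
      + scl ((-1) ^ Suc m) (ract (f (butlast k)) (last k)))"
    unfolding add sm scl_sign by (auto simp: neg intro!: sum.cong)
  also have "\<dots> = cochain_beta (Suc m) (hochschild_coboundary A scl lact ract m f) c l"
    unfolding l(1) cochain_beta_outer[OF lk] hochschild_coboundary_def
    using l(4) by (simp add: k(1) del: last.simps butlast.simps)
  finally show ?thesis .
qed

subsection \<open>Chains\<close>

text \<open>
  A bar element \<open>(a, l, b)\<close> acts on \<open>x\<close> by the chain \<open>(b x a, l)\<close>; for fixed \<open>x\<close> this is a map from
  the bar resolution to chains.
\<close>

definition chain_beta :: "nat \<Rightarrow> 'm \<Rightarrow> 'k \<Rightarrow> 'a list \<Rightarrow> (('m \<times> 'a list) \<Rightarrow>\<^sub>0 int)"
  where "chain_beta m x c l =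
    (if length l = m + 2 then frag_of (scl c (lact (last l) (ract x (hd l))), butlast (tl l)) else 0)"

lemma chain_beta_outer:
  "length l = m \<Longrightarrow> chain_beta m x c (a # l @ [b]) = frag_of (scl c (lact b (ract x a)), l)"
  by (simp add: chain_beta_def)

lemma chain_beta_outside: "length l \<noteq> m + 2 \<Longrightarrow> chain_beta m x c l = 0"
  by (simp add: chain_beta_def)

lemma tensor_null_add: "x \<in> tensor_null A scl m \<Longrightarrow> y \<in> tensor_null A scl m \<Longrightarrow> x + y \<in> tensor_null A scl m"
  using generate.eng unfolding tensor_null_def tensor_free_def by fastforce

lemma tensor_null_zero: "0 \<in> tensor_null A scl m"
  using generate.one[of "tensor_free A m"] unfolding tensor_null_def tensor_free_def by simp

lemma tensor_relators_closed: "z \<in> tensor_relators A scl m \<Longrightarrow> Poly_Mapping.keys z \<subseteq> UNIV \<times> tuples m"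
proof -
  have fo: "Poly_Mapping.keys (frag_of (x, l)) \<subseteq> UNIV \<times> tuples m" if "l \<in> tuples m" for x and l :: "'a list"
    using that by simp
  have df: "Poly_Mapping.keys (u - v) \<subseteq> UNIV \<times> tuples m"
    if "Poly_Mapping.keys u \<subseteq> UNIV \<times> tuples m" "Poly_Mapping.keys v \<subseteq> UNIV \<times> tuples m" for u v
    using that keys_diff[of u v] by blast
  have up: "l[i := a] \<in> tuples m" if "l \<in> tuples m" "a \<in> carrier A" for l i a
    using that by (auto simp: tuples_iff dest!: subsetD[OF set_update_subset_insert])
  assume "z \<in> tensor_relators A scl m"
  thus ?thesis
    unfolding tensor_relators_def Un_iff mem_Collect_eq
    by (elim disjE exE conjE; hypsubst; intro df fo up; simp)
qed

lemma tensor_null_uminus: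
  assumes "x \<in> tensor_null A scl m" shows "- x \<in> tensor_null A scl m"
proof -
  have sg: "subgroup (tensor_null A scl m) (tensor_free A m)"
    unfolding tensor_null_def
    by (rule group.generate_is_subgroup) (use tensor_relators_closed in \<open>auto simp: tensor_free_def\<close>)
  have "x \<in> carrier (tensor_free A m)" using subgroup.subset[OF sg] assms by auto
  thus ?thesis using subgroup.m_inv_closed[OF sg assms] by (simp add: tensor_free_def)
qed

sublocale chain: coefficients I A cls "tensor_null A scl m" for m
  by unfold_locales (auto intro: tensor_null_zero tensor_null_add tensor_null_uminus)

lemma relator_add:
  "l \<in> tuples m \<Longrightarrow> chain.cong_N m (frag_of (x + y, l)) (frag_of (x, l) + frag_of (y, l))"
  unfolding chain.cong_N_def unfolding tensor_null_def
  by (rule generate.incl) (auto simp: tensor_relators_def algebra_simps)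

lemma relator_slot_add:
  assumes "l1 @ a # l2 \<in> tuples m" "b \<in> carrier A"
  shows "chain.cong_N m (frag_of (x, l1 @ (a \<oplus> b) # l2)) (frag_of (x, l1 @ a # l2) + frag_of (x, l1 @ b # l2))"
proof -
  have "\<exists>x' as i a' b'. frag_of (x, l1 @ (a \<oplus> b) # l2) - (frag_of (x, l1 @ a # l2) + frag_of (x, l1 @ b # l2))
     = frag_of (x', as[i := a' \<oplus> b']) - frag_of (x', as[i := a']) - frag_of (x', as[i := b'])
     \<and> as \<in> tuples m \<and> i < m \<and> a' \<in> carrier A \<and> b' \<in> carrier A"
    using assms by (intro exI[of _ x] exI[of _ "l1 @ a # l2"] exI[of _ "length l1"] exI[of _ a] exI[of _ b])
      (auto simp: tuples_iff)
  thus ?thesis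
    unfolding chain.cong_N_def unfolding tensor_null_def
    by (intro generate.incl) (unfold tensor_relators_def, blast)
qed

lemma relator_smult:
  assumes "l1 @ a # l2 \<in> tuples m"
  shows "chain.cong_N m (frag_of (scl c x, l1 @ a # l2)) (frag_of (x, l1 @ (c \<odot> a) # l2))"
proof -
  have "\<exists>c' x' as i a'. frag_of (scl c x, l1 @ a # l2) - frag_of (x, l1 @ (c \<odot> a) # l2)
     = frag_of (scl c' x', as[i := a']) - frag_of (x', as[i := c' \<odot> a'])
     \<and> as \<in> tuples m \<and> i < m \<and> a' \<in> carrier A"
    using assms by (intro exI[of _ c] exI[of _ x] exI[of _ "l1 @ a # l2"] exI[of _ "length l1"] exI[of _ a])
      (auto simp: tuples_iff)
  thus ?thesis
    unfolding chain.cong_N_def unfolding tensor_null_def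
    by (intro generate.incl) (unfold tensor_relators_def, blast)
qed

lemma balanced_chain_beta: "chain.balanced m (chain_beta m x)"
  unfolding chain.balanced_def
proof (intro conjI allI impI; (elim conjE)?)
  fix c c' l assume l: "set l \<subseteq> carrier A"
  show "chain.cong_N m (chain_beta m x (c + c') l) (chain_beta m x c l + chain_beta m x c' l)"
  proof (cases "length l = m + 2")
    case True
    hence "l \<in> tuples (m + 2)" using l by (simp add: tuples_iff)
    then obtain a k b where "l = a # k @ [b]" "k \<in> tuples m" by (rule outer_cases)
    thus ?thesis by (simp add: chain_beta_outer tuples_iff S.scale_left_distrib relator_add)
  qed (simp add: chain_beta_outside)
next
  fix c l1 a b l2
  assume *: "set l1 \<subseteq> carrier A" "a \<in> carrier A" "b \<in> carrier A" "set l2 \<subseteq> carrier A"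
  show "chain.cong_N m (chain_beta m x c (l1 @ (a \<oplus> b) # l2)) (chain_beta m x c (l1 @ a # l2) + chain_beta m x c (l1 @ b # l2))"
  proof (cases "length l1 + length l2 = m + 1")
    case True
    from True show ?thesis
    proof (cases rule: slot_cases)
      case (first l2' e)
      thus ?thesis using *
        by (simp add: chain_beta_outer M.ract_add_right M.lact_add_right S.scale_right_distrib relator_add tuples_iff)
    next
      case (last d l1')
      thus ?thesis using *
        by (simp add: chain_beta_outer M.lact_add_left S.scale_right_distrib relator_add tuples_iff)
    next
      case (inner d l1' l2' e)
      have mem: "l1' @ a # l2' \<in> tuples m" using * inner by (auto simp: tuples_iff)
      thus ?thesis using * inner chain_beta_outer[of "l1' @ _ # l2'" m x c d e] relator_slot_add[OF mem]
        by simp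
    qed
  qed (simp add: chain_beta_outside)
next
  fix c c' l1 a l2
  assume *: "set l1 \<subseteq> carrier A" "a \<in> carrier A" "set l2 \<subseteq> carrier A"
  show "chain.cong_N m (chain_beta m x c (l1 @ (c' \<odot> a) # l2)) (chain_beta m x (c * c') (l1 @ a # l2))"
  proof (cases "length l1 + length l2 = m + 1")
    case True
    from True show ?thesis
    proof (cases rule: slot_cases)
      case (first l2' e)
      thus ?thesis using * by (simp add: chain_beta_outer M.ract_scale_right M.lact_scale_right)
    next
      case (last d l1')
      thus ?thesis using * by (simp add: chain_beta_outer M.lact_scale_left)
    next
      case (inner d l1' l2' e)
      have mem: "l1' @ a # l2' \<in> tuples m" using * inner by (auto simp: tuples_iff)
      have "chain.cong_N m (frag_of (scl c (lact e (ract x d)), l1' @ (c' \<odot> a) # l2'))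
          (frag_of (scl c' (scl c (lact e (ract x d))), l1' @ a # l2'))"
        by (rule chain.cong_sym[OF relator_smult[OF mem]])
      thus ?thesis using * inner chain_beta_outer[of "l1' @ _ # l2'" m x _ d e]
        by (simp add: mult.commute)
    qed
  qed (simp add: chain_beta_outside)
qed

abbreviation bd :: "(('m \<times> 'a list) \<Rightarrow>\<^sub>0 int) \<Rightarrow> (('m \<times> 'a list) \<Rightarrow>\<^sub>0 int)"
  where "bd \<equiv> frag_extend (hochschild_boundary_gen A lact ract)"

lemma bd_chain_beta:
  assumes "l \<in> tuples (m + 3)"
  shows "bd (chain_beta (Suc m) x c l) = chain.dual_bar (chain_beta m x) c l"
proof -
  have "l \<in> tuples (Suc m + 2)" using assms by (simp add: numeral_3_eq_3)
  then obtain b k e where l: "l = b # k @ [e]" "b \<in> carrier A" "e \<in> carrier A" "k \<in> tuples (Suc m)"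
    by (rule outer_cases)
  obtain d q where k: "k = d # q" "d \<in> carrier A" "q \<in> tuples m"
    using l(4) by (cases k) (auto simp: tuples_iff)
  have lst: "last k \<in> carrier A" "butlast k \<in> tuples m"
    using l(4) last_in_set[of k] in_set_butlastD[of _ k] by (auto simp: tuples_iff k(1) simp del: last.simps butlast.simps)
  have lk: "length k = Suc m" using l(4) by (simp add: tuples_iff)
  have len: "length q = m" "length (butlast k) = m" "\<And>i. i < m \<Longrightarrow> length (contract A i k) = m"
    using k lst contract_tuples[OF l(4)] by (auto simp: tuples_iff)
  let ?y = "scl c (lact e (ract x b))"
  have sg: "frag_cmul ((-1) ^ n) z = (if even n then z else - z)" for n and z :: "('m \<times> 'a list) \<Rightarrow>\<^sub>0 int"
    by simp
  have mid: "(\<Sum>i<m. if even i then - chain_beta m x c (b # contract A i k @ [e]) else chain_beta m x c (b # contract A i k @ [e]))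
    = (\<Sum>i<m. if even i then - frag_of (?y, contract A i k) else frag_of (?y, contract A i k))"
    by (rule sum.cong) (auto simp: chain_beta_outer len(3))
  have "chain.dual_bar (chain_beta m x) c l
    = frag_of (scl c (lact e (ract x (b \<otimes> d))), q)
      + (\<Sum>i<m. if even i then - frag_of (?y, contract A i k) else frag_of (?y, contract A i k))
      + (if odd m then frag_of (scl c (lact (last k \<otimes> e) (ract x b)), butlast k)
         else - frag_of (scl c (lact (last k \<otimes> e) (ract x b)), butlast k))"
    unfolding l(1) k(1) chain.dual_bar_outer unfolding k(1)[symmetric] len(1)
    using l k lst by (simp add: mid chain_beta_outer len del: last.simps butlast.simps)
  also have "\<dots> = frag_of (ract ?y d, q)
      + (\<Sum>i<length q. frag_cmul ((-1) ^ Suc i) (frag_of (?y, contract A i (d # q))))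
      + frag_cmul ((-1) ^ length (d # q)) (frag_of (lact (last (d # q)) ?y, butlast (d # q)))"
    unfolding sg k(1)[symmetric] using l k lst
    by (auto simp: len M.ract_mult M.lact_mult M.lact_ract M.ract_scale_left M.lact_scale_right
        simp del: last.simps butlast.simps intro!: sum.cong)
  also have "\<dots> = bd (chain_beta (Suc m) x c l)"
    unfolding l(1) chain_beta_outer[OF lk] frag_extend_of unfolding k(1) hochschild_boundary_gen.simps(2) ..
  finally show ?thesis by simp
qed

end

section \<open>Vanishing of Hochschild homology and cohomology\<close>

lemma trivial_self_quotient:
  assumes "group G" "subgroup Z G"
  shows "trivial_group (subgroup_generated G Z Mod Z)"
proof -
  interpret G: group G by fact
  let ?H = "subgroup_generated G Z"
  have car: "carrier ?H = Z" by (rule subgroup.carrier_subgroup_generated_subgroup[OF assms(2)])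
  have grp: "group ?H" by (rule G.group_subgroup_generated)
  interpret H: group ?H by (rule grp)
  have nor: "Z \<lhd> ?H" using H.subgroup_self by (intro H.normalI) (auto simp: car H.coset_join2 H.coset_join3)
  have "carrier (?H Mod Z) = {Z}"
    using H.coset_join2[OF _ H.subgroup_self] H.one_closed by (auto simp: FactGroup_def RCOSETS_def car)
  thus ?thesis
    using normal.factorgroup_is_group[OF nor] by (simp add: trivial_group_def FactGroup_def)
qed

lemma (in coefficients) dual_bar_zero: "dual_bar (\<lambda>_ _. 0) c l = 0"
  by (simp add: dual_bar_contract cong: if_cong)

lemma (in coefficients) dual_bar_hom:
  assumes "\<And>x y. \<phi> (x + y) = \<phi> x + (\<phi> y :: 'g)"
  shows "\<phi> (dual_bar \<beta> c l) = dual_bar (\<lambda>c l. \<phi> (\<beta> c l)) c l"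
proof -
  have z: "\<phi> 0 = 0" using assms[of 0 0] by simp
  have n: "\<phi> (- x) = - \<phi> x" for x using assms[of x "- x"] z by (simp add: eq_neg_iff_add_eq_0 add.commute)
  have s: "\<phi> (sum f S) = (\<Sum>i\<in>S. \<phi> (f i))" for f :: "nat \<Rightarrow> 'g" and S
    by (induction S rule: infinite_finite_induct) (auto simp: z assms)
  show ?thesis unfolding dual_bar_contract s by (auto simp: n intro!: sum.cong)
qed

lemma (in coefficients) pull_hom:
  assumes "\<And>x y. \<phi> (x + y) = \<phi> x + (\<phi> y :: 'g)"
  shows "\<phi> (pull S \<beta> c l) = pull S (\<lambda>c l. \<phi> (\<beta> c l)) c l"
proof -
  have z: "\<phi> 0 = 0" using assms[of 0 0] by simp
  have s: "\<phi> (sum f S) = (\<Sum>i\<in>S. \<phi> (f i))" for f :: "'w list \<Rightarrow> 'g" and S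
    by (induction S rule: infinite_finite_induct) (auto simp: z assms)
  show ?thesis unfolding pull_def ev_def s ..
qed

lemma (in coefficients) dual_bar_outside:
  assumes "\<And>c l'. Suc (length l') = length l \<Longrightarrow> \<beta> c l' = 0" "set l \<subseteq> carrier A"
  shows "dual_bar \<beta> c l \<doteq> 0"
  using dual_bar_cong[of l \<beta> "\<lambda>_ _. 0" c] assms by (simp add: dual_bar_zero)

context bimodule_presentation
begin

lemma unit_outer: "k \<in> tuples m \<Longrightarrow> \<one> # k @ [\<one>] \<in> tuples (m + 2)"
  by (auto simp: tuples_iff)

subsection \<open>Cohomology\<close>

abbreviation cb :: "nat \<Rightarrow> ('a list \<Rightarrow> 'm) \<Rightarrow> 'a list \<Rightarrow> 'm"
  where "cb \<equiv> hochschild_coboundary A scl lact ract"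

abbreviation cochains :: "nat \<Rightarrow> ('a list \<Rightarrow> 'm) monoid"
  where "cochains \<equiv> hochschild_cochains A scl"

lemma cochains_iff:
  "f \<in> carrier (cochains m) \<longleftrightarrow> multilinear_on A scl m f \<and> (\<forall>l. l \<notin> tuples m \<longrightarrow> f l = 0)"
  by (simp add: hochschild_cochains_def)

lemma cochain_beta_units: "k \<in> tuples m \<Longrightarrow> cochain_beta m f c (\<one> # k @ [\<one>]) = scl c (f k)"
  by (simp add: cochain_beta_outer tuples_iff M.lact_one M.ract_one)

lemma cb_eq_dual_bar:
  assumes "k \<in> tuples (Suc m)"
  shows "scl c (cb m f k) = cochain.dual_bar (cochain_beta m f) c (\<one> # k @ [\<one>])"
  using dual_bar_cochain_beta[of "\<one> # k @ [\<one>]" m f c] unit_outer[OF assms] cochain_beta_units[OF assms]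
  by (simp add: numeral_3_eq_3)

lemma cb_multilinear:
  assumes "multilinear_on A scl m f"
  shows "multilinear_on A scl (Suc m) (cb m f)"
proof (rule multilinearI)
  note bal = cochain.balanced_dual_bar[OF balanced_cochain_beta[OF assms]]
  fix l1 a l2 assume mem: "l1 @ a # l2 \<in> tuples (Suc m)"
  hence *: "set (\<one> # l1) \<subseteq> carrier A" "a \<in> carrier A" "set (l2 @ [\<one>]) \<subseteq> carrier A" by (auto simp: tuples_iff)
  show "cb m f (l1 @ (a \<oplus> b) # l2) = cb m f (l1 @ a # l2) + cb m f (l1 @ b # l2)" if b: "b \<in> carrier A" for b
  proof -
    have mem': "l1 @ b # l2 \<in> tuples (Suc m)" "l1 @ (a \<oplus> b) # l2 \<in> tuples (Suc m)"
      using mem b by (auto simp: tuples_iff)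
    show ?thesis
      using cochain.balanced_slot_add[OF bal *(1,2) b *(3), of 1] cb_eq_dual_bar[OF mem, of 1 f]
        cb_eq_dual_bar[OF mem'(1), of 1 f] cb_eq_dual_bar[OF mem'(2), of 1 f] by simp
  qed
  show "cb m f (l1 @ (c \<odot> a) # l2) = scl c (cb m f (l1 @ a # l2))" for c
  proof -
    have mem': "l1 @ (c \<odot> a) # l2 \<in> tuples (Suc m)" using mem by (auto simp: tuples_iff)
    show ?thesis
      using cochain.balanced_slot_smult[OF bal *, of 1 c] cb_eq_dual_bar[OF mem, of c f]
        cb_eq_dual_bar[OF mem', of 1 f] by simp
  qed
qed

lemma cb_closed: "f \<in> carrier (cochains m) \<Longrightarrow> cb m f \<in> carrier (cochains (Suc m))"
  using cb_multilinear by (auto simp: cochains_iff hochschild_coboundary_def)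

lemma cb_cb:
  assumes "f \<in> carrier (cochains m)"
  shows "cb (Suc m) (cb m f) = (\<lambda>_. 0)"
proof
  fix k
  show "cb (Suc m) (cb m f) k = 0"
  proof (cases "k \<in> tuples (Suc (Suc m))")
    case True
    let ?l = "\<one> # k @ [\<one>]"
    have bal: "cochain.balanced (cochain_beta m f)"
      using assms by (intro balanced_cochain_beta) (simp add: cochains_iff)
    have l: "set ?l \<subseteq> carrier A" "length ?l = m + 4" using True by (auto simp: tuples_iff)
    have "cb (Suc m) (cb m f) k = cochain.dual_bar (cochain_beta (Suc m) (cb m f)) 1 ?l"
      using cb_eq_dual_bar[OF True, of 1 "cb m f"] by simp
    also have "\<dots> = cochain.dual_bar (cochain.dual_bar (cochain_beta m f)) 1 ?l"
    proof (rule cochain.dual_bar_cong[unfolded cochain_cong, OF _ l(1)])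
      fix c l' assume "set l' \<subseteq> carrier A" "Suc (length l') = length ?l"
      hence "l' \<in> tuples (m + 3)" using l by (simp add: tuples_iff)
      thus "cochain_beta (Suc m) (cb m f) c l' = cochain.dual_bar (cochain_beta m f) c l'"
        by (simp add: dual_bar_cochain_beta)
    qed
    also have "\<dots> = 0" using cochain.dual_bar_square[OF bal l(1)] by simp
    finally show ?thesis .
  qed (simp add: hochschild_coboundary_def)
qed

text \<open>
  A cocycle \<open>f\<close> is the coboundary of its composite with the contraction \<open>S\<close>. The homotopy
  expresses \<open>f\<close> as the differential of that composite plus a term that factors through the
  coboundary of \<open>f\<close>.
\<close>

lemma cochain_exact:
  assumes S: "null_map S" "null_map S'"
    and hom: "\<And>w. w \<in> tensors (Suc (Suc (Suc m))) \<Longrightarrow> bar (S' w) + S (bar w) - w \<in> null"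
    and f: "f \<in> carrier (cochains (Suc m))" and cocycle: "cb (Suc m) f = (\<lambda>_. 0)"
  shows "\<exists>g\<in>carrier (cochains m). f = cb m g"
proof -
  define \<beta> where "\<beta> = cochain_beta (Suc m) f"
  have bal: "cochain.balanced \<beta>"
    unfolding \<beta>_def using f by (intro balanced_cochain_beta) (simp add: cochains_iff)
  note balp = cochain.balanced_pull[OF S(1) bal]
  define g where "g k = (if k \<in> tuples m then cochain.pull S \<beta> 1 (\<one> # k @ [\<one>]) else 0)" for k
  have outer: "cochain.pull S \<beta> c l = cochain_beta m g c l" if l: "l \<in> tuples (m + 2)" for c l
  proof -
    obtain a k b where ab: "l = a # k @ [b]" "a \<in> carrier A" "b \<in> carrier A" "k \<in> tuples m"
      using l by (rule outer_cases)
    have k: "set k \<subseteq> carrier A" using ab(4) by (simp add: tuples_iff)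
    have "cochain.pull S \<beta> c (a # k @ [b])
        = cochain.pull S (\<lambda>c' l. scl c (lact a (ract (\<beta> c' l) b))) 1 (\<one> # k @ [\<one>])"
    proof (rule cochain.pull_outer[unfolded cochain_cong, OF S(1) bal ab(2,3) k])
      fix c' l assume l: "set l \<subseteq> carrier A"
      show "cochain.beta_left a (cochain.beta_right b \<beta>) (c * c') l = scl c (lact a (ract (\<beta> c' l) b))"
      proof (cases "length l = Suc m + 2")
        case True
        hence "l \<in> tuples (Suc m + 2)" using l by (simp add: tuples_iff)
        then obtain d k e where l: "l = d # k @ [e]" "d \<in> carrier A" "e \<in> carrier A" "k \<in> tuples (Suc m)"
          by (rule outer_cases)
        have "cochain.beta_left a (cochain.beta_right b \<beta>) (c * c') l = \<beta> (c * c') ((a \<otimes> d) # k @ [e \<otimes> b])"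
          using cochain.beta_right_snoc[of b \<beta> "c * c'" "(a \<otimes> d) # k" e] by (simp add: l(1))
        thus ?thesis using l ab
          by (simp add: \<beta>_def cochain_beta_outer tuples_iff M.lact_mult M.ract_mult M.lact_ract
              M.lact_scale_right M.ract_scale_left)
      next
        case False
        hence "\<beta> c' l = 0" by (simp add: \<beta>_def cochain_beta_outside)
        moreover have "cochain.beta_left a (cochain.beta_right b \<beta>) (c * c') l = 0"
          using False unfolding \<beta>_def cochain.beta_left_apply cochain.beta_right_apply
          by (cases l) (auto intro!: cochain_beta_outside)
        ultimately show ?thesis using ab by simp
      qed
    qed
    also have "\<dots> = scl c (lact a (ract (cochain.pull S \<beta> 1 (\<one> # k @ [\<one>])) b))"
      using ab cochain.pull_hom[of "\<lambda>x. scl c (lact a (ract x b))" S \<beta> 1 "\<one> # k @ [\<one>]"]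
      by (simp add: M.ract_add_left M.lact_add_right S.scale_right_distrib)
    also have "\<dots> = cochain_beta m g c l"
      using ab by (simp add: cochain_beta_outer tuples_iff g_def)
    finally show ?thesis by (simp add: ab)
  qed
  have pull_units: "cochain.pull S \<beta> c (\<one> # k @ [\<one>]) = scl c (g k)" if "k \<in> tuples m" for c k
    using outer[OF unit_outer[OF that]] cochain_beta_units[OF that] by simp
  have "multilinear_on A scl m g"
  proof (rule multilinearI)
    fix l1 a l2 assume mem: "l1 @ a # l2 \<in> tuples m"
    hence *: "set (\<one> # l1) \<subseteq> carrier A" "a \<in> carrier A" "set (l2 @ [\<one>]) \<subseteq> carrier A" by (auto simp: tuples_iff)
    show "g (l1 @ (a \<oplus> b) # l2) = g (l1 @ a # l2) + g (l1 @ b # l2)" if b: "b \<in> carrier A" for b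
    proof -
      have mem': "l1 @ b # l2 \<in> tuples m" "l1 @ (a \<oplus> b) # l2 \<in> tuples m"
        using mem b by (auto simp: tuples_iff)
      show ?thesis
        using cochain.balanced_slot_add[OF balp *(1,2) b *(3), of 1] pull_units[OF mem, of 1]
          pull_units[OF mem'(1), of 1] pull_units[OF mem'(2), of 1] by simp
    qed
    show "g (l1 @ (c \<odot> a) # l2) = scl c (g (l1 @ a # l2))" for c
    proof -
      have mem': "l1 @ (c \<odot> a) # l2 \<in> tuples m" using mem by (auto simp: tuples_iff)
      show ?thesis
        using cochain.balanced_slot_smult[OF balp *, of 1 c] pull_units[OF mem, of c]
          pull_units[OF mem', of 1] by simp
    qed
  qed
  hence g: "g \<in> carrier (cochains m)" by (simp add: cochains_iff g_def)
  have "f k = cb m g k" for k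
  proof (cases "k \<in> tuples (Suc m)")
    case True
    let ?l = "\<one> # k @ [\<one>]"
    have l: "set ?l \<subseteq> carrier A" "length ?l = Suc (Suc (Suc m))" using True by (auto simp: tuples_iff)
    have zero: "cochain.dual_bar \<beta> c l' = 0" if "set l' \<subseteq> carrier A" for c l'
    proof (cases "length l' = Suc m + 3")
      case True
      hence "l' \<in> tuples (Suc m + 3)" using that by (simp add: tuples_iff)
      hence "cochain.dual_bar \<beta> c l' = cochain_beta (Suc (Suc m)) (\<lambda>_. 0) c l'"
        by (simp only: \<beta>_def dual_bar_cochain_beta cocycle)
      moreover have "l' \<in> tuples (Suc (Suc m) + 2)" using True that by (simp add: tuples_iff)
      then obtain a k b where "l' = a # k @ [b]" "a \<in> carrier A" "b \<in> carrier A" "k \<in> tuples (Suc (Suc m))"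
        by (rule outer_cases)
      ultimately show ?thesis by (simp add: cochain_beta_outer tuples_iff)
    next
      case False
      thus ?thesis using that cochain.dual_bar_outside[of l' \<beta> c]
        by (simp add: \<beta>_def cochain_beta_outside)
    qed
    have "cochain.pull S' (cochain.dual_bar \<beta>) 1 ?l = cochain.pull S' (\<lambda>_ _. 0) 1 ?l"
      by (rule cochain.pull_cong[unfolded cochain_cong]) (rule zero)
    also have "\<dots> = 0" by (simp add: cochain.pull_def cochain.ev_def)
    finally have "f k = cochain.dual_bar (cochain.pull S \<beta>) 1 ?l"
      using cochain.pull_homotopy[OF S hom bal l, of 1] cochain_beta_units[OF True, of f 1] by (simp add: \<beta>_def)
    also have "\<dots> = cochain.dual_bar (cochain_beta m g) 1 ?l"
      by (rule cochain.dual_bar_cong[unfolded cochain_cong, OF _ l(1)]) (use l(2) in \<open>auto intro!: outer simp: tuples_iff\<close>)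
    also have "\<dots> = cb m g k" using cb_eq_dual_bar[OF True, of 1 g] by simp
    finally show ?thesis .
  next
    case False
    thus ?thesis using f by (simp add: cochains_iff hochschild_coboundary_def)
  qed
  thus ?thesis using g by blast
qed

lemma group_cochains: "group (cochains m)"
proof (rule groupI)
  fix f g assume fg: "f \<in> carrier (cochains m)" "g \<in> carrier (cochains m)"
  show "f \<otimes>\<^bsub>cochains m\<^esub> g \<in> carrier (cochains m)"
    using fg by (auto simp: hochschild_cochains_def multilinear_on_def S.scale_right_distrib)
next
  show "\<one>\<^bsub>cochains m\<^esub> \<in> carrier (cochains m)"
    by (auto simp: hochschild_cochains_def multilinear_on_def)
next
  fix f assume f: "f \<in> carrier (cochains m)"
  show "\<exists>g\<in>carrier (cochains m). g \<otimes>\<^bsub>cochains m\<^esub> f = \<one>\<^bsub>cochains m\<^esub>"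
    using f by (intro bexI[of _ "\<lambda>l. - f l"]) (auto simp: hochschild_cochains_def multilinear_on_def)
qed (auto simp: hochschild_cochains_def add.assoc)

lemma cb_hom: "cb m \<in> hom (cochains m) (cochains (Suc m))"
proof (rule homI)
  fix f g assume "f \<in> carrier (cochains m)" "g \<in> carrier (cochains m)"
  show "cb m (f \<otimes>\<^bsub>cochains m\<^esub> g) = cb m f \<otimes>\<^bsub>cochains (Suc m)\<^esub> cb m g"
  proof
    fix l
    show "cb m (f \<otimes>\<^bsub>cochains m\<^esub> g) l = (cb m f \<otimes>\<^bsub>cochains (Suc m)\<^esub> cb m g) l"
    proof (cases "l \<in> tuples (Suc m)")
      case True
      hence "l \<noteq> []" "set l \<subseteq> carrier A" by (auto simp: tuples_iff)
      hence "hd l \<in> carrier A" "last l \<in> carrier A" by auto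
      thus ?thesis
        by (simp add: hochschild_coboundary_def hochschild_cochains_def M.lact_add_right M.ract_add_left
            S.scale_right_distrib sum.distrib sum_negf sum_subtractf)
    qed (simp add: hochschild_coboundary_def hochschild_cochains_def)
  qed
qed (rule cb_closed)

theorem cohomology_trivial:
  assumes S: "null_map S" "null_map S'"
    and hom: "\<And>w. w \<in> tensors (Suc (Suc m)) \<Longrightarrow> bar (S' w) + S (bar w) - w \<in> null" and m: "m > 0"
  shows "trivial_group (hochschild_cohomology A scl lact ract m)"
proof -
  obtain p where p: "m = Suc p" using m by (cases m) auto
  let ?Z = "kernel (cochains m) (cochains (Suc m)) (cb m)"
  interpret h: group_hom "cochains m" "cochains (Suc m)" "cb m"
    by (intro group_hom.intro group_hom_axioms.intro group_cochains cb_hom)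
  have one: "\<one>\<^bsub>cochains r\<^esub> = (\<lambda>_. 0)" for r by (simp add: hochschild_cochains_def)
  have "hochschild_coboundaries A scl lact ract m = ?Z"
  proof -
    have "cb p f \<in> ?Z" if "f \<in> carrier (cochains p)" for f
      using that cb_closed[OF that] cb_cb[OF that] by (simp add: kernel_def one p)
    moreover have "f \<in> cb p ` carrier (cochains p)" if "f \<in> ?Z" for f
      using cochain_exact[OF S hom[unfolded p]] that by (auto simp: kernel_def one p)
    ultimately show ?thesis by (auto simp: hochschild_coboundaries_def p)
  qed
  thus ?thesis
    unfolding hochschild_cohomology_def
    using trivial_self_quotient[OF group_cochains h.subgroup_kernel] by simp
qed

subsection \<open>Homology\<close>

abbreviation free :: "nat \<Rightarrow> (('m \<times> 'a list) \<Rightarrow>\<^sub>0 int) monoid"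
  where "free \<equiv> tensor_free A"

abbreviation tnull :: "nat \<Rightarrow> (('m \<times> 'a list) \<Rightarrow>\<^sub>0 int) set"
  where "tnull \<equiv> tensor_null A scl"

lemma free_simps [simp]:
  "z \<in> carrier (free m) \<longleftrightarrow> Poly_Mapping.keys z \<subseteq> UNIV \<times> tuples m"
  "x \<otimes>\<^bsub>free m\<^esub> y = x + y" "\<one>\<^bsub>free m\<^esub> = 0"
  by (simp_all add: tensor_free_def)

lemma free_closed_add: "x \<in> carrier (free m) \<Longrightarrow> y \<in> carrier (free m) \<Longrightarrow> x + y \<in> carrier (free m)"
  using Poly_Mapping.keys_add[of x y] by auto

lemma free_closed_uminus: "x \<in> carrier (free m) \<Longrightarrow> - x \<in> carrier (free m)"
  by simp

lemma free_closed_sum: "(\<And>i. i \<in> J \<Longrightarrow> f i \<in> carrier (free m)) \<Longrightarrow> sum f J \<in> carrier (free m)"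
  by (induction J rule: infinite_finite_induct) (auto simp del: free_simps(1) intro: free_closed_add, auto)

lemma comm_group_free: "comm_group (free m)"
  unfolding tensor_free_def by (rule abelian_free_Abelian_group)

lemma tensor_relators_subset: "tensor_relators A scl m \<subseteq> carrier (free m)"
  using tensor_relators_closed by auto

lemma chain_beta_closed: "set l \<subseteq> carrier A \<Longrightarrow> chain_beta m x c l \<in> carrier (free m)"
proof (cases "length l = m + 2")
  case True
  assume "set l \<subseteq> carrier A"
  hence "l \<in> tuples (m + 2)" using True by (simp add: tuples_iff)
  then obtain a k b where "l = a # k @ [b]" "k \<in> tuples m" by (rule outer_cases)
  thus ?thesis by (simp add: chain_beta_outer tuples_iff)
qed (simp add: chain_beta_outside)

lemma chain_beta_units: "k \<in> tuples m \<Longrightarrow> chain_beta m x c (\<one> # k @ [\<one>]) = frag_of (scl c x, k)"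
  by (simp add: chain_beta_outer tuples_iff M.lact_one M.ract_one)

lemma chain_beta_scl:
  assumes "set l \<subseteq> carrier A"
  shows "chain_beta m (scl c x) c' l = chain_beta m x (c' * c) l"
proof (cases "length l = m + 2")
  case True
  hence "l \<in> tuples (m + 2)" using assms by (simp add: tuples_iff)
  then obtain a k b where "l = a # k @ [b]" "a \<in> carrier A" "b \<in> carrier A" "k \<in> tuples m" by (rule outer_cases)
  thus ?thesis by (simp add: chain_beta_outer tuples_iff M.ract_scale_left M.lact_scale_right)
qed (simp add: chain_beta_outside)

lemma chain_beta_add:
  assumes "set l \<subseteq> carrier A"
  shows "chain.cong_N m (chain_beta m (x + y) c l) (chain_beta m x c l + chain_beta m y c l)"
proof (cases "length l = m + 2")
  case True
  hence "l \<in> tuples (m + 2)" using assms by (simp add: tuples_iff)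
  then obtain a k b where "l = a # k @ [b]" "a \<in> carrier A" "b \<in> carrier A" "k \<in> tuples m" by (rule outer_cases)
  thus ?thesis
    by (simp add: chain_beta_outer tuples_iff M.ract_add_left M.lact_add_right S.scale_right_distrib relator_add)
qed (simp add: chain_beta_outside)

text \<open>
  A map on chains may be given by a family of balanced functions that is linear in the bimodule
  argument: each kind of relator of the tensor product is one of the three hypotheses or a slot
  property.
\<close>

lemma frag_extend_tnull:
  assumes bal: "\<And>x. chain.balanced m (\<Phi> x)"
    and add: "\<And>x y c l. set l \<subseteq> carrier A \<Longrightarrow> chain.cong_N m (\<Phi> (x + y) c l) (\<Phi> x c l + \<Phi> y c l)"
    and scale: "\<And>x c c' l. set l \<subseteq> carrier A \<Longrightarrow> chain.cong_N m (\<Phi> (scl c x) c' l) (\<Phi> x (c' * c) l)"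
    and h: "\<And>x k. k \<in> tuples p \<Longrightarrow> h (x, k) = \<Phi> x 1 (\<one> # k @ [\<one>])"
    and z: "z \<in> tnull p"
  shows "frag_extend h z \<in> tnull m"
  using z unfolding tensor_null_def[of A scl p]
proof (induction rule: generate.induct)
  case one
  show ?case by (simp add: tensor_null_zero)
next
  have rel: "frag_extend h r \<in> tnull m" if r: "r \<in> tensor_relators A scl p" for r
  proof -
    have upd: "as[i := x] = take i as @ x # drop (Suc i) as" if "as \<in> tuples p" "i < p" for as i x
      using that by (intro upd_conv_take_nth_drop) (simp add: tuples_iff)
    have mem: "take i as @ x # drop (Suc i) as \<in> tuples p" if "as \<in> tuples p" "i < p" "x \<in> carrier A" for as i x
      using that by (auto simp: tuples_iff dest: in_set_takeD in_set_dropD)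
    have car: "set (\<one> # take i as) \<subseteq> carrier A" "set (drop (Suc i) as @ [\<one>]) \<subseteq> carrier A" if "as \<in> tuples p" for as i
      using that by (auto simp: tuples_iff dest: in_set_takeD in_set_dropD)
    consider (add) x y as where "as \<in> tuples p" "r = frag_of (x + y, as) - frag_of (x, as) - frag_of (y, as)"
      | (slot) x as i a b where "as \<in> tuples p" "i < p" "a \<in> carrier A" "b \<in> carrier A"
          "r = frag_of (x, as[i := a \<oplus> b]) - frag_of (x, as[i := a]) - frag_of (x, as[i := b])"
      | (scale) c x as i a where "as \<in> tuples p" "i < p" "a \<in> carrier A"
          "r = frag_of (scl c x, as[i := a]) - frag_of (x, as[i := c \<odot> a])"
      using r unfolding tensor_relators_def by blast
    thus ?thesis
    proof cases
      case add: (add x y as)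
      have "set (\<one> # as @ [\<one>]) \<subseteq> carrier A" using add by (auto simp: tuples_iff)
      from assms(2)[OF this, of x y 1] show ?thesis
        using add(1) unfolding add(2) by (simp add: h frag_extend_diff frag_extend_add chain.cong_N_def diff_diff_eq)
    next
      case (slot x as i a b)
      have m3: "take i as @ a # drop (Suc i) as \<in> tuples p" "take i as @ b # drop (Suc i) as \<in> tuples p"
        "take i as @ (a \<oplus> b) # drop (Suc i) as \<in> tuples p"
        using slot by (auto intro!: mem)
      have "chain.cong_N m (\<Phi> x 1 ((\<one> # take i as) @ (a \<oplus> b) # drop (Suc i) as @ [\<one>]))
          (\<Phi> x 1 ((\<one> # take i as) @ a # drop (Suc i) as @ [\<one>])
           + \<Phi> x 1 ((\<one> # take i as) @ b # drop (Suc i) as @ [\<one>]))"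
        by (rule chain.balanced_slot_add[OF bal car(1) slot(3,4) car(2)]) (use slot in auto)
      thus ?thesis
        using slot m3 by (simp add: upd h frag_extend_diff frag_extend_add chain.cong_N_def diff_diff_eq)
    next
      case sc: (scale c x as i a)
      have m2: "take i as @ a # drop (Suc i) as \<in> tuples p" "take i as @ (c \<odot> a) # drop (Suc i) as \<in> tuples p"
        using sc by (auto intro!: mem)
      have 1: "chain.cong_N m (\<Phi> x 1 ((\<one> # take i as) @ (c \<odot> a) # drop (Suc i) as @ [\<one>]))
          (\<Phi> x (1 * c) ((\<one> # take i as) @ a # drop (Suc i) as @ [\<one>]))"
        by (rule chain.balanced_slot_smult[OF bal car(1) sc(3) car(2)]) (use sc in auto)
      have 2: "chain.cong_N m (\<Phi> (scl c x) 1 ((\<one> # take i as) @ a # drop (Suc i) as @ [\<one>]))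
          (\<Phi> x (1 * c) ((\<one> # take i as) @ a # drop (Suc i) as @ [\<one>]))"
        by (rule assms(3)) (use sc car in auto)
      show ?thesis
        using chain.cong_trans[OF 2 chain.cong_sym[OF 1]] sc m2
        by (simp add: upd h frag_extend_diff chain.cong_N_def)
    qed
  qed
  case (incl r)
  thus ?case by (rule rel)
  case (inv r)
  hence "Poly_Mapping.keys r \<subseteq> UNIV \<times> tuples p" by (rule tensor_relators_closed)
  hence "inv\<^bsub>free p\<^esub> r = - r" by (simp add: tensor_free_def)
  thus ?case using tensor_null_uminus[OF rel[OF inv]] by (simp add: frag_extend_minus)
next
  case (eng x y)
  thus ?case by (simp add: frag_extend_add tensor_null_add)
qed

lemma bd_eq_dual_bar:
  assumes "k \<in> tuples (Suc m)"
  shows "hochschild_boundary_gen A lact ract (x, k) = chain.dual_bar (chain_beta m x) 1 (\<one> # k @ [\<one>])"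
  using bd_chain_beta[of "\<one> # k @ [\<one>]" m x 1] unit_outer[OF assms] chain_beta_units[OF assms]
  by (simp add: numeral_3_eq_3)

lemma chain_dual_bar_add:
  assumes "set l \<subseteq> carrier A"
  shows "chain.cong_N m (chain.dual_bar (chain_beta m (x + y)) c l)
    (chain.dual_bar (chain_beta m x) c l + chain.dual_bar (chain_beta m y) c l)"
  using chain.dual_bar_cong[where m = m and l = l and c = c and \<beta> = "chain_beta m (x + y)" and \<beta>' = "\<lambda>c l. chain_beta m x c l + chain_beta m y c l"]
    chain_beta_add assms by (simp add: chain.dual_bar_add)

lemma chain_dual_bar_scl:
  assumes "set l \<subseteq> carrier A"
  shows "chain.cong_N m (chain.dual_bar (chain_beta m (scl c x)) c' l) (chain.dual_bar (chain_beta m x) (c' * c) l)"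
  using chain.dual_bar_cong[where m = m and l = l and c = c' and \<beta> = "chain_beta m (scl c x)" and \<beta>' = "\<lambda>c' l. chain_beta m x (c * c') l"]
    assms chain.dual_bar_scale[of "chain_beta m x" c c' l] by (simp add: chain_beta_scl mult.commute)

lemma bd_tnull: "z \<in> tnull (Suc m) \<Longrightarrow> bd z \<in> tnull m"
  by (rule frag_extend_tnull[where \<Phi> = "\<lambda>x. chain.dual_bar (chain_beta m x)" and p = "Suc m"])
     (auto intro: chain.balanced_dual_bar balanced_chain_beta chain_dual_bar_add chain_dual_bar_scl bd_eq_dual_bar)

lemma dual_bar_closed:
  assumes "\<And>c l. set l \<subseteq> carrier A \<Longrightarrow> \<beta> c l \<in> carrier (free m)" "set l \<subseteq> carrier A"
  shows "chain.dual_bar \<beta> c l \<in> carrier (free m)"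
proof -
  have "set (contract A i l) \<subseteq> carrier A" if "i < length l - 1" for i
    using that assms(2) by (auto simp: contract_def dest: in_set_takeD in_set_dropD intro!: m_closed)
  hence "\<beta> c (contract A i l) \<in> carrier (free m)" if "i < length l - 1" for i
    using that assms(1) by blast
  thus ?thesis unfolding chain.dual_bar_contract
    by (intro free_closed_sum) (auto simp del: free_simps(1) intro: free_closed_uminus)
qed

lemma frag_extend_closed:
  assumes "z \<in> carrier (free p)" "\<And>x k. k \<in> tuples p \<Longrightarrow> h (x, k) \<in> carrier (free m)"
  shows "frag_extend h z \<in> carrier (free m)"
proof -
  have "Poly_Mapping.keys z \<subseteq> UNIV \<times> tuples p" using assms(1) by simp
  thus ?thesis
  proof (induction rule: frag_induction)
    case (diff a b)
    thus ?case using free_closed_add[OF _ free_closed_uminus] by (fastforce simp: frag_extend_diff simp del: free_simps(1))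
  qed (use assms(2) in auto)
qed

lemma bd_closed: "z \<in> carrier (free (Suc m)) \<Longrightarrow> bd z \<in> carrier (free m)"
proof (erule frag_extend_closed)
  fix x and k :: "'a list" assume k: "k \<in> tuples (Suc m)"
  hence "set (\<one> # k @ [\<one>]) \<subseteq> carrier A" by (auto simp: tuples_iff)
  thus "hochschild_boundary_gen A lact ract (x, k) \<in> carrier (free m)"
    unfolding bd_eq_dual_bar[OF k] by (intro dual_bar_closed chain_beta_closed)
qed

lemma bd_bd:
  assumes "z \<in> carrier (free (Suc (Suc m)))"
  shows "bd (bd z) \<in> tnull m"
proof -
  have "Poly_Mapping.keys z \<subseteq> UNIV \<times> tuples (Suc (Suc m))" using assms by simp
  thus ?thesis
  proof (induction rule: frag_induction)
    case (one y)
    then obtain x k where y: "y = (x, k)" and k: "k \<in> tuples (Suc (Suc m))" by (cases y) auto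
    let ?l = "\<one> # k @ [\<one>]"
    have l: "set ?l \<subseteq> carrier A" "length ?l = m + 4" using k by (auto simp: tuples_iff)
    have "bd (bd (frag_of y)) = chain.dual_bar (\<lambda>c l. bd (chain_beta (Suc m) x c l)) 1 ?l"
      using chain.dual_bar_hom[of bd "chain_beta (Suc m) x" 1 ?l] by (simp add: y bd_eq_dual_bar[OF k] frag_extend_add)
    also have "chain.cong_N m \<dots> (chain.dual_bar (chain.dual_bar (chain_beta m x)) 1 ?l)"
    proof (rule chain.dual_bar_cong[OF _ l(1)])
      fix c l' assume "set l' \<subseteq> carrier A" "Suc (length l') = length ?l"
      hence "l' \<in> tuples (m + 3)" using l by (simp add: tuples_iff)
      thus "chain.cong_N m (bd (chain_beta (Suc m) x c l')) (chain.dual_bar (chain_beta m x) c l')"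
        by (simp add: bd_chain_beta)
    qed
    also have "chain.cong_N m \<dots> 0"
      by (rule chain.dual_bar_square[OF balanced_chain_beta l(1)])
    finally show ?case by (simp add: chain.cong_N_def)
  next
    case (diff a b)
    thus ?case using tensor_null_add[OF _ tensor_null_uminus] by (fastforce simp: frag_extend_diff)
  qed (simp add: tensor_null_zero)
qed

text \<open>
  The contraction of the bar resolution acts on chains through \<open>chain_beta\<close>. The maps \<open>s\<close> and
  \<open>s'\<close> obtained in two neighbouring degrees form a homotopy \<open>bd s' + s bd = 1\<close> modulo relations, so a
  cycle \<open>z\<close> is the boundary of \<open>s' z\<close>.
\<close>

lemma chain_exact:
  assumes S: "null_map S" "null_map S'"
    and hom: "\<And>w. w \<in> tensors (Suc (Suc (Suc m))) \<Longrightarrow> bar (S' w) + S (bar w) - w \<in> null"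
    and z: "z \<in> carrier (free (Suc m))" and cycle: "bd z \<in> tnull m"
  shows "\<exists>y\<in>carrier (free (Suc (Suc m))). z - bd y \<in> tnull (Suc m)"
proof -
  define H where "H x c l = chain.pull S (chain_beta (Suc m) x) c l" for x c l
  define s where "s = frag_extend (\<lambda>(x, k). H x 1 (\<one> # k @ [\<one>]))"
  define s' where "s' = frag_extend (\<lambda>(x, k). chain.pull S' (chain_beta (Suc (Suc m)) x) 1 (\<one> # k @ [\<one>]))"
  have bal: "chain.balanced (Suc m) (chain_beta (Suc m) x)" for x by (rule balanced_chain_beta)
  have pull_closed: "chain.pull R (chain_beta r x) c l \<in> carrier (free r)" for R r x c l
    unfolding chain.pull_def chain.ev_def by (intro free_closed_sum chain_beta_closed) auto
  have s_null: "s y \<in> tnull (Suc m)" if "y \<in> tnull m" for y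
    unfolding s_def
  proof (rule frag_extend_tnull[where \<Phi> = H, OF _ _ _ _ that])
    show "chain.balanced (Suc m) (H x)" for x
      using chain.balanced_pull[OF S(1) bal[of x]] by (simp add: H_def[abs_def])
    show "chain.cong_N (Suc m) (H (x + y) c l) (H x c l + H y c l)" for x y c l
    proof -
      have "H x c l + H y c l = chain.pull S (\<lambda>c l. chain_beta (Suc m) x c l + chain_beta (Suc m) y c l) c l"
        by (simp add: H_def chain.pull_def chain.ev_def sum.distrib)
      thus ?thesis unfolding H_def[of "x + y"] using chain.pull_cong[OF chain_beta_add] by simp
    qed
    show "chain.cong_N (Suc m) (H (scl c x) c' l) (H x (c' * c) l)" for c x c' l
    proof -
      have "chain.cong_N (Suc m) (H (scl c x) c' l) (chain.pull S (\<lambda>c' l. chain_beta (Suc m) x (c * c') l) c' l)"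
        unfolding H_def by (rule chain.pull_cong) (simp add: chain_beta_scl mult.commute)
      also have "chain.cong_N (Suc m) \<dots> (H x (c * c') l)"
        unfolding H_def by (rule chain.pull_scale[OF S(1) bal])
      finally show ?thesis by (simp add: mult.commute)
    qed
  qed simp
  have outer: "chain.cong_N (Suc m) (s (chain_beta m x c l)) (H x c l)" if "l \<in> tuples (m + 2)" for x c l
  proof -
    obtain a k b where ab: "l = a # k @ [b]" "a \<in> carrier A" "b \<in> carrier A" "k \<in> tuples m"
      using \<open>l \<in> tuples (m + 2)\<close> by (rule outer_cases)
    have k: "set k \<subseteq> carrier A" using ab(4) by (simp add: tuples_iff)
    let ?y = "scl c (lact b (ract x a))"
    have "chain.cong_N (Suc m) (chain.pull S (chain_beta (Suc m) x) c (a # k @ [b]))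
        (chain.pull S (chain_beta (Suc m) ?y) 1 (\<one> # k @ [\<one>]))"
    proof (rule chain.pull_outer[OF S(1) bal ab(2,3) k])
      fix c' l assume l: "set l \<subseteq> carrier A"
      have "chain.beta_left a (chain.beta_right b (chain_beta (Suc m) x)) (c * c') l = chain_beta (Suc m) ?y c' l"
      proof (cases "length l = Suc m + 2")
        case True
        hence "l \<in> tuples (Suc m + 2)" using l by (simp add: tuples_iff)
        then obtain d k e where l: "l = d # k @ [e]" "d \<in> carrier A" "e \<in> carrier A" "k \<in> tuples (Suc m)"
          by (rule outer_cases)
        have "chain.beta_left a (chain.beta_right b (chain_beta (Suc m) x)) (c * c') l
            = chain_beta (Suc m) x (c * c') ((a \<otimes> d) # k @ [e \<otimes> b])"
          using chain.beta_right_snoc[of b "chain_beta (Suc m) x" "c * c'" "(a \<otimes> d) # k" e] by (simp add: l(1))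
        thus ?thesis using l ab
          by (simp add: chain_beta_outer tuples_iff M.lact_mult M.ract_mult M.lact_ract
              M.lact_scale_right M.ract_scale_left mult.commute)
      next
        case False
        moreover have "chain.beta_left a (chain.beta_right b (chain_beta (Suc m) x)) (c * c') l = 0"
          using False unfolding chain.beta_left_apply chain.beta_right_apply
          by (cases l) (auto intro!: chain_beta_outside)
        ultimately show ?thesis by (simp add: chain_beta_outside)
      qed
      thus "chain.cong_N (Suc m) (chain.beta_left a (chain.beta_right b (chain_beta (Suc m) x)) (c * c') l) (chain_beta (Suc m) ?y c' l)"
        by simp
    qed
    moreover have "s (chain_beta m x c l) = H ?y 1 (\<one> # k @ [\<one>])"
      using ab by (simp add: chain_beta_outer tuples_iff s_def)
    ultimately show ?thesis using chain.cong_sym by (simp add: H_def ab(1))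
  qed
  have homotopy: "y - (bd (s' y) + s (bd y)) \<in> tnull (Suc m)" if "Poly_Mapping.keys y \<subseteq> UNIV \<times> tuples (Suc m)" for y
    using that
  proof (induction rule: frag_induction)
    case zero
    show ?case by (simp add: s_def s'_def tensor_null_zero)
  next
    case (diff a b)
    have "(a - b) - (bd (s' (a - b)) + s (bd (a - b))) = (a - (bd (s' a) + s (bd a))) + - (b - (bd (s' b) + s (bd b)))"
      by (simp add: s_def s'_def frag_extend_diff)
    thus ?case using tensor_null_add[OF diff(1) tensor_null_uminus[OF diff(2)]] by (simp only:)
  next
    case (one u)
    then obtain x k where u: "u = (x, k)" and k: "k \<in> tuples (Suc m)" by (cases u) auto
    let ?l = "\<one> # k @ [\<one>]"
    have l: "set ?l \<subseteq> carrier A" "length ?l = Suc (Suc (Suc m))" using k by (auto simp: tuples_iff)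
    have "bd (s' (frag_of u)) = chain.pull S' (\<lambda>c l. bd (chain_beta (Suc (Suc m)) x c l)) 1 ?l"
      using chain.pull_hom[of bd S' "chain_beta (Suc (Suc m)) x" 1 ?l] by (simp add: u s'_def frag_extend_add)
    also have "chain.cong_N (Suc m) \<dots> (chain.pull S' (chain.dual_bar (chain_beta (Suc m) x)) 1 ?l)"
    proof (rule chain.pull_cong)
      fix c l' assume l': "set l' \<subseteq> carrier A"
      show "chain.cong_N (Suc m) (bd (chain_beta (Suc (Suc m)) x c l')) (chain.dual_bar (chain_beta (Suc m) x) c l')"
      proof (cases "length l' = Suc m + 3")
        case True
        hence "l' \<in> tuples (Suc m + 3)" using l' by (simp add: tuples_iff)
        thus ?thesis by (simp add: bd_chain_beta)
      next
        case False
        have "chain.cong_N (Suc m) (chain.dual_bar (chain_beta (Suc m) x) c l') 0"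
          using False l' by (intro chain.dual_bar_outside) (auto intro!: chain_beta_outside)
        thus ?thesis using False by (simp add: chain_beta_outside chain.cong_sym)
      qed
    qed
    finally have 1: "chain.cong_N (Suc m) (bd (s' (frag_of u))) (chain.pull S' (chain.dual_bar (chain_beta (Suc m) x)) 1 ?l)" .
    have "s (bd (frag_of u)) = chain.dual_bar (\<lambda>c l. s (chain_beta m x c l)) 1 ?l"
      using chain.dual_bar_hom[of s "chain_beta m x" 1 ?l] by (simp add: u bd_eq_dual_bar[OF k] s_def frag_extend_add)
    also have "chain.cong_N (Suc m) \<dots> (chain.dual_bar (H x) 1 ?l)"
      by (rule chain.dual_bar_cong[OF _ l(1)]) (use l(2) in \<open>auto intro!: outer simp: tuples_iff\<close>)
    finally have 2: "chain.cong_N (Suc m) (s (bd (frag_of u))) (chain.dual_bar (H x) 1 ?l)" .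
    have "chain.cong_N (Suc m) (bd (s' (frag_of u)) + s (bd (frag_of u))) (chain_beta (Suc m) x 1 ?l)"
      using chain.cong_trans[OF chain.cong_add[OF 1 2]] chain.pull_homotopy[OF S hom bal l, of x 1]
      by (simp add: H_def[abs_def])
    thus ?case using chain.cong_sym[of "Suc m"] chain_beta_units[OF k, of x 1] by (simp add: chain.cong_N_def u)
  qed
  have "z - bd (s' z) = (z - (bd (s' z) + s (bd z))) + s (bd z)" by simp
  also have "\<dots> \<in> tnull (Suc m)"
    using z by (intro tensor_null_add homotopy s_null cycle) simp
  finally have "z - bd (s' z) \<in> tnull (Suc m)" .
  moreover have "s' z \<in> carrier (free (Suc (Suc m)))"
    unfolding s'_def by (rule frag_extend_closed[OF z]) (simp only: case_prod_conv pull_closed)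
  ultimately show ?thesis by blast
qed

abbreviation chains :: "nat \<Rightarrow> (('m \<times> 'a list) \<Rightarrow>\<^sub>0 int) set monoid"
  where "chains \<equiv> hochschild_chains A scl"

definition coset :: "nat \<Rightarrow> (('m \<times> 'a list) \<Rightarrow>\<^sub>0 int) \<Rightarrow> (('m \<times> 'a list) \<Rightarrow>\<^sub>0 int) set"
  where "coset m z = tnull m #>\<^bsub>free m\<^esub> z"

lemma coset_eq: "coset m z = {n + z | n. n \<in> tnull m}"
  by (auto simp: coset_def r_coset_def)

lemma coset_cong: "coset m y = coset m z \<longleftrightarrow> y - z \<in> tnull m"
proof
  assume "coset m y = coset m z"
  moreover have "y \<in> coset m y" using tensor_null_zero by (force simp: coset_eq)
  ultimately obtain n where "n \<in> tnull m" "y = n + z" by (auto simp: coset_eq)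
  thus "y - z \<in> tnull m" by simp
next
  assume yz: "y - z \<in> tnull m"
  have "n + y \<in> coset m z" if "n \<in> tnull m" for n
    using tensor_null_add[OF that yz] by (force simp: coset_eq intro: exI[of _ "n + (y - z)"])
  moreover have "n + z \<in> coset m y" if "n \<in> tnull m" for n
    using tensor_null_add[OF that tensor_null_uminus[OF yz]] by (force simp: coset_eq intro: exI[of _ "n - (y - z)"])
  ultimately show "coset m y = coset m z"
    unfolding coset_eq[of m y] coset_eq[of m z] by (auto simp: coset_eq)
qed

lemma normal_tnull: "tnull m \<lhd> free m"
proof -
  interpret G: comm_group "free m" by (rule comm_group_free)
  have "subgroup (tnull m) (free m)"
    unfolding tensor_null_def by (rule G.generate_is_subgroup[OF tensor_relators_subset])
  thus ?thesis by (rule G.subgroup_imp_normal)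
qed

lemma group_chains: "group (chains m)"
  unfolding hochschild_chains_def by (rule normal.factorgroup_is_group[OF normal_tnull])

lemma carrier_chains: "carrier (chains m) = coset m ` carrier (free m)"
  by (auto simp: hochschild_chains_def FactGroup_def RCOSETS_def coset_def)

lemma mult_coset:
  "y \<in> carrier (free m) \<Longrightarrow> z \<in> carrier (free m) \<Longrightarrow> coset m y \<otimes>\<^bsub>chains m\<^esub> coset m z = coset m (y + z)"
  using normal.rcos_sum[OF normal_tnull, of y m z] by (simp add: hochschild_chains_def FactGroup_def coset_def)

lemma one_coset: "\<one>\<^bsub>chains m\<^esub> = coset m 0"
  by (auto simp: hochschild_chains_def FactGroup_def coset_eq)

lemma boundary_coset:
  "hochschild_boundary A scl lact ract (Suc m) (coset (Suc m) z) = coset m (bd z)"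
proof -
  have "coset m (bd (n + z)) = coset m (bd z)" if "n \<in> tnull (Suc m)" for n
    using bd_tnull[OF that] by (simp add: coset_cong frag_extend_add)
  hence "(\<Union>y\<in>coset (Suc m) z. coset m (bd y)) = coset m (bd z)"
    unfolding coset_eq[of "Suc m"] using tensor_null_zero by blast
  thus ?thesis by (simp add: hochschild_boundary_def coset_def)
qed

lemma boundary_hom:
  "hochschild_boundary A scl lact ract (Suc m) \<in> hom (chains (Suc m)) (chains m)"
proof (rule homI)
  fix u v assume "u \<in> carrier (chains (Suc m))" "v \<in> carrier (chains (Suc m))"
  then obtain y z where y: "y \<in> carrier (free (Suc m))" "u = coset (Suc m) y"
    and z: "z \<in> carrier (free (Suc m))" "v = coset (Suc m) z"
    unfolding carrier_chains by blast
  show "hochschild_boundary A scl lact ract (Suc m) (u \<otimes>\<^bsub>chains (Suc m)\<^esub> v)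
    = hochschild_boundary A scl lact ract (Suc m) u \<otimes>\<^bsub>chains m\<^esub> hochschild_boundary A scl lact ract (Suc m) v"
    unfolding y(2) z(2) mult_coset[OF y(1) z(1)] boundary_coset mult_coset[OF bd_closed[OF y(1)] bd_closed[OF z(1)]]
    by (simp add: frag_extend_add)
next
  fix u assume "u \<in> carrier (chains (Suc m))"
  then obtain y where "y \<in> carrier (free (Suc m))" "u = coset (Suc m) y"
    unfolding carrier_chains by blast
  thus "hochschild_boundary A scl lact ract (Suc m) u \<in> carrier (chains m)"
    using bd_closed unfolding carrier_chains by (auto simp: boundary_coset simp del: free_simps(1))
qed

theorem homology_trivial:
  assumes S: "null_map S" "null_map S'"
    and hom: "\<And>w. w \<in> tensors (Suc (Suc m)) \<Longrightarrow> bar (S' w) + S (bar w) - w \<in> null" and m: "m > 0"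
  shows "trivial_group (hochschild_homology A scl lact ract m)"
proof -
  obtain p where p: "m = Suc p" using m by (cases m) auto
  let ?d = "hochschild_boundary A scl lact ract"
  let ?Z = "kernel (chains m) (chains p) (?d m)"
  interpret h: group_hom "chains m" "chains p" "?d m"
    unfolding p by (intro group_hom.intro group_hom_axioms.intro group_chains boundary_hom)
  have "?d (Suc m) ` carrier (chains (Suc m)) = ?Z"
  proof (intro equalityI subsetI)
    fix u assume "u \<in> ?d (Suc m) ` carrier (chains (Suc m))"
    then obtain z where z: "z \<in> carrier (free (Suc m))" "u = coset m (bd z)"
      unfolding carrier_chains by (auto simp: boundary_coset simp del: free_simps(1))
    have "bd (bd z) \<in> tnull p" using bd_bd z(1) p by blast
    hence "?d m u = \<one>\<^bsub>chains p\<^esub>"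
      unfolding z(2) p boundary_coset one_coset coset_cong by simp
    moreover have "u \<in> carrier (chains m)"
      using bd_closed[OF z(1)] z(2) unfolding carrier_chains by blast
    ultimately show "u \<in> ?Z" by (simp add: kernel_def)
  next
    fix u assume "u \<in> ?Z"
    hence u: "u \<in> carrier (chains m)" "?d m u = \<one>\<^bsub>chains p\<^esub>" by (auto simp: kernel_def)
    then obtain z where z: "z \<in> carrier (free m)" "u = coset m z" unfolding carrier_chains by blast
    have "bd z \<in> tnull p" using u(2) unfolding z(2) p boundary_coset one_coset coset_cong by simp
    then obtain y where y: "y \<in> carrier (free (Suc m))" "z - bd y \<in> tnull m"
      using chain_exact[OF S hom[unfolded p] z(1)[unfolded p]] p by blast
    have "u = ?d (Suc m) (coset (Suc m) y)"
      unfolding z(2) boundary_coset coset_cong by (rule y(2))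
    thus "u \<in> ?d (Suc m) ` carrier (chains (Suc m))"
      using y(1) unfolding carrier_chains by blast
  qed
  thus ?thesis
    unfolding hochschild_homology_def hochschild_cycles_def
    using trivial_self_quotient[OF group_chains h.subgroup_kernel] by (simp add: p)
qed

end

theorem theorem7p4:
  fixes F :: "'k::field^'n::finite^'n"
    and t :: 'k
    and scl :: "'k \<Rightarrow> 'm::ab_group_add \<Rightarrow> 'm"
    and lact :: "('n, 'k) free_algebra set \<Rightarrow> 'm \<Rightarrow> 'm"
    and ract :: "'m \<Rightarrow> ('n, 'k) free_algebra set \<Rightarrow> 'm"
    and m :: nat
  assumes "CARD('n) \<ge> 2"
    and "invertible F"
    and "t \<in> {0, 1}"
    and "alg_bimodule (AFt F t) scl lact ract"
    and "m > 2"
  shows "trivial_group (hochschild_homology (AFt F t) scl lact ract m) \<and>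
         trivial_group (hochschild_cohomology (AFt F t) scl lact ract m)"
proof -
  interpret Q: quadratic_relation F t
    by (rule quadratic_relation.intro[OF assms(1,2)])
  interpret B: bimodule_presentation Q.I "AFt F t" Q.cls scl lact ract
    by (intro bimodule_presentation.intro bimodule_presentation_axioms.intro
        Q.algebra_presentation_axioms assms(4))
  have "4 \<le> Suc m" using assms(5) by simp
  then obtain S S' where "Q.null_map S" "Q.null_map S'"
    "\<And>w. w \<in> tensors (Suc (Suc m)) \<Longrightarrow> bar (S' w) + S (bar w) - w \<in> Q.null"
    by (rule Q.bar_contraction) blast
  thus ?thesis
    using B.homology_trivial B.cohomology_trivial assms(5) by simp
qed

end
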